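(* Let $(X,\mathcal{X},\mu,T)$ be a system and let $f\in L^\infty(\mu)$ be such that $|||f|||_{d+s}=0$ for some $d,s\in\mathbb{N}_0$. Then $$\lim_{H\to\infty}\frac1{H^{2s}}\sum_{\underline h,\underline h'\in[H]^s}|||f_{\underline h,\underline h'}|||_d=0,$$ where for $\underline h,\underline h'\in\mathbb{N}^s$, $$f_{\underline h,\underline h'}:=\prod_{\epsilon\in\{0,1\}^s}\mathcal{C}^{|\epsilon|}\,\mathcal{D}_{d+1}\big(\Delta_{\underline h^\epsilon}f\big).$$
   Context: A system $(X,\mathcal{X},\mu,T)$ is an invertible measure-preserving transformation $T$ of a Lebesgue probability space; $T^nf:=f\circ T^n$; $[H]:=\{1,\ldots,H\}$; $\mathcal{C}z:=\overline z$ is complex conjugation; for $\epsilon\in\{0,1\}^s$, $|\epsilon|:=\epsilon_1+\cdots+\epsilon_s$ and $\epsilon\cdot\underline h:=\epsilon_1h_1+\cdots+\epsilon_sh_s$. For $h\in\mathbb{Z}$, $\Delta_hf:=f\cdot T^h\overline f$, and for $\underline h=(h_1,\ldots,h_s)$, $\Delta_{\underline h}f:=\Delta_{h_1}\cdots\Delta_{h_s}f=\prod_{\epsilon\in\{0,1\}^s}\mathcal{C}^{|\epsilon|}T^{\epsilon\cdot\underline h}f$. For $\underline h,\underline h'\in\mathbb{N}^s$ and $\epsilon\in\{0,1\}^s$, $\underline h^\epsilon:=(h_1^{\epsilon_1},\ldots,h_s^{\epsilon_s})$ where $h_j^0:=h_j$ and $h_j^1:=h_j'$ (superscripts select coordinates;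 they are not powers). For $s=0$ there is no averaging and $f_{\underline h,\underline h'}=\mathcal{D}_{d+1}(f)$. Gowers-Host-Kra seminorms: $|||f|||_0:=\int f\,d\mu$ (not a seminorm) and for $s\ge0$, $|||f|||_{s+1}^{2^{s+1}}:=\lim_{H\to\infty}\frac1H\sum_{h=1}^H|||\Delta_hf|||_s^{2^s}$ (the limits exist). Dual functions: for $r\in\mathbb{N}$ and $f\in L^\infty(\mu)$, $$\mathcal{D}_r(f):=\lim_{M\to\infty}\frac1{M^r}\sum_{\underline m\in[M]^r}\ \prod_{\epsilon\in\{0,1\}^r\setminus\{\underline0\}}\mathcal{C}^{|\epsilon|}T^{\epsilon\cdot\underline m}f,$$ where the limit is known to exist in $L^2(\mu)$. *)

theory Defs
  imports "HOL-Probability.Probability"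
begin

text \<open>
  A Lebesgue probability space is a complete probability space isomorphic modulo null sets to the
  completion of a Borel probability measure on a Polish space. By the Borel isomorphism theorem
  the Polish space can be taken to be the real line, which avoids quantifying over types.
\<close>

definition isomorphic_mod_0 :: "'a measure \<Rightarrow> 'b measure \<Rightarrow> bool" where
  "isomorphic_mod_0 M N \<longleftrightarrow>
     (\<exists>A\<in>sets M. \<exists>B\<in>sets N. \<exists>\<phi>.
        space M - A \<in> null_sets M \<and> space N - B \<in> null_sets N \<and>
        bij_betw \<phi> A B \<and>
        \<phi> \<in> measurable (restrict_space M A) (restrict_space N B) \<and>
        the_inv_into A \<phi> \<in> measurable (restrict_space N B) (restrict_space M A) \<and>
        distr (restrict_space M A) (restrict_space N B) \<phi> = restrict_space N B)"

definition lebesgue_prob_space :: "'a measure \<Rightarrow> bool" where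
  "lebesgue_prob_space M \<longleftrightarrow>
     prob_space M \<and> complete_measure M \<and>
     (\<exists>N :: real measure. prob_space N \<and> sets N = sets borel \<and>
        isomorphic_mod_0 M (completion N))"

locale mp_system =
  fixes M :: "'a measure" and T :: "'a \<Rightarrow> 'a"
  assumes lebesgue: "lebesgue_prob_space M"
    and bij: "bij_betw T (space M) (space M)"
    and meas: "T \<in> measurable M M"
    and meas_inv: "the_inv_into (space M) T \<in> measurable M M"
    and preserving: "distr M M T = M"

text \<open>
  Elements of \<open>L\<^sup>\<infinity>\<close> and \<open>L\<^sup>2\<close> are represented by functions, with no identification
  of functions that agree almost everywhere.
\<close>

definition Linf :: "'a measure \<Rightarrow> ('a \<Rightarrow> complex) set" where
  "Linf M = {f \<in> borel_measurable M. \<exists>C. AE x in M. norm (f x) \<le> C}"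

definition L2_tendsto :: "'a measure \<Rightarrow> (nat \<Rightarrow> 'a \<Rightarrow> complex) \<Rightarrow> ('a \<Rightarrow> complex) \<Rightarrow> bool" where
  "L2_tendsto M F g \<longleftrightarrow>
     g \<in> borel_measurable M \<and> integrable M (\<lambda>x. (norm (g x))\<^sup>2) \<and>
     (\<lambda>n. \<integral>\<^sup>+ x. ennreal ((norm (F n x - g x))\<^sup>2) \<partial>M) \<longlonglongrightarrow> 0"

definition shift :: "('a \<Rightarrow> 'a) \<Rightarrow> nat \<Rightarrow> ('a \<Rightarrow> complex) \<Rightarrow> 'a \<Rightarrow> complex" where
  "shift T n f = (\<lambda>x. f ((T ^^ n) x))"

definition mderiv :: "('a \<Rightarrow> 'a) \<Rightarrow> nat \<Rightarrow> ('a \<Rightarrow> complex) \<Rightarrow> 'a \<Rightarrow> complex" where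
  "mderiv T h f = (\<lambda>x. f x * cnj (shift T h f x))"

text \<open>
  A vector of length \<open>s\<close> is a function on the indices \<open>0, \<dots>, s - 1\<close>. The iterated derivative
  is \<open>\<Delta>\<close> with shift \<open>h 0\<close> applied last: \<open>\<Delta>\<^bsub>h 0\<^esub> (\<Delta>\<^bsub>h 1\<^esub> (\<dots> \<Delta>\<^bsub>h (s-1)\<^esub> f))\<close>.
\<close>

definition mderivs ::
    "('a \<Rightarrow> 'a) \<Rightarrow> nat \<Rightarrow> (nat \<Rightarrow> nat) \<Rightarrow> ('a \<Rightarrow> complex) \<Rightarrow> 'a \<Rightarrow> complex" where
  "mderivs T s h f = foldr (\<lambda>j. mderiv T (h j)) [0..<s] f"

definition grid :: "nat \<Rightarrow> nat \<Rightarrow> (nat \<Rightarrow> nat) set" where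
  "grid s H = {..<s} \<rightarrow>\<^sub>E {1..H}"

definition cube :: "nat \<Rightarrow> (nat \<Rightarrow> nat) set" where
  "cube s = {..<s} \<rightarrow>\<^sub>E {0, 1}"

definition weight :: "nat \<Rightarrow> (nat \<Rightarrow> nat) \<Rightarrow> nat" where
  "weight s \<epsilon> = (\<Sum>j<s. \<epsilon> j)"

definition select :: "(nat \<Rightarrow> nat) \<Rightarrow> (nat \<Rightarrow> nat) \<Rightarrow> (nat \<Rightarrow> nat) \<Rightarrow> nat \<Rightarrow> nat" where
  "select \<epsilon> h h' = (\<lambda>j. if \<epsilon> j = 0 then h j else h' j)"

text \<open>
  The seminorm of degree 0 is the integral, a complex number, so all degrees take values in
  \<open>complex\<close>. The limits in positive degree exist and are non-negative reals, so taking the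
  real part before the root is only a change of type.
\<close>

primrec ghk :: "'a measure \<Rightarrow> ('a \<Rightarrow> 'a) \<Rightarrow> nat \<Rightarrow> ('a \<Rightarrow> complex) \<Rightarrow> complex" where
  "ghk M T 0 f = (LINT x|M. f x)"
| "ghk M T (Suc s) f =
     complex_of_real (root (2 ^ Suc s)
       (Re (lim (\<lambda>H. (\<Sum>h=1..H. ghk M T s (mderiv T h f) ^ (2 ^ s)) / of_nat H))))"

definition dual_avg ::
    "('a \<Rightarrow> 'a) \<Rightarrow> nat \<Rightarrow> ('a \<Rightarrow> complex) \<Rightarrow> nat \<Rightarrow> 'a \<Rightarrow> complex" where
  "dual_avg T r f N = (\<lambda>x.
     (\<Sum>m\<in>grid r N. \<Prod>\<epsilon>\<in>cube r - {\<lambda>j\<in>{..<r}. 0}.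
        (cnj ^^ weight r \<epsilon>) (shift T (\<Sum>j<r. \<epsilon> j * m j) f x)) / of_nat N ^ r)"

text \<open>
  The limit in \<open>L\<^sup>2\<close> exists for \<open>f\<close> in \<open>L\<^sup>\<infinity>\<close> and is unique up to null sets;
  \<open>dual_fun\<close> picks one representative.
\<close>

definition dual_fun ::
    "'a measure \<Rightarrow> ('a \<Rightarrow> 'a) \<Rightarrow> nat \<Rightarrow> ('a \<Rightarrow> complex) \<Rightarrow> 'a \<Rightarrow> complex" where
  "dual_fun M T r f = (SOME g. L2_tendsto M (dual_avg T r f) g)"

definition dual_cube_prod ::
    "'a measure \<Rightarrow> ('a \<Rightarrow> 'a) \<Rightarrow> nat \<Rightarrow> nat \<Rightarrow> ('a \<Rightarrow> complex) \<Rightarrow>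
      (nat \<Rightarrow> nat) \<Rightarrow> (nat \<Rightarrow> nat) \<Rightarrow> 'a \<Rightarrow> complex" where
  "dual_cube_prod M T d s f h h' = (\<lambda>x.
     \<Prod>\<epsilon>\<in>cube s. (cnj ^^ weight s \<epsilon>)
        (dual_fun M T (Suc d) (mderivs T s (select \<epsilon> h h') f) x))"

end

(*
  Write f_{h,h'} for the product of dual functions, and let r = d + s. The power |||f_{h,h'}|||_d^{2^d}
  is an iterated average over n of integrals of Delta_n f_{h,h'}. Expand one of the factors
  D_{d+1}(Delta_h f) of the integrand as an average over m. The substitution h_j -> h_j + rho_{d+j},
  n_i -> n_i + rho_i, m_i -> m_i + rho_i, x -> T^{-(rho_1 + ... + rho_d)} x leaves these averages
  asymptotically unchanged. Afterwards a single factor, a translate of f, depends on all the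
  coordinates of rho; every other factor ignores at least one of them. Hence r applications of the
  Cauchy-Schwarz inequality over a window of rho's bound everything by the box average of f over the
  window, uniformly in h, h', n, m, and this box average tends to |||f|||_{d+s}^{2^{d+s}} = 0.

  The seminorms and dual functions are limits, whose existence is proved without nilmanifolds. For
  cube averages of commuting maps this is an energy decrement. If the averages oscillate in the
  function u at a vertex of maximal size, u correlates with a finitary dual function. In an ultraproduct
  extension this dual function is D; replacing D by its expression removes the vertex from the
  average, so the averages with D in place of u converge by induction. Thus u may be replaced by
  u - t D, which has the same oscillation and an energy smaller by a fixed amount.
*)

theory Submission
  imports Defs "HOL-Library.Function_Algebras" "HOL-Real_Asymp.Real_Asymp"
begin

section \<open>Limits along an ultrafilter\<close>

text \<open>The energy decrement completes no Hilbert space: the limit function that it needs is an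
  ordinary function of one more parameter, and only the functional is a limit, taken along an
  ultrafilter. Each decrement passes to a new system, so convergence has to be proved for all
  systems at once; the type \<open>'a pt\<close> is closed under the extension, which makes this an
  induction over a single type. In the main estimate, translating the point by minus the sum of the
  first d coordinates of \<rho> leaves \<rho>_i with the coefficient \<theta>_i - 1 at a vertex
  \<theta>, so a vertex with \<theta>_i = 1 loses \<rho>_i. This is where the degree d + 1 of the
  dual function, one more than that of the seminorm, is used: the last coordinate of m is not moved,
  so the vertex whose only 1 stands there is different from the excluded zero vertex and still keeps
  the first d coordinates of \<rho>. Inside it, the top vertex of the derivative Delta_h f keeps the
  other s.\<close>

definition ultra :: "'a filter \<Rightarrow> bool" where
  "ultra U \<longleftrightarrow> U \<noteq> bot \<and> (\<forall>P. eventually P U \<or> eventually (\<lambda>x. \<not> P x) U)"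

text \<open>Finer filters are smaller, so an ultrafilter is a minimal element among the proper
  filters below \<open>F\<close>. Zorn's lemma applies because the infimum of a chain of proper
  filters is proper.\<close>

lemma ultrafilter_exists:
  assumes "F \<noteq> (bot :: 'a filter)"
  shows "\<exists>U. U \<le> F \<and> ultra U"
proof -
  define A where "A = {G. G \<le> F \<and> G \<noteq> bot}"
  have "\<exists>m\<in>A. \<forall>G\<in>A. G \<le> m \<longrightarrow> G = m"
  proof (rule predicate_Zorn)
    show "partial_order_on A (relation_of (\<lambda>G H. H \<le> G) A)"
      by (rule partial_order_on_relation_ofI) auto
  next
    fix C assume C: "C \<in> Chains (relation_of (\<lambda>G H. H \<le> G) A)"
    then have CA: "C \<subseteq> A" and tot: "\<And>G H. G \<in> C \<Longrightarrow> H \<in> C \<Longrightarrow> G \<le> H \<or> H \<le> G"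
      unfolding Chains_def relation_of_def by blast+
    show "\<exists>u\<in>A. \<forall>a\<in>C. u \<le> a"
    proof (cases "C = {}")
      case True
      with assms show ?thesis by (auto simp: A_def)
    next
      case False
      \<comment> \<open>An infimum of filters is proper as soon as all finite infima are, and a
        nonempty finite subset of a chain contains its infimum.\<close>
      have "Inf X \<noteq> bot" if "X \<subseteq> C" "finite X" for X
      proof (cases "X = {}")
        case True
        have "top \<noteq> (bot :: 'a filter)" using assms by (metis bot.extremum_uniqueI top_greatest)
        with True show ?thesis by simp
      next
        case nonempty: False
        have "Inf X \<in> X"
          using that(2) nonempty that(1)
        proof (induction X rule: finite_ne_induct)
          case (insert x X)
          then have "x \<le> Inf X \<or> Inf X \<le> x" using tot by blast
          then show ?case using insert by (auto simp: inf_absorb1 inf_absorb2)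
        qed simp
        then show ?thesis using that CA by (auto simp: A_def)
      qed
      then have "Inf C \<noteq> bot" by (rule Inf_filter_not_bot)
      moreover have "Inf C \<le> F" using False CA unfolding A_def
        by (metis (mono_tags, lifting) Inf_lower2 ex_in_conv mem_Collect_eq subsetD)
      ultimately show ?thesis by (intro bexI[of _ "Inf C"]) (auto simp: A_def Inf_lower)
    qed
  qed
  then obtain U where U: "U \<le> F" "U \<noteq> bot" "\<And>G. G \<le> F \<Longrightarrow> G \<noteq> bot \<Longrightarrow> G \<le> U \<Longrightarrow> G = U"
    unfolding A_def by blast
  have "eventually P U \<or> eventually (\<lambda>x. \<not> P x) U" for P
  \<comment> \<open>If the restriction of \<open>U\<close> to \<open>P\<close> is proper, minimality
    says that it is \<open>U\<close> itself, so \<open>P\<close> holds along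
    \<open>U\<close>.\<close>
  proof (cases "inf U (principal {x. P x}) = bot")
    case True
    then have "eventually (\<lambda>x. \<not> P x) U"
      by (simp add: trivial_limit_def eventually_inf_principal)
    then show ?thesis ..
  next
    case False
    then have "inf U (principal {x. P x}) = U"
      using U by (meson inf_le1 order_trans)
    then have "U \<le> principal {x. P x}" by (metis inf_le2)
    then show ?thesis by (simp add: le_principal)
  qed
  with U show ?thesis unfolding ultra_def by blast
qed

text \<open>Compactness of the disc yields a cluster point, and a cluster point along an ultrafilter
  is a limit.\<close>

lemma ultra_converges:
  fixes z :: "'a \<Rightarrow> complex"
  assumes U: "ultra U" and bd: "\<And>k. norm (z k) \<le> C"
  shows "\<exists>l. (z \<longlongrightarrow> l) U"
proof -
  have "compact (cball 0 C :: complex set)" by simp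
  moreover have "filtermap z U \<noteq> bot" using U by (simp add: ultra_def filtermap_bot_iff)
  moreover have "eventually (\<lambda>x. x \<in> cball 0 C) (filtermap z U)"
    using bd by (simp add: eventually_filtermap)
  ultimately obtain l where l: "inf (nhds l) (filtermap z U) \<noteq> bot"
    unfolding compact_filter by blast
  have "eventually (\<lambda>k. z k \<in> S) U" if "open S" "l \<in> S" for S
  proof (rule ccontr)
    assume "\<not> ?thesis"
    then have "eventually (\<lambda>k. z k \<notin> S) U" using U unfolding ultra_def by blast
    then have "eventually (\<lambda>w. w \<notin> S) (filtermap z U)" by (simp add: eventually_filtermap)
    moreover have "eventually (\<lambda>w. w \<in> S) (nhds l)" using that eventually_nhds by blast
    ultimately have "eventually (\<lambda>w. False) (inf (nhds l) (filtermap z U))"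
      unfolding eventually_inf by blast
    with l show False by (simp add: trivial_limit_def)
  qed
  then show ?thesis unfolding tendsto_def by blast
qed

text \<open>Being finer than \<open>sequentially\<close>, \<open>ufil\<close> makes
  \<open>ulim\<close> a generalised limit: it exists for all bounded sequences and is the ordinary
  limit whenever there is one.\<close>

definition ufil :: "nat filter" where "ufil = (SOME U. U \<le> sequentially \<and> ultra U)"

definition ulim :: "(nat \<Rightarrow> complex) \<Rightarrow> complex" where "ulim = Lim ufil"

lemma ufil: "ufil \<le> sequentially" "ultra ufil"
  using someI_ex[OF ultrafilter_exists[OF sequentially_bot]] unfolding ufil_def by auto

lemma ufil_nontriv: "ufil \<noteq> bot"
  using ufil unfolding ultra_def by blast

lemma ulim_unique: "(z \<longlongrightarrow> l) ufil \<Longrightarrow> ulim z = l"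
  unfolding ulim_def using ufil_nontriv by (rule tendsto_Lim)

lemma ulim_tendsto:
  assumes "\<And>k. norm (z k) \<le> C" shows "(z \<longlongrightarrow> ulim z) ufil"
proof -
  obtain l where l: "(z \<longlongrightarrow> l) ufil" using ultra_converges[OF ufil(2), of z C] assms by auto
  then show ?thesis using ulim_unique by simp
qed

lemma ulim_eq_lim: "z \<longlonglongrightarrow> l \<Longrightarrow> ulim z = l"
  using ulim_unique ufil(1) tendsto_mono by blast

section \<open>Boxes\<close>

text \<open>A vertex of the cube is given as the set of its coordinates equal to 1. In this form the
  composition of two restrictions is the restriction to the intersection of the vertices.\<close>

definition rs :: "nat set \<Rightarrow> (nat \<Rightarrow> int) \<Rightarrow> nat \<Rightarrow> int" where
  "rs \<epsilon> v = (\<lambda>i. if i \<in> \<epsilon> then v i else 0)"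

lemma rs_add: "rs \<epsilon> (u + v) = rs \<epsilon> u + rs \<epsilon> v"
  by (auto simp: rs_def fun_eq_iff)
lemma rs_zero [simp]: "rs \<epsilon> 0 = 0"
  by (auto simp: rs_def fun_eq_iff)
lemma rs_rs: "rs \<epsilon> (rs \<eta> v) = rs (\<epsilon> \<inter> \<eta>) v"
  by (auto simp: rs_def fun_eq_iff)
lemma rs_empty [simp]: "rs {} v = 0"
  by (auto simp: rs_def fun_eq_iff)

text \<open>The coordinates from \<open>r\<close> on are 0 rather than \<open>undefined\<close>, so
  the box lies in the additive group \<open>nat \<Rightarrow> int\<close> and can be
  translated.\<close>

definition box :: "nat \<Rightarrow> nat \<Rightarrow> (nat \<Rightarrow> int) set" where
  "box r N = {n. \<forall>i. if i < r then 1 \<le> n i \<and> n i \<le> int N else n i = 0}"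

text \<open>The sides are arbitrary because the intersection of a box with its translate has to be
  counted too.\<close>

lemma card_box_like:
  fixes a b :: "nat \<Rightarrow> int" and r :: nat
  defines "X \<equiv> {n. \<forall>i. if i < r then a i \<le> n i \<and> n i \<le> b i else n i = 0}"
  shows "finite X" "card X = (\<Prod>i<r. card {a i..b i})"
proof -
  have bij: "bij_betw (\<lambda>n. \<lambda>i. if i < r then n i else 0) (Pi\<^sub>E {..<r} (\<lambda>i. {a i..b i})) X"
    unfolding X_def
    by (rule bij_betwI[where g = "\<lambda>n. restrict n {..<r}"])
       (auto simp: fun_eq_iff PiE_iff extensional_def split: if_splits)
  have fin: "finite (Pi\<^sub>E {..<r} (\<lambda>i. {a i..b i}))" by (intro finite_PiE) auto
  show "finite X" using bij_betw_finite[OF bij] fin by simp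
  show "card X = (\<Prod>i<r. card {a i..b i})"
    using bij_betw_same_card[OF bij] by (simp add: card_PiE)
qed

lemma finite_box [simp]: "finite (box r N)"
  unfolding box_def by (rule card_box_like(1)[where a = "\<lambda>_. 1" and b = "\<lambda>_. int N"])
lemma card_box [simp]: "card (box r N) = N ^ r"
  unfolding box_def using card_box_like(2)[where a = "\<lambda>_. 1" and b = "\<lambda>_. int N"] by simp

text \<open>The sums differ only over the symmetric difference of the box and its translate. Each
  half of it has \<open>N ^ r\<close> minus the product of the overlaps \<open>N - |v i|\<close>
  many points; \<open>elim\<close> keeps every overlap non-negative.\<close>

lemma box_shift_bound:
  fixes a :: "(nat \<Rightarrow> int) \<Rightarrow> complex"
  assumes bd: "\<And>n. norm (a n) \<le> C" and v: "\<And>i. i \<ge> r \<Longrightarrow> v i = 0"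
    and elim: "Suc (\<Sum>i<r. nat \<bar>v i\<bar>) \<le> N"
  shows "norm (((\<Sum>n\<in>box r N. a (n + v)) - (\<Sum>n\<in>box r N. a n)) / of_nat N ^ r)
     \<le> 2 * C * (1 - (\<Prod>i<r. (real N - \<bar>real_of_int (v i)\<bar>) / real N))"
proof -
  let ?p = "\<lambda>N. (\<Prod>i<r. real N - \<bar>real_of_int (v i)\<bar>)"
  from elim have N0: "N > 0" by simp
  have vN: "\<bar>v i\<bar> \<le> int N" if "i < r" for i
  proof -
    have "nat \<bar>v i\<bar> \<le> (\<Sum>i<r. nat \<bar>v i\<bar>)" using that by (intro member_le_sum) auto
    with elim show ?thesis by linarith
  qed
  define B where "B = box r N"
  define B' where "B' = (\<lambda>n. n + v) ` B"
  have inj: "inj_on (\<lambda>n. n + v) B" by (auto simp: inj_on_def)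
  have fin: "finite B" "finite B'" by (auto simp: B_def B'_def)
  have s: "(\<Sum>n\<in>B. a (n + v)) = sum a B'" unfolding B'_def using inj by (simp add: sum.reindex)
  have cB: "card B = N ^ r" "card B' = N ^ r" unfolding B'_def using inj by (simp_all add: card_image B_def)
  define X where "X = {n::nat\<Rightarrow>int. \<forall>i. if i < r then max 1 (1 + v i) \<le> n i \<and> n i \<le> min (int N) (int N + v i) else n i = 0}"
  have "B \<inter> B' = X"
  proof (intro set_eqI iffI)
    fix n assume "n \<in> B \<inter> B'"
    then obtain m where "m \<in> B" "n = m + v" "n \<in> B" by (auto simp: B'_def)
    then show "n \<in> X" using v by (auto simp: X_def B_def box_def split: if_splits)
  next
    fix n assume n: "n \<in> X"
    then have "n \<in> B" by (auto simp: X_def B_def box_def split: if_splits)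
    moreover have "n - v \<in> B"
      unfolding B_def box_def
    proof (intro CollectI allI)
      fix i
      show "if i < r then 1 \<le> (n - v) i \<and> (n - v) i \<le> int N else (n - v) i = 0"
        using n v[of i] unfolding X_def by (auto dest!: spec[of _ i] split: if_splits)
    qed
    then have "n \<in> B'" unfolding B'_def by (intro image_eqI[of _ _ "n - v"]) auto
    ultimately show "n \<in> B \<inter> B'" by blast
  qed
  moreover have "real (card X) = (\<Prod>i<r. real (card {max 1 (1 + v i)..min (int N) (int N + v i)}))"
    unfolding X_def by (subst card_box_like(2)) (rule of_nat_prod)
  moreover have "(\<Prod>i<r. real (card {max 1 (1 + v i)..min (int N) (int N + v i)})) = ?p N"
  proof (rule prod.cong)
    fix i assume "i \<in> {..<r}"
    then show "real (card {max 1 (1 + v i)..min (int N) (int N + v i)}) = real N - \<bar>real_of_int (v i)\<bar>"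
      using vN[of i] by (auto simp: max_def min_def)
  qed simp
  ultimately have cap: "real (card (B \<inter> B')) = ?p N" by simp
  have d: "real (card (Y - Z)) = real (card Y) - real (card (Y \<inter> Z))" if "finite Y" for Y Z :: "(nat \<Rightarrow> int) set"
    using card_Int_Diff[OF that, of Z] by linarith
  have d1: "real (card (B - B')) = real N ^ r - ?p N"
    unfolding d[OF fin(1)] cap cB by simp
  have d2: "real (card (B' - B)) = real N ^ r - ?p N"
    unfolding d[OF fin(2)] Int_commute[of B' B] cap cB by simp
  have "sum a B' = sum a (B' - B) + sum a (B \<inter> B')"
    using sum.Int_Diff[OF fin(2), of a B] by (simp add: Int_commute)
  moreover have "sum a B = sum a (B - B') + sum a (B \<inter> B')"
    using sum.Int_Diff[OF fin(1), of a B'] by simp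
  ultimately have "sum a B' - sum a B = sum a (B' - B) - sum a (B - B')" by simp
  then have "norm (sum a B' - sum a B) \<le> norm (sum a (B' - B)) + norm (sum a (B - B'))"
    by (simp only: norm_triangle_ineq4)
  also have "\<dots> \<le> C * real (card (B' - B)) + C * real (card (B - B'))"
    using sum_norm_bound[of "B' - B" a C, OF bd] sum_norm_bound[of "B - B'" a C, OF bd]
    by (intro add_mono) (simp_all add: mult.commute)
  also have "\<dots> = 2 * C * (real N ^ r - ?p N)" unfolding d1 d2 by (simp only: mult_2 distrib_right)
  finally have "norm (sum a B' - sum a B) / real N ^ r \<le> 2 * C * (real N ^ r - ?p N) / real N ^ r"
    by (intro divide_right_mono) auto
  also have "\<dots> = 2 * C * (1 - ?p N / real N ^ r)" using N0 by (simp add: divide_simps)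
  also have "?p N / real N ^ r = (\<Prod>i<r. (real N - \<bar>real_of_int (v i)\<bar>) / real N)"
    by (simp add: prod_dividef)
  finally show ?thesis unfolding s[symmetric] B_def by (simp add: norm_divide norm_power)
qed

text \<open>The error \<open>d\<close> is fixed before \<open>N\<close>, \<open>C\<close> and
  \<open>a\<close>. It depends on \<open>r\<close> and the translation only, which makes the later
  estimates uniform in all other parameters.\<close>

lemma box_shift_uniform:
  fixes v :: "nat \<Rightarrow> int"
  assumes v: "\<And>i. i \<ge> r \<Longrightarrow> v i = 0"
  shows "\<exists>d. d \<longlonglongrightarrow> 0 \<and> (\<forall>N C (a :: (nat \<Rightarrow> int) \<Rightarrow> complex). (\<forall>n. norm (a n) \<le> C) \<longrightarrow>
           norm (((\<Sum>n\<in>box r N. a (n + v)) - (\<Sum>n\<in>box r N. a n)) / of_nat N ^ r) \<le> C * d N)"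
proof -
  define N0 where "N0 = Suc (\<Sum>i<r. nat \<bar>v i\<bar>)"
  define e where "e = (\<lambda>N. 2 * (1 - (\<Prod>i<r. (real N - \<bar>real_of_int (v i)\<bar>) / real N)))"
  \<comment> \<open>Below \<open>N0\<close> the trivial bound by two averages of size at most
    \<open>C\<close> is used.\<close>
  define d where "d = (\<lambda>N. if N0 \<le> N then e N else 2)"
  have "(\<lambda>N. (\<Prod>i<r. (real N - \<bar>real_of_int (v i)\<bar>) / real N)) \<longlonglongrightarrow> (\<Prod>i<r. 1)"
  proof (intro tendsto_prod)
    fix i
    show "(\<lambda>N. (real N - c) / real N) \<longlonglongrightarrow> 1" for c by real_asymp
  qed
  then have "e \<longlonglongrightarrow> 2 * (1 - (\<Prod>i<r. 1))" unfolding e_def by (intro tendsto_mult tendsto_diff tendsto_const)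
  then have "e \<longlonglongrightarrow> 0" by simp
  then have "d \<longlonglongrightarrow> 0"
    by (rule Lim_transform_eventually)
       (auto simp: d_def intro: eventually_mono[OF eventually_ge_at_top[of N0]])
  moreover have "norm (((\<Sum>n\<in>box r N. a (n + v)) - (\<Sum>n\<in>box r N. a n)) / of_nat N ^ r) \<le> C * d N"
    if a: "\<forall>n. norm (a n) \<le> C" for N C and a :: "(nat \<Rightarrow> int) \<Rightarrow> complex"
  proof (cases "N0 \<le> N")
    case True
    then show ?thesis using box_shift_bound[of a C r v N] a v by (simp add: d_def N0_def e_def ac_simps)
  next
    case False
    have C0: "0 \<le> C" using a norm_ge_zero order_trans by blast
    have "norm ((\<Sum>n\<in>box r N. a (n + v)) - (\<Sum>n\<in>box r N. a n)) \<le> N ^ r * C + N ^ r * C"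
      using sum_norm_bound[of "box r N" "\<lambda>n. a (n + v)" C] sum_norm_bound[of "box r N" a C] a
      by (intro order_trans[OF norm_triangle_ineq4] add_mono) auto
    then have "norm (((\<Sum>n\<in>box r N. a (n + v)) - (\<Sum>n\<in>box r N. a n)) / of_nat N ^ r) \<le> (N ^ r * (2 * C)) / N ^ r"
      unfolding norm_divide norm_power norm_of_nat of_nat_power
      by (intro divide_right_mono) (simp_all add: algebra_simps)
    also have "\<dots> \<le> 2 * C" using C0 by simp
    finally show ?thesis using False by (simp add: d_def)
  qed
  ultimately show ?thesis by blast
qed

section \<open>Systems of bounded functions\<close>

text \<open>
  Stands for a measure-preserving action: \<open>E\<close> is an algebra of bounded functions, \<open>L\<close> the integral.
  Nothing is complete, so a positive functional obtained as an ultralimit is admissible.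
\<close>

locale osys =
  fixes E :: "('y \<Rightarrow> complex) set" and L :: "('y \<Rightarrow> complex) \<Rightarrow> complex"
    and A :: "(nat \<Rightarrow> int) \<Rightarrow> 'y \<Rightarrow> 'y"
  assumes E_const: "(\<lambda>_. c) \<in> E"
    and E_add: "\<phi> \<in> E \<Longrightarrow> \<psi> \<in> E \<Longrightarrow> (\<lambda>y. \<phi> y + \<psi> y) \<in> E"
    and E_mult: "\<phi> \<in> E \<Longrightarrow> \<psi> \<in> E \<Longrightarrow> (\<lambda>y. \<phi> y * \<psi> y) \<in> E"
    and E_cnj: "\<phi> \<in> E \<Longrightarrow> (\<lambda>y. cnj (\<phi> y)) \<in> E"
    and E_bdd: "\<phi> \<in> E \<Longrightarrow> \<exists>C. \<forall>y. norm (\<phi> y) \<le> C"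
    and E_A: "\<phi> \<in> E \<Longrightarrow> (\<lambda>y. \<phi> (A v y)) \<in> E"
    and L_add: "\<phi> \<in> E \<Longrightarrow> \<psi> \<in> E \<Longrightarrow> L (\<lambda>y. \<phi> y + \<psi> y) = L \<phi> + L \<psi>"
    and L_scale: "\<phi> \<in> E \<Longrightarrow> L (\<lambda>y. c * \<phi> y) = c * L \<phi>"
    and L_one: "L (\<lambda>_. 1) = 1"
    and L_pos: "\<phi> \<in> E \<Longrightarrow> (\<And>y. 0 \<le> Re (\<phi> y)) \<Longrightarrow> 0 \<le> Re (L \<phi>)"
    and L_A: "\<phi> \<in> E \<Longrightarrow> L (\<lambda>y. \<phi> (A v y)) = L \<phi>"
    and A_add: "A (u + v) y = A u (A v y)"
    and A_zero: "A 0 y = y"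
begin

lemma E_scale: "\<phi> \<in> E \<Longrightarrow> (\<lambda>y. c * \<phi> y) \<in> E"
  using E_mult[OF E_const] .

lemma E_diff: "\<phi> \<in> E \<Longrightarrow> \<psi> \<in> E \<Longrightarrow> (\<lambda>y. \<phi> y - \<psi> y) \<in> E"
  using E_add[of \<phi> "\<lambda>y. -1 * \<psi> y"] E_scale[of \<psi> "-1"] by simp

lemma E_sum: "(\<And>i. i \<in> I \<Longrightarrow> \<phi> i \<in> E) \<Longrightarrow> (\<lambda>y. \<Sum>i\<in>I. \<phi> i y) \<in> E"
  by (induction I rule: infinite_finite_induct) (auto simp: E_const intro!: E_add)

lemma E_prod: "(\<And>i. i \<in> I \<Longrightarrow> \<phi> i \<in> E) \<Longrightarrow> (\<lambda>y. \<Prod>i\<in>I. \<phi> i y) \<in> E"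
  by (induction I rule: infinite_finite_induct) (auto simp: E_const intro!: E_mult)

lemma E_divide: "\<phi> \<in> E \<Longrightarrow> (\<lambda>y. \<phi> y / c) \<in> E"
  using E_scale[of \<phi> "inverse c"] by (simp add: divide_inverse mult.commute)

lemmas E_intros = E_const E_add E_diff E_mult E_cnj E_A E_sum E_prod E_divide

lemma L_divide: "\<phi> \<in> E \<Longrightarrow> L (\<lambda>y. \<phi> y / c) = L \<phi> / c"
  using L_scale[of \<phi> "inverse c"] by (simp add: divide_inverse mult.commute)

lemma L_diff: "\<phi> \<in> E \<Longrightarrow> \<psi> \<in> E \<Longrightarrow> L (\<lambda>y. \<phi> y - \<psi> y) = L \<phi> - L \<psi>"
  using L_add[of \<phi> "\<lambda>y. -1 * \<psi> y"] E_scale[of \<psi> "-1"] L_scale[of \<psi> "-1"] by simp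

lemma L_const: "L (\<lambda>_. c) = c"
  using L_scale[OF E_const[of 1], of c] L_one by simp

lemma L_sum: "(\<And>i. i \<in> I \<Longrightarrow> \<phi> i \<in> E) \<Longrightarrow> L (\<lambda>y. \<Sum>i\<in>I. \<phi> i y) = (\<Sum>i\<in>I. L (\<phi> i))"
  by (induction I rule: infinite_finite_induct) (auto simp: L_const L_add E_sum)

lemma L_mono: "\<phi> \<in> E \<Longrightarrow> \<psi> \<in> E \<Longrightarrow> (\<And>y. Re (\<phi> y) \<le> Re (\<psi> y)) \<Longrightarrow> Re (L \<phi>) \<le> Re (L \<psi>)"
  using L_pos[OF E_diff[of \<psi> \<phi>]] L_diff[of \<psi> \<phi>] by simp

lemma unit_rotation: obtains c :: complex where "norm c = 1" "c * z = of_real (norm z)"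
proof (cases "z = 0")
  case True
  then show ?thesis using that[of 1] by simp
next
  case False
  have "cnj z / of_real (norm z) * z = of_real (norm z)"
    using False complex_norm_square[of z] by (simp add: divide_simps power2_eq_square mult.commute)
  then show ?thesis using that[of "cnj z / of_real (norm z)"] False by (simp add: norm_divide)
qed

text \<open>A rotation by a unit makes \<open>L \<phi>\<close> real and non-negative, and positivity
  then compares real parts with the constant \<open>C\<close>.\<close>

lemma L_bound:
  assumes \<phi>: "\<phi> \<in> E" and C: "\<And>y. norm (\<phi> y) \<le> C"
  shows "norm (L \<phi>) \<le> C"
proof -
  obtain c where c: "norm c = 1" "c * L \<phi> = of_real (norm (L \<phi>))"
    using unit_rotation by blast
  have "Re (L (\<lambda>y. c * \<phi> y)) \<le> Re (L (\<lambda>_. of_real C))"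
  proof (rule L_mono)
    fix y
    have "Re (c * \<phi> y) \<le> norm (c * \<phi> y)" by (rule complex_Re_le_cmod)
    also have "\<dots> \<le> C" using C c by (simp add: norm_mult)
    finally show "Re (c * \<phi> y) \<le> Re (of_real C)" by simp
  qed (auto intro: E_scale \<phi> E_const)
  then show ?thesis using c by (simp add: L_scale[OF \<phi>] L_const)
qed

lemma L_cnj:
  assumes \<phi>: "\<phi> \<in> E" shows "L (\<lambda>y. cnj (\<phi> y)) = cnj (L \<phi>)"
proof -
  \<comment> \<open>Multiplying a real-valued \<psi> by \<open>\<i>\<close> or \<open>-\<i>\<close>
    gives real part zero, so positivity applies with both signs.\<close>
  have real: "Im (L \<psi>) = 0" if "\<psi> \<in> E" "\<And>y. Im (\<psi> y) = 0" for \<psi>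
    using L_pos[OF E_scale[OF that(1), of \<i>]] L_pos[OF E_scale[OF that(1), of "-\<i>"]] that
      L_scale[OF that(1), of "-\<i>"] by (simp add: L_scale)
  have 1: "Im (L (\<lambda>y. \<phi> y + cnj (\<phi> y))) = 0" by (rule real) (auto intro!: E_intros \<phi>)
  have 2: "Im (L (\<lambda>y. \<i> * (\<phi> y - cnj (\<phi> y)))) = 0" by (rule real) (auto intro!: E_intros \<phi>)
  show ?thesis
    using 1 2 \<phi> by (simp add: L_add L_scale L_diff E_cnj E_diff complex_eq_iff)
qed

section \<open>The inner product and seminorm defined by the functional\<close>

definition ip :: "('y \<Rightarrow> complex) \<Rightarrow> ('y \<Rightarrow> complex) \<Rightarrow> complex" where
  "ip \<phi> \<psi> = L (\<lambda>y. \<phi> y * cnj (\<psi> y))"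

definition sn :: "('y \<Rightarrow> complex) \<Rightarrow> real" where
  "sn \<phi> = sqrt (Re (ip \<phi> \<phi>))"

lemma Re_mult_cnj: "Re (z * cnj z) = (norm z)\<^sup>2"
  by (simp add: cmod_power2 flip: power2_eq_square)

lemma ip_nonneg: "\<phi> \<in> E \<Longrightarrow> 0 \<le> Re (ip \<phi> \<phi>)"
  unfolding ip_def by (rule L_pos) (auto intro!: E_intros simp only: Re_mult_cnj zero_le_power2)

lemma sn_nonneg: "\<phi> \<in> E \<Longrightarrow> 0 \<le> sn \<phi>"
  by (simp add: sn_def ip_nonneg)

lemma sn_sq: "\<phi> \<in> E \<Longrightarrow> (sn \<phi>)\<^sup>2 = Re (ip \<phi> \<phi>)"
  by (simp add: sn_def ip_nonneg)

lemma ip_sym: "\<phi> \<in> E \<Longrightarrow> \<psi> \<in> E \<Longrightarrow> ip \<psi> \<phi> = cnj (ip \<phi> \<psi>)"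
  unfolding ip_def by (subst L_cnj[symmetric]) (auto intro!: E_intros simp: mult.commute)

lemma ip_self: "\<phi> \<in> E \<Longrightarrow> ip \<phi> \<phi> = of_real ((sn \<phi>)\<^sup>2)"
  using ip_sym[of \<phi> \<phi>] sn_sq[of \<phi>] by (auto simp: complex_eq_iff)

lemma ip_diff_left: "\<phi> \<in> E \<Longrightarrow> \<psi> \<in> E \<Longrightarrow> \<theta> \<in> E \<Longrightarrow> ip (\<lambda>y. \<phi> y - \<psi> y) \<theta> = ip \<phi> \<theta> - ip \<psi> \<theta>"
  unfolding ip_def by (subst L_diff[symmetric]) (auto intro!: E_intros simp: algebra_simps)

lemma ip_diff_right: "\<phi> \<in> E \<Longrightarrow> \<psi> \<in> E \<Longrightarrow> \<theta> \<in> E \<Longrightarrow> ip \<theta> (\<lambda>y. \<phi> y - \<psi> y) = ip \<theta> \<phi> - ip \<theta> \<psi>"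
  unfolding ip_def by (subst L_diff[symmetric]) (auto intro!: E_intros simp: algebra_simps)

lemma ip_scale_left: "\<phi> \<in> E \<Longrightarrow> \<psi> \<in> E \<Longrightarrow> ip (\<lambda>y. c * \<phi> y) \<psi> = c * ip \<phi> \<psi>"
  unfolding ip_def by (subst L_scale[symmetric]) (auto intro!: E_intros simp: algebra_simps)

lemma ip_scale_right: "\<phi> \<in> E \<Longrightarrow> \<psi> \<in> E \<Longrightarrow> ip \<phi> (\<lambda>y. c * \<psi> y) = cnj c * ip \<phi> \<psi>"
  unfolding ip_def by (subst L_scale[symmetric]) (auto intro!: E_intros simp: algebra_simps)

lemma sn_scale:
  assumes "\<phi> \<in> E" shows "sn (\<lambda>y. c * \<phi> y) = norm c * sn \<phi>"
proof -
  have "ip (\<lambda>y. c * \<phi> y) (\<lambda>y. c * \<phi> y) = (c * cnj c) * of_real ((sn \<phi>)\<^sup>2)"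
    using assms by (simp add: ip_scale_left ip_scale_right E_scale ip_self mult.assoc)
  also have "\<dots> = of_real ((norm c * sn \<phi>)\<^sup>2)"
    by (simp only: complex_norm_square[symmetric] of_real_mult[symmetric] power_mult_distrib)
  finally show ?thesis using sn_nonneg[OF assms] unfolding sn_def[of "\<lambda>y. c * \<phi> y"] by (simp only: Re_complex_of_real real_sqrt_abs) simp
qed

lemma sn_diff_sq:
  assumes "\<phi> \<in> E" "\<psi> \<in> E"
  shows "(sn (\<lambda>y. \<phi> y - of_real t * \<psi> y))\<^sup>2 = (sn \<phi>)\<^sup>2 - 2 * t * Re (ip \<phi> \<psi>) + t\<^sup>2 * (sn \<psi>)\<^sup>2"
proof -
  have "ip (\<lambda>y. \<phi> y - of_real t * \<psi> y) (\<lambda>y. \<phi> y - of_real t * \<psi> y)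
      = ip \<phi> \<phi> - t * ip \<phi> \<psi> - (t * cnj (ip \<phi> \<psi>) - t * (t * ip \<psi> \<psi>))"
    using assms by (simp add: ip_diff_left ip_diff_right ip_scale_left ip_scale_right E_diff E_scale
        ip_sym[OF assms])
  then have "Re (ip (\<lambda>y. \<phi> y - of_real t * \<psi> y) (\<lambda>y. \<phi> y - of_real t * \<psi> y))
      = Re (ip \<phi> \<phi>) - 2 * t * Re (ip \<phi> \<psi>) + t\<^sup>2 * Re (ip \<psi> \<psi>)"
    by (simp add: power2_eq_square)
  then show ?thesis
    using assms by (simp add: sn_sq E_diff E_scale)
qed

lemma cauchy_schwarz:
  assumes "\<phi> \<in> E" "\<psi> \<in> E"
  shows "norm (ip \<phi> \<psi>) \<le> sn \<phi> * sn \<psi>"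
proof -
  obtain c where c: "norm c = 1" "c * ip \<phi> \<psi> = of_real (norm (ip \<phi> \<psi>))"
    using unit_rotation by blast
  define \<theta> where "\<theta> = (\<lambda>y. c * \<phi> y)"
  have \<theta>: "\<theta> \<in> E" "sn \<theta> = sn \<phi>" "ip \<theta> \<psi> = of_real (norm (ip \<phi> \<psi>))"
    unfolding \<theta>_def using assms c by (auto simp: E_scale sn_scale ip_scale_left)
  let ?a = "sn \<phi>" and ?b = "sn \<psi>" and ?m = "norm (ip \<phi> \<psi>)"
  have q: "0 \<le> ?a\<^sup>2 - 2 * t * ?m + t\<^sup>2 * ?b\<^sup>2" for t
    using sn_diff_sq[OF \<theta>(1) assms(2), of t] \<theta> by (metis Re_complex_of_real zero_le_power2)
  have nn: "0 \<le> ?a" "0 \<le> ?b" using assms sn_nonneg by auto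
  show ?thesis
  proof (cases "?b = 0")
    case True
    \<comment> \<open>\<open>sn\<close> is only a seminorm, so this case has content: the quadratic
      in \<open>t\<close> degenerates to a linear function bounded above, whose slope must
      vanish.\<close>
    then have q': "2 * t * ?m \<le> ?a\<^sup>2" for t using q[of t] by simp
    have "?m = 0"
    proof (rule ccontr)
      assume "?m \<noteq> 0"
      then show False using q'[of "(?a\<^sup>2 + 1) / (2 * ?m)"] by (simp add: field_simps)
    qed
    then show ?thesis using nn by simp
  next
    case False
    then have "?b > 0" using nn by simp
    then have "0 \<le> ?a\<^sup>2 * ?b\<^sup>2 - ?m\<^sup>2"
      using q[of "?m / ?b\<^sup>2"] by (simp add: field_simps power2_eq_square)
    then have "?m\<^sup>2 \<le> (?a * ?b)\<^sup>2" by (simp add: power_mult_distrib)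
    then show ?thesis using nn by (simp add: power2_le_iff_abs_le)
  qed
qed

lemma sn_triangle:
  assumes "\<phi> \<in> E" "\<psi> \<in> E"
  shows "sn (\<lambda>y. \<phi> y + \<psi> y) \<le> sn \<phi> + sn \<psi>"
proof -
  have "(sn (\<lambda>y. \<phi> y + \<psi> y))\<^sup>2 = (sn \<phi>)\<^sup>2 + 2 * Re (ip \<phi> \<psi>) + (sn \<psi>)\<^sup>2"
    using sn_diff_sq[OF assms, of "-1"] by simp
  also have "\<dots> \<le> (sn \<phi>)\<^sup>2 + 2 * (sn \<phi> * sn \<psi>) + (sn \<psi>)\<^sup>2"
    using cauchy_schwarz[OF assms] complex_Re_le_cmod[of "ip \<phi> \<psi>"] by linarith
  also have "\<dots> = (sn \<phi> + sn \<psi>)\<^sup>2" by (simp add: power2_eq_square algebra_simps)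
  finally show ?thesis using sn_nonneg assms by (meson add_nonneg_nonneg power2_le_imp_le)
qed

lemma sn_triangle_diff:
  assumes "\<phi> \<in> E" "\<psi> \<in> E"
  shows "sn (\<lambda>y. \<phi> y - \<psi> y) \<le> sn \<phi> + sn \<psi>"
  using sn_triangle[of \<phi> "\<lambda>y. -1 * \<psi> y"] sn_scale[of \<psi> "-1"] E_scale[of \<psi> "-1"] assms by simp

lemma sn_bound_mult:
  assumes "\<phi> \<in> E" "\<psi> \<in> E" and C: "\<And>y. norm (\<phi> y) \<le> C"
  shows "sn (\<lambda>y. \<phi> y * \<psi> y) \<le> C * sn \<psi>"
proof -
  have C0: "0 \<le> C" using C norm_ge_zero order_trans by blast
  have "Re (ip (\<lambda>y. \<phi> y * \<psi> y) (\<lambda>y. \<phi> y * \<psi> y)) \<le> Re (L (\<lambda>y. of_real (C\<^sup>2) * (\<psi> y * cnj (\<psi> y))))"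
    unfolding ip_def
  proof (rule L_mono)
    fix y
    have "Re (\<phi> y * \<psi> y * cnj (\<phi> y * \<psi> y)) = (norm (\<phi> y))\<^sup>2 * (norm (\<psi> y))\<^sup>2"
      by (simp only: Re_mult_cnj norm_mult power_mult_distrib)
    also have "\<dots> \<le> C\<^sup>2 * (norm (\<psi> y))\<^sup>2"
      using C by (intro mult_right_mono power_mono) auto
    also have "\<dots> = Re (of_real (C\<^sup>2) * (\<psi> y * cnj (\<psi> y)))"
      by (simp only: Re_complex_of_real Re_mult_cnj times_complex.sel(1)[of "of_real (C\<^sup>2)"] Im_complex_of_real mult_zero_left diff_zero)
    finally show "Re (\<phi> y * \<psi> y * cnj (\<phi> y * \<psi> y)) \<le> Re (of_real (C\<^sup>2) * (\<psi> y * cnj (\<psi> y)))" .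
  qed (auto intro!: E_intros assms)
  also have "\<dots> = C\<^sup>2 * Re (ip \<psi> \<psi>)"
    using assms by (subst L_scale) (auto intro!: E_intros simp: ip_def)
  finally show ?thesis
    unfolding sn_def using C0 by (metis real_sqrt_le_mono real_sqrt_mult real_sqrt_abs abs_of_nonneg)
qed

lemma sn_bound:
  assumes "\<phi> \<in> E" and C: "\<And>y. norm (\<phi> y) \<le> C"
  shows "sn \<phi> \<le> C"
proof -
  have "sn (\<lambda>_. 1) = 1" by (simp add: sn_def ip_def L_one)
  then show ?thesis using sn_bound_mult[OF assms(1) E_const[of 1] C] by simp
qed

lemma sn_A: "\<phi> \<in> E \<Longrightarrow> sn (\<lambda>y. \<phi> (A v y)) = sn \<phi>"
  unfolding sn_def ip_def using L_A[of "\<lambda>y. \<phi> y * cnj (\<phi> y)" v] by (simp add: E_mult E_cnj)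

lemma sn_sum: "finite I \<Longrightarrow> (\<And>i. i \<in> I \<Longrightarrow> \<phi> i \<in> E) \<Longrightarrow> sn (\<lambda>y. \<Sum>i\<in>I. \<phi> i y) \<le> (\<Sum>i\<in>I. sn (\<phi> i))"
proof (induction I rule: finite_induct)
  case empty
  then show ?case by (simp add: sn_def ip_def L_const)
next
  case (insert i I)
  have "sn (\<lambda>y. \<phi> i y + (\<Sum>i\<in>I. \<phi> i y)) \<le> sn (\<phi> i) + sn (\<lambda>y. \<Sum>i\<in>I. \<phi> i y)"
    using insert by (intro sn_triangle) (auto intro!: E_sum)
  then show ?case using insert by simp
qed

text \<open>The family \<open>S\<close> is arbitrary and not the full cube because the convergence
  proof removes vertices one at a time.\<close>

definition cav :: "nat \<Rightarrow> nat set set \<Rightarrow> (nat set \<Rightarrow> 'y \<Rightarrow> complex) \<Rightarrow> nat \<Rightarrow> 'y \<Rightarrow> complex" where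
  "cav r S F N y = (\<Sum>n\<in>box r N. \<Prod>\<epsilon>\<in>S. F \<epsilon> (A (rs \<epsilon> n) y)) / of_nat N ^ r"

lemma cav_E: "(\<And>\<epsilon>. \<epsilon> \<in> S \<Longrightarrow> F \<epsilon> \<in> E) \<Longrightarrow> cav r S F N \<in> E"
  unfolding cav_def[abs_def] by (auto intro!: E_intros)

lemma prod_bound:
  fixes g :: "'i \<Rightarrow> complex"
  assumes "\<And>i. i \<in> I \<Longrightarrow> norm (g i) \<le> b"
  shows "norm (\<Prod>i\<in>I. g i) \<le> b ^ card I"
proof -
  have "(\<Prod>i\<in>I. norm (g i)) \<le> (\<Prod>i\<in>I. b)" using assms by (intro prod_mono) auto
  then show ?thesis by (simp add: prod_norm)
qed

text \<open>The distinguished vertex enters through \<open>sn\<close> alone: the energy decrement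
  maintains no sup bound for it, while the other vertices keep the bound \<open>b\<close>.\<close>

lemma cav_sn_bound:
  assumes S: "finite S" "\<eta> \<in> S" and F: "\<And>\<epsilon>. \<epsilon> \<in> S \<Longrightarrow> F \<epsilon> \<in> E"
    and b: "\<And>\<epsilon> y. \<epsilon> \<in> S - {\<eta>} \<Longrightarrow> norm (F \<epsilon> y) \<le> b" and N: "N > 0"
  shows "sn (cav r S F N) \<le> b ^ card (S - {\<eta>}) * sn (F \<eta>)"
proof -
  let ?B = "b ^ card (S - {\<eta>})"
  have e: "cav r S F N = (\<lambda>y. inverse (of_nat N ^ r) * (\<Sum>n\<in>box r N. (\<Prod>\<epsilon>\<in>S - {\<eta>}. F \<epsilon> (A (rs \<epsilon> n) y)) * F \<eta> (A (rs \<eta> n) y)))"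
    unfolding cav_def[abs_def] using S by (simp add: prod.remove[of S \<eta>] divide_inverse mult.commute)
  have "sn (\<lambda>y. (\<Prod>\<epsilon>\<in>S - {\<eta>}. F \<epsilon> (A (rs \<epsilon> n) y)) * F \<eta> (A (rs \<eta> n) y)) \<le> ?B * sn (F \<eta>)" for n
  proof -
    have "sn (\<lambda>y. (\<Prod>\<epsilon>\<in>S - {\<eta>}. F \<epsilon> (A (rs \<epsilon> n) y)) * F \<eta> (A (rs \<eta> n) y)) \<le> ?B * sn (\<lambda>y. F \<eta> (A (rs \<eta> n) y))"
      using S F b by (intro sn_bound_mult prod_bound) (auto intro!: E_intros)
    then show ?thesis using sn_A[OF F[OF S(2)]] by simp
  qed
  then have "sn (\<lambda>y. \<Sum>n\<in>box r N. (\<Prod>\<epsilon>\<in>S - {\<eta>}. F \<epsilon> (A (rs \<epsilon> n) y)) * F \<eta> (A (rs \<eta> n) y)) \<le> (\<Sum>n\<in>box r N. ?B * sn (F \<eta>))"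
    using S F by (intro order_trans[OF sn_sum] sum_mono) (auto intro!: E_intros)
  moreover have "sn (cav r S F N) = inverse (real N ^ r) * sn (\<lambda>y. \<Sum>n\<in>box r N. (\<Prod>\<epsilon>\<in>S - {\<eta>}. F \<epsilon> (A (rs \<epsilon> n) y)) * F \<eta> (A (rs \<eta> n) y))"
    unfolding e using S F by (subst sn_scale) (auto intro!: E_intros simp: norm_inverse norm_power)
  ultimately show ?thesis using N by (simp add: inverse_eq_divide divide_le_eq ac_simps)
qed

end

section \<open>Extensions by a parameter\<close>

text \<open>
  A point carries infinitely many parameters, so that adjoining one more, a pair of a natural number
  and an integer vector, is a bijection. An extension of a system thus lives on the same type, which
  allows inductions over all systems.
\<close>

datatype 'a pt = Pt (ks: "nat \<Rightarrow> nat") (ms: "nat \<Rightarrow> nat \<Rightarrow> int") (base: 'a)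

definition pcons :: "nat \<Rightarrow> (nat \<Rightarrow> int) \<Rightarrow> 'a pt \<Rightarrow> 'a pt" where
  "pcons k m y = Pt (case_nat k (ks y)) (case_nat m (ms y)) (base y)"
definition pk :: "'a pt \<Rightarrow> nat" where "pk y = ks y 0"
definition pm :: "'a pt \<Rightarrow> nat \<Rightarrow> int" where "pm y = ms y 0"
definition ptl :: "'a pt \<Rightarrow> 'a pt" where "ptl y = Pt (\<lambda>n. ks y (Suc n)) (\<lambda>n. ms y (Suc n)) (base y)"

lemma pt_simps [simp]:
  "pk (pcons k m y) = k" "pm (pcons k m y) = m" "ptl (pcons k m y) = y"
  "pcons (pk y) (pm y) (ptl y) = y"
  by (auto simp: pcons_def pk_def pm_def ptl_def fun_eq_iff intro!: pt.expand split: nat.split)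

text \<open>
  The extension averages its parameter \<open>m\<close> over a box of side \<open>K k\<close> and then lets \<open>k\<close> tend to
  infinity. The action also translates the coordinates of \<open>m\<close> in \<open>\<eta>\<close>.
\<close>

definition ext_E :: "('a pt \<Rightarrow> complex) set \<Rightarrow> ('a pt \<Rightarrow> complex) set" where
  "ext_E E = {\<phi>. (\<exists>C. \<forall>y. norm (\<phi> y) \<le> C) \<and> (\<forall>k m. (\<lambda>y. \<phi> (pcons k m y)) \<in> E)}"

definition ext_s :: "nat \<Rightarrow> (nat \<Rightarrow> nat) \<Rightarrow> (('a pt \<Rightarrow> complex) \<Rightarrow> complex) \<Rightarrow> ('a pt \<Rightarrow> complex) \<Rightarrow> nat \<Rightarrow> complex" where
  "ext_s r K L \<phi> k = (\<Sum>m\<in>box r (K k). L (\<lambda>y. \<phi> (pcons k m y))) / of_nat (K k) ^ r"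

definition ext_L :: "nat \<Rightarrow> (nat \<Rightarrow> nat) \<Rightarrow> (('a pt \<Rightarrow> complex) \<Rightarrow> complex) \<Rightarrow> ('a pt \<Rightarrow> complex) \<Rightarrow> complex" where
  "ext_L r K L \<phi> = ulim (ext_s r K L \<phi>)"

definition ext_A :: "nat set \<Rightarrow> ((nat \<Rightarrow> int) \<Rightarrow> 'a pt \<Rightarrow> 'a pt) \<Rightarrow> (nat \<Rightarrow> int) \<Rightarrow> 'a pt \<Rightarrow> 'a pt" where
  "ext_A \<eta> A v y = pcons (pk y) (pm y + rs \<eta> v) (A v (ptl y))"

text \<open>\<open>K_lim\<close> makes a fixed translation of the averaged parameter negligible in
  the limit; \<open>\<eta>\<close> lies below \<open>r\<close> because only these coordinates are
  averaged.\<close>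

locale ext_sys = osys E L A for E :: "('a pt \<Rightarrow> complex) set" and L A +
  fixes r :: nat and K :: "nat \<Rightarrow> nat" and \<eta> :: "nat set"
  assumes K_lim: "filterlim K at_top sequentially" and K_pos: "\<And>k. K k > 0"
    and \<eta>: "\<eta> \<subseteq> {..<r}"
begin

abbreviation "E' \<equiv> ext_E E"
abbreviation "L' \<equiv> ext_L r K L"
abbreviation "A' \<equiv> ext_A \<eta> A"

lemma box_avg_bound:
  assumes "\<And>m. norm (z m) \<le> C"
  shows "norm ((\<Sum>m\<in>box r (K k). z m) / of_nat (K k) ^ r :: complex) \<le> C"
proof -
  have "norm (\<Sum>m\<in>box r (K k). z m) \<le> real (K k) ^ r * C"
    using sum_norm_bound[of "box r (K k)" z C] assms by simp
  then show ?thesis using K_pos[of k] by (simp add: norm_divide norm_power divide_le_eq mult.commute)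
qed

lemma ext_slice: "\<phi> \<in> E' \<Longrightarrow> (\<lambda>y. \<phi> (pcons k m y)) \<in> E"
  by (simp add: ext_E_def)

lemma ext_s_bound: "\<phi> \<in> E' \<Longrightarrow> (\<And>y. norm (\<phi> y) \<le> C) \<Longrightarrow> norm (ext_s r K L \<phi> k) \<le> C"
  unfolding ext_s_def by (rule box_avg_bound, rule L_bound) (auto simp: ext_slice)

lemma ext_tendsto:
  assumes "\<phi> \<in> E'" shows "(ext_s r K L \<phi> \<longlongrightarrow> L' \<phi>) ufil"
proof -
  obtain C where "\<And>y. norm (\<phi> y) \<le> C" using assms by (auto simp: ext_E_def)
  then show ?thesis unfolding ext_L_def using ext_s_bound[OF assms] by (blast intro: ulim_tendsto)
qed

lemma ext_L_eqI: "(ext_s r K L \<phi> \<longlongrightarrow> l) ufil \<Longrightarrow> L' \<phi> = l"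
  unfolding ext_L_def by (rule ulim_unique)

lemma ext_E_lift: "\<phi> \<in> E \<Longrightarrow> (\<lambda>y. \<phi> (ptl y)) \<in> E'"
  using E_bdd[of \<phi>] by (auto simp: ext_E_def)

lemma ext_L_lift: "L' (\<lambda>y. \<phi> (ptl y)) = L \<phi>"
proof (rule ext_L_eqI)
  have "ext_s r K L (\<lambda>y. \<phi> (ptl y)) = (\<lambda>_. L \<phi>)"
    using K_pos by (simp add: ext_s_def fun_eq_iff)
  then show "(ext_s r K L (\<lambda>y. \<phi> (ptl y)) \<longlongrightarrow> L \<phi>) ufil" by simp
qed

text \<open>Most axioms pass from the slices to the averages and on to the ultralimit. Invariance is
  different: \<open>A' v\<close> also translates the parameter, which changes \<open>ext_s\<close>
  by an error that vanishes only in the limit.\<close>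

lemma ext_osys: "osys E' L' A'"
proof
  fix c show "(\<lambda>_. c) \<in> E'" by (auto simp: ext_E_def E_const)
next
  fix \<phi> \<psi> assume a: "\<phi> \<in> E'" "\<psi> \<in> E'"
  then obtain C1 C2 where C: "\<And>y. norm (\<phi> y) \<le> C1" "\<And>y. norm (\<psi> y) \<le> C2" by (auto simp: ext_E_def)
  have "norm (\<phi> y + \<psi> y) \<le> C1 + C2" for y using C by (meson norm_triangle_mono)
  then show "(\<lambda>y. \<phi> y + \<psi> y) \<in> E'" using a by (auto simp: ext_E_def intro!: E_add)
  have "norm (\<phi> y * \<psi> y) \<le> C1 * C2" for y using C by (simp add: norm_mult mult_mono')
  then show "(\<lambda>y. \<phi> y * \<psi> y) \<in> E'" using a by (auto simp: ext_E_def intro!: E_mult)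
  have "ext_s r K L (\<lambda>y. \<phi> y + \<psi> y) = (\<lambda>k. ext_s r K L \<phi> k + ext_s r K L \<psi> k)"
    using a by (simp add: ext_s_def fun_eq_iff L_add ext_slice sum.distrib add_divide_distrib)
  then show "L' (\<lambda>y. \<phi> y + \<psi> y) = L' \<phi> + L' \<psi>"
    using tendsto_add[OF ext_tendsto[OF a(1)] ext_tendsto[OF a(2)]] by (intro ext_L_eqI) simp
next
  fix \<phi> assume a: "\<phi> \<in> E'"
  then obtain C where C: "\<And>y. norm (\<phi> y) \<le> C" by (auto simp: ext_E_def)
  show "(\<lambda>y. cnj (\<phi> y)) \<in> E'" using a by (auto simp: ext_E_def intro: E_cnj)
  show "\<exists>C. \<forall>y. norm (\<phi> y) \<le> C" using C by blast
  fix v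
  have A'_cons: "A' v (pcons k m y) = pcons k (m + rs \<eta> v) (A v y)" for k m y
    by (simp add: ext_A_def)
  show "(\<lambda>y. \<phi> (A' v y)) \<in> E'"
    using C E_A[OF ext_slice[OF a]] by (auto simp: ext_E_def A'_cons)
  obtain d where d: "d \<longlonglongrightarrow> 0" "\<And>N C (a :: (nat \<Rightarrow> int) \<Rightarrow> complex). (\<And>n. norm (a n) \<le> C) \<Longrightarrow>
      norm (((\<Sum>n\<in>box r N. a (n + rs \<eta> v)) - (\<Sum>n\<in>box r N. a n)) / of_nat N ^ r) \<le> C * d N"
  proof -
    have "rs \<eta> v i = 0" if "i \<ge> r" for i using \<eta> that by (auto simp: rs_def)
    from box_shift_uniform[of r "rs \<eta> v", OF this] that show ?thesis by blast
  qed
  have le: "norm (ext_s r K L (\<lambda>y. \<phi> (A' v y)) k - ext_s r K L \<phi> k) \<le> C * d (K k)" for k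
  proof -
    have e: "ext_s r K L (\<lambda>y. \<phi> (A' v y)) k = (\<Sum>m\<in>box r (K k). L (\<lambda>y. \<phi> (pcons k (m + rs \<eta> v) y))) / of_nat (K k) ^ r"
      unfolding ext_s_def A'_cons using L_A[OF ext_slice[OF a]] by simp
    show ?thesis
      unfolding e ext_s_def[of r K L \<phi>] diff_divide_distrib[symmetric]
      by (rule d(2)[of "\<lambda>m. L (\<lambda>y. \<phi> (pcons k m y))"], rule L_bound[OF ext_slice[OF a]], rule C)
  qed
  have lim: "(\<lambda>k. C * d (K k)) \<longlonglongrightarrow> 0"
    by (rule tendsto_mult_right_zero, rule filterlim_compose[OF d(1) K_lim])
  have "(\<lambda>k. ext_s r K L (\<lambda>y. \<phi> (A' v y)) k - ext_s r K L \<phi> k) \<longlonglongrightarrow> 0"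
    by (rule Lim_null_comparison[OF _ lim]) (simp add: le)
  then have "((\<lambda>k. ext_s r K L (\<lambda>y. \<phi> (A' v y)) k - ext_s r K L \<phi> k) \<longlongrightarrow> 0) ufil"
    by (rule tendsto_mono[OF ufil(1)])
  from tendsto_add[OF this ext_tendsto[OF a]] show "L' (\<lambda>y. \<phi> (A' v y)) = L' \<phi>"
    by (intro ext_L_eqI) simp
next
  fix \<phi> c assume a: "\<phi> \<in> E'"
  have "ext_s r K L (\<lambda>y. c * \<phi> y) = (\<lambda>k. c * ext_s r K L \<phi> k)"
    using a by (simp add: ext_s_def fun_eq_iff L_scale ext_slice sum_distrib_left)
  then show "L' (\<lambda>y. c * \<phi> y) = c * L' \<phi>"
    using tendsto_mult_left[OF ext_tendsto[OF a], of c] by (intro ext_L_eqI) simp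
next
  show "L' (\<lambda>_. 1) = 1" using ext_L_lift[of "\<lambda>_. 1"] L_one by simp
next
  fix \<phi> assume a: "\<phi> \<in> E'" and p: "\<And>y. 0 \<le> Re (\<phi> y)"
  have "0 \<le> Re (ext_s r K L \<phi> k)" for k
  proof -
    have "ext_s r K L \<phi> k = (\<Sum>m\<in>box r (K k). L (\<lambda>y. \<phi> (pcons k m y))) / of_real (real (K k) ^ r)"
      by (simp add: ext_s_def)
    then show ?thesis using L_pos[OF ext_slice[OF a]] p
      by (simp only: Re_divide_of_real Re_sum) (auto intro!: divide_nonneg_nonneg sum_nonneg)
  qed
  then show "0 \<le> Re (L' \<phi>)"
    using tendsto_Re[OF ext_tendsto[OF a]] ufil_nontriv
    by (intro tendsto_lowerbound[of "\<lambda>k. Re (ext_s r K L \<phi> k)" _ ufil]) auto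
next
  fix u v y
  show "A' (u + v) y = A' u (A' v y)"
    by (simp add: ext_A_def A_add rs_add add.assoc add.commute[of "rs \<eta> u"])
  show "A' 0 y = y" by (simp add: ext_A_def A_zero)
qed

sublocale X: osys E' L' A' by (rule ext_osys)

text \<open>The original system is a factor of the extension, with \<open>ptl\<close> as the factor
  map.\<close>

lemma ip_lift: "X.ip (\<lambda>y. \<phi> (ptl y)) (\<lambda>y. \<psi> (ptl y)) = ip \<phi> \<psi>"
  unfolding X.ip_def ip_def by (rule ext_L_lift)

lemma sn_lift: "X.sn (\<lambda>y. \<phi> (ptl y)) = sn \<phi>"
  by (simp add: X.sn_def sn_def ip_lift)

lemma ptl_A' [simp]: "ptl (A' v y) = A v (ptl y)"
  by (simp add: ext_A_def)

lemma pk_A' [simp]: "pk (A' v y) = pk y" and pm_A' [simp]: "pm (A' v y) = pm y + rs \<eta> v"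
  by (simp_all add: ext_A_def)

lemma cav_lift: "X.cav p S (\<lambda>\<epsilon> y. F \<epsilon> (ptl y)) N = (\<lambda>y. cav p S F N (ptl y))"
  by (simp add: X.cav_def cav_def fun_eq_iff)

end

section \<open>Convergence of cube averages\<close>

context osys begin

lemma cav_upd:
  assumes "finite S" "\<eta> \<in> S"
  shows "cav r S (F(\<eta> := g)) N y = (\<Sum>n\<in>box r N. g (A (rs \<eta> n) y) * (\<Prod>\<epsilon>\<in>S - {\<eta>}. F \<epsilon> (A (rs \<epsilon> n) y))) / of_nat N ^ r"
proof -
  have "(\<Prod>\<epsilon>\<in>S. (F(\<eta> := g)) \<epsilon> (A (rs \<epsilon> n) y)) = g (A (rs \<eta> n) y) * (\<Prod>\<epsilon>\<in>S - {\<eta>}. F \<epsilon> (A (rs \<epsilon> n) y))" for n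
    using assms by (subst prod.remove[OF assms]) (auto intro!: prod.cong)
  then show ?thesis by (simp add: cav_def)
qed

lemma cav_upd_diff:
  assumes "finite S" "\<eta> \<in> S"
  shows "cav r S (F(\<eta> := \<lambda>y. u y - t * v y)) N y = cav r S (F(\<eta> := u)) N y - t * cav r S (F(\<eta> := v)) N y"
  unfolding cav_upd[OF assms]
  by (simp add: left_diff_distrib sum_subtractf diff_divide_distrib mult.assoc sum_distrib_left)

lemma cav_norm_bound:
  assumes "\<And>\<epsilon> y. \<epsilon> \<in> S \<Longrightarrow> norm (F \<epsilon> y) \<le> B" "0 \<le> B"
  shows "norm (cav r S F N y) \<le> B ^ card S"
proof -
  have "norm (\<Sum>n\<in>box r N. \<Prod>\<epsilon>\<in>S. F \<epsilon> (A (rs \<epsilon> n) y)) \<le> real N ^ r * B ^ card S"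
    using sum_norm_bound[of "box r N" "\<lambda>n. \<Prod>\<epsilon>\<in>S. F \<epsilon> (A (rs \<epsilon> n) y)" "B ^ card S"]
      prod_bound[of S] assms by simp
  then have "norm (cav r S F N y) \<le> real N ^ r * B ^ card S / real N ^ r"
    unfolding cav_def norm_divide norm_power norm_of_nat by (intro divide_right_mono) auto
  also have "\<dots> \<le> B ^ card S" using assms by simp
  finally show ?thesis .
qed

abbreviation cdist :: "nat \<Rightarrow> nat set set \<Rightarrow> (nat set \<Rightarrow> 'y \<Rightarrow> complex) \<Rightarrow> nat \<Rightarrow> nat \<Rightarrow> real" where
  "cdist r S F M N \<equiv> sn (\<lambda>y. cav r S F M y - cav r S F N y)"

definition ccauchy :: "nat \<Rightarrow> nat set set \<Rightarrow> (nat set \<Rightarrow> 'y \<Rightarrow> complex) \<Rightarrow> bool" where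
  "ccauchy r S F \<longleftrightarrow> (\<forall>e>0. \<exists>N0. \<forall>M\<ge>N0. \<forall>N\<ge>N0. cdist r S F M N < e)"

text \<open>The limit superior of the distances is at least \<delta>. Quantifying over all
  \<open>\<delta>'\<close> below \<delta> lets the same \<delta> survive when a term with Cauchy
  averages is subtracted.\<close>

definition osc_ge :: "real \<Rightarrow> nat \<Rightarrow> nat set set \<Rightarrow> (nat set \<Rightarrow> 'y \<Rightarrow> complex) \<Rightarrow> bool" where
  "osc_ge \<delta> r S F \<longleftrightarrow> (\<forall>\<delta>'<\<delta>. \<forall>N0. \<exists>M\<ge>N0. \<exists>N\<ge>N0. \<delta>' < cdist r S F M N)"

lemma not_ccauchy_osc:
  assumes "\<not> ccauchy r S F" obtains \<delta> where "\<delta> > 0" "osc_ge \<delta> r S F"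
proof -
  obtain e where e: "e > 0" "\<And>N0. \<exists>M\<ge>N0. \<exists>N\<ge>N0. \<not> cdist r S F M N < e"
    using assms unfolding ccauchy_def by blast
  have "osc_ge e r S F" unfolding osc_ge_def
  proof (intro allI impI)
    fix \<delta>' N0 assume "\<delta>' < e"
    then show "\<exists>M\<ge>N0. \<exists>N\<ge>N0. \<delta>' < cdist r S F M N"
      using e(2)[of N0] by (meson less_le_trans linorder_not_less)
  qed
  with e that show ?thesis by blast
qed

end

context ext_sys begin

lemma sn_ext_le:
  assumes \<phi>: "\<phi> \<in> E'" and C: "0 \<le> C" "\<And>k m. sn (\<lambda>y. \<phi> (pcons k m y)) \<le> C"
  shows "X.sn \<phi> \<le> C"
proof -
  let ?\<psi> = "\<lambda>y. \<phi> y * cnj (\<phi> y)"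
  have \<psi>: "?\<psi> \<in> E'" using \<phi> by (intro X.E_mult X.E_cnj)
  have "norm (ext_s r K L ?\<psi> k) \<le> C\<^sup>2" for k
    unfolding ext_s_def
  proof (rule box_avg_bound)
    fix m
    have "L (\<lambda>y. \<phi> (pcons k m y) * cnj (\<phi> (pcons k m y))) = of_real ((sn (\<lambda>y. \<phi> (pcons k m y)))\<^sup>2)"
      using ip_self[OF ext_slice[OF \<phi>], of k m] by (simp add: ip_def)
    also have "norm (of_real ((sn (\<lambda>y. \<phi> (pcons k m y)))\<^sup>2) :: complex) \<le> C\<^sup>2"
      unfolding norm_of_real abs_power2 using C sn_nonneg[OF ext_slice[OF \<phi>]] by (intro power_mono) auto
    finally show "norm (L (\<lambda>y. \<phi> (pcons k m y) * cnj (\<phi> (pcons k m y)))) \<le> C\<^sup>2" .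
  qed
  then have "norm (L' ?\<psi>) \<le> C\<^sup>2"
    using ext_tendsto[OF \<psi>] ufil_nontriv by (intro Lim_norm_ubound[of ufil]) auto
  then have "(X.sn \<phi>)\<^sup>2 \<le> C\<^sup>2"
    using complex_Re_le_cmod[of "X.ip \<phi> \<phi>"] X.sn_sq[OF \<phi>] by (simp add: X.ip_def)
  then show ?thesis using C(1) by (rule power2_le_imp_le)
qed

text \<open>\<open>D\<close> is the finitary dual function of the averages of side \<open>K k\<close>, as a function of \<open>k\<close> and \<open>m\<close>.\<close>

lemma dual_correlation:
  fixes F :: "nat set \<Rightarrow> 'a pt \<Rightarrow> complex"
  assumes S: "finite S" "\<eta> \<in> S"
    and F: "\<And>\<epsilon>. \<epsilon> \<in> S \<Longrightarrow> F \<epsilon> \<in> E"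
    and b: "\<And>\<epsilon> y. \<epsilon> \<in> S - {\<eta>} \<Longrightarrow> norm (F \<epsilon> y) \<le> b" "0 \<le> b"
    and \<kappa>: "\<And>k. \<kappa> \<le> (sn (cav r S F (K k)))\<^sup>2"
    and D_def: "D = (\<lambda>y. cav r S F (K (pk y)) (A (- rs \<eta> (pm y)) (ptl y)) *
               (\<Prod>\<epsilon>\<in>S - {\<eta>}. cnj (F \<epsilon> (A (rs \<epsilon> (pm y)) (A (- rs \<eta> (pm y)) (ptl y))))))"
  shows "D \<in> E'" "\<kappa> \<le> Re (X.ip (\<lambda>y. F \<eta> (ptl y)) D)"
    "X.sn D \<le> (b ^ card (S - {\<eta>}))\<^sup>2 * sn (F \<eta>)"
proof -
  let ?w = "\<lambda>k. cav r S F (K k)"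
  define Dk where "Dk k m y = ?w k y * (\<Prod>\<epsilon>\<in>S - {\<eta>}. cnj (F \<epsilon> (A (rs \<epsilon> m) y)))" for k m y
  have D_slice: "D (pcons k m y) = Dk k m (A (- rs \<eta> m) y)" for k m y
    by (simp add: D_def Dk_def)
  have w: "?w k \<in> E" for k by (rule cav_E) (rule F)
  have Dk: "Dk k m \<in> E" for k m
    unfolding Dk_def[abs_def] using F w by (intro E_mult E_prod E_cnj E_A) auto
  have bu: "\<exists>B. \<forall>\<epsilon>\<in>S. \<forall>y. norm (F \<epsilon> y) \<le> B"
  proof -
    have "\<forall>\<epsilon>\<in>S. \<exists>C. \<forall>y. norm (F \<epsilon> y) \<le> C" using F E_bdd by blast
    then obtain C where C: "\<And>\<epsilon> y. \<epsilon> \<in> S \<Longrightarrow> norm (F \<epsilon> y) \<le> C \<epsilon>" by metis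
    then have "norm (F \<epsilon> y) \<le> (\<Sum>\<epsilon>\<in>S. \<bar>C \<epsilon>\<bar>)" if "\<epsilon> \<in> S" for \<epsilon> y
      using that S(1) member_le_sum[of \<epsilon> S "\<lambda>\<epsilon>. \<bar>C \<epsilon>\<bar>"] by (meson abs_ge_self abs_ge_zero order_trans)
    then show ?thesis by blast
  qed
  then obtain B where B: "\<And>\<epsilon> y. \<epsilon> \<in> S \<Longrightarrow> norm (F \<epsilon> y) \<le> B" by blast
  then have B0: "0 \<le> B" using S norm_ge_zero order_trans by blast
  have "norm (Dk k m y) \<le> B ^ card S * b ^ card (S - {\<eta>})" for k m y
    unfolding Dk_def norm_mult
    using cav_norm_bound[OF B B0, of S] prod_bound[of "S - {\<eta>}" "\<lambda>\<epsilon>. cnj (F \<epsilon> (A (rs \<epsilon> m) y))" b] b B0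
    by (intro mult_mono) auto
  then have "norm (D y) \<le> B ^ card S * b ^ card (S - {\<eta>})" for y
    using D_slice[of "pk y" "pm y" "ptl y"] by simp
  then show D: "D \<in> E'"
    unfolding ext_E_def using Dk by (auto simp: D_slice intro: E_A)
  have uD: "(\<lambda>y. F \<eta> (ptl y) * cnj (D y)) \<in> E'"
    using D ext_E_lift[OF F[OF S(2)]] by (intro X.E_mult X.E_cnj)
  \<comment> \<open>On the slice \<open>k\<close> the correlation with \<open>D\<close> is the
    energy of the average \<open>?w k\<close>: after translation by \<open>rs \<eta> m\<close> the
    factor \<open>F \<eta>\<close> completes the product over \<open>S\<close>, and averaging over
    \<open>m\<close> pairs \<open>?w k\<close> with itself.\<close>
  have "ext_s r K L (\<lambda>y. F \<eta> (ptl y) * cnj (D y)) k = of_real ((sn (?w k))\<^sup>2)" for k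
  proof -
    have "L (\<lambda>y. F \<eta> y * cnj (Dk k m (A (- rs \<eta> m) y)))
        = L (\<lambda>y. (\<Prod>\<epsilon>\<in>S. F \<epsilon> (A (rs \<epsilon> m) y)) * cnj (?w k y))" for m
    proof -
      have "L (\<lambda>y. F \<eta> y * cnj (Dk k m (A (- rs \<eta> m) y)))
          = L (\<lambda>y. F \<eta> (A (rs \<eta> m) y) * cnj (Dk k m (A (- rs \<eta> m) (A (rs \<eta> m) y))))"
        using L_A[of "\<lambda>y. F \<eta> y * cnj (Dk k m (A (- rs \<eta> m) y))" "rs \<eta> m"] Dk F S
        by (simp add: E_mult E_cnj E_A)
      also have "\<dots> = L (\<lambda>y. (\<Prod>\<epsilon>\<in>S. F \<epsilon> (A (rs \<epsilon> m) y)) * cnj (?w k y))"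
        using S by (simp add: A_add[symmetric] A_zero Dk_def prod.remove[of S \<eta>] ac_simps)
      finally show ?thesis .
    qed
    then have "ext_s r K L (\<lambda>y. F \<eta> (ptl y) * cnj (D y)) k
      = (\<Sum>m\<in>box r (K k). L (\<lambda>y. (\<Prod>\<epsilon>\<in>S. F \<epsilon> (A (rs \<epsilon> m) y)) * cnj (?w k y))) / of_nat (K k) ^ r"
      by (simp add: ext_s_def D_slice)
    also have "\<dots> = ip (?w k) (?w k)"
      unfolding ip_def cav_def[of r S F "K k"] times_divide_eq_left sum_distrib_right
      using F w by (subst L_divide, force intro!: E_intros simp: cav_def[abs_def, symmetric])
       (subst L_sum, auto intro!: E_intros)
    finally show ?thesis using ip_self[OF w] by simp
  qed
  then have "((\<lambda>k. Re (of_real ((sn (?w k))\<^sup>2))) \<longlongrightarrow> Re (L' (\<lambda>y. F \<eta> (ptl y) * cnj (D y)))) ufil"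
    using tendsto_Re[OF ext_tendsto[OF uD]] by simp
  then show "\<kappa> \<le> Re (X.ip (\<lambda>y. F \<eta> (ptl y)) D)"
    unfolding X.ip_def using \<kappa> ufil_nontriv
    by (intro tendsto_lowerbound[of "\<lambda>k. Re (of_real ((sn (?w k))\<^sup>2))" _ ufil]) auto
  let ?P = "b ^ card (S - {\<eta>})"
  have P0: "0 \<le> ?P" using b by simp
  show "X.sn D \<le> ?P\<^sup>2 * sn (F \<eta>)"
  proof (rule sn_ext_le[OF D])
    show "0 \<le> ?P\<^sup>2 * sn (F \<eta>)" using sn_nonneg F S by simp
    fix k m
    have "sn (\<lambda>y. D (pcons k m y)) = sn (Dk k m)"
      unfolding D_slice using sn_A[OF Dk] by simp
    also have "Dk k m = (\<lambda>y. (\<Prod>\<epsilon>\<in>S - {\<eta>}. cnj (F \<epsilon> (A (rs \<epsilon> m) y))) * ?w k y)"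
      by (simp add: Dk_def fun_eq_iff mult.commute)
    \<comment> \<open>One factor \<open>?P\<close> bounds the product of conjugates; the second
      comes from the average \<open>?w k\<close>.\<close>
    also have "sn \<dots> \<le> ?P * sn (?w k)"
      using F w b by (intro sn_bound_mult prod_bound) (auto intro!: E_intros)
    also have "\<dots> \<le> ?P * (?P * sn (F \<eta>))"
      using cav_sn_bound[of S \<eta> F b "K k" r] S F b K_pos P0 by (intro mult_left_mono) auto
    finally show "sn (\<lambda>y. D (pcons k m y)) \<le> ?P\<^sup>2 * sn (F \<eta>)" by (simp add: power2_eq_square mult.assoc)
  qed
qed

end

context ext_sys begin

text \<open>
  Each \<open>H \<epsilon>\<close> is invariant under the coordinates of the extended action in \<open>\<eta> - \<epsilon>\<close>, so it can be moved
  to the vertex \<open>\<epsilon> \<inter> \<eta>\<close>, and the vertex \<open>\<eta>\<close> disappears.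
\<close>

lemma cav_dual:
  fixes F :: "nat set \<Rightarrow> 'a pt \<Rightarrow> complex"
  assumes S: "finite S" "\<eta> \<in> S"
    and Int: "\<And>\<epsilon>. \<epsilon> \<in> S - {\<eta>} \<Longrightarrow> \<epsilon> \<inter> \<eta> \<in> S - {\<eta>}"
    and H_def: "H = (\<lambda>\<epsilon> y. cnj (F \<epsilon> (A (rs \<epsilon> (pm y)) (A (- rs \<eta> (pm y)) (ptl y)))))"
    and D_def: "D = (\<lambda>y. w (pk y) (A (- rs \<eta> (pm y)) (ptl y)) * (\<Prod>\<epsilon>\<in>S - {\<eta>}. H \<epsilon> y))"
    and G_def: "G = (\<lambda>\<zeta> y. F \<zeta> (ptl y) * (\<Prod>\<epsilon>\<in>{\<epsilon>\<in>S - {\<eta>}. \<epsilon> \<inter> \<eta> = \<zeta>}. H \<epsilon> y))"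
  shows "X.cav p S ((\<lambda>\<epsilon> y. F \<epsilon> (ptl y))(\<eta> := D)) N y
    = w (pk y) (A (- rs \<eta> (pm y)) (ptl y)) * X.cav p (S - {\<eta>}) G N y"
proof -
  let ?S = "S - {\<eta>}"
  have fin: "finite ?S" using S by simp
  \<comment> \<open>The translation of the parameter cancels that of the point, so this factor is
    constant along the average.\<close>
  have w: "w (pk (A' (rs \<eta> n) y)) (A (- rs \<eta> (pm (A' (rs \<eta> n) y))) (ptl (A' (rs \<eta> n) y)))
      = w (pk y) (A (- rs \<eta> (pm y)) (ptl y))" for n
    by (simp add: A_add[symmetric] rs_add rs_rs)
  have H: "H \<epsilon> (A' (rs \<eta> n) y) = H \<epsilon> (A' (rs (\<epsilon> \<inter> \<eta>) n) y)" for \<epsilon> n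
  proof -
    \<comment> \<open>On \<eta> - \<epsilon> the parameter and the point move by opposite amounts,
      so \<open>n\<close> enters only through \<epsilon> \<inter> \<eta>.\<close>
    have "rs \<epsilon> (pm y + rs \<eta> (rs \<eta> n)) + - rs \<eta> (pm y + rs \<eta> (rs \<eta> n)) + rs \<eta> n
        = rs \<epsilon> (pm y + rs \<eta> (rs (\<epsilon> \<inter> \<eta>) n)) + - rs \<eta> (pm y + rs \<eta> (rs (\<epsilon> \<inter> \<eta>) n)) + rs (\<epsilon> \<inter> \<eta>) n"
      by (auto simp: rs_def fun_eq_iff)
    then show ?thesis by (simp only: H_def pm_A' ptl_A' A_add[symmetric])
  qed
  have "D (A' (rs \<eta> n) y) * (\<Prod>\<epsilon>\<in>?S. F \<epsilon> (ptl (A' (rs \<epsilon> n) y)))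
      = w (pk y) (A (- rs \<eta> (pm y)) (ptl y)) * (\<Prod>\<zeta>\<in>?S. G \<zeta> (A' (rs \<zeta> n) y))" for n
  proof -
    have "(\<Prod>\<epsilon>\<in>?S. H \<epsilon> (A' (rs \<eta> n) y)) = (\<Prod>\<epsilon>\<in>?S. H \<epsilon> (A' (rs (\<epsilon> \<inter> \<eta>) n) y))"
      by (simp add: H)
    also have "\<dots> = (\<Prod>\<zeta>\<in>?S. \<Prod>\<epsilon>\<in>{\<epsilon>\<in>?S. \<epsilon> \<inter> \<eta> = \<zeta>}. H \<epsilon> (A' (rs (\<epsilon> \<inter> \<eta>) n) y))"
      using fin Int by (subst prod.group) auto
    also have "\<dots> = (\<Prod>\<zeta>\<in>?S. \<Prod>\<epsilon>\<in>{\<epsilon>\<in>?S. \<epsilon> \<inter> \<eta> = \<zeta>}. H \<epsilon> (A' (rs \<zeta> n) y))"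
      by (intro prod.cong) auto
    finally have "(\<Prod>\<epsilon>\<in>?S. H \<epsilon> (A' (rs \<eta> n) y)) = (\<Prod>\<zeta>\<in>?S. \<Prod>\<epsilon>\<in>{\<epsilon>\<in>?S. \<epsilon> \<inter> \<eta> = \<zeta>}. H \<epsilon> (A' (rs \<zeta> n) y))" .
    then have "D (A' (rs \<eta> n) y) = w (pk y) (A (- rs \<eta> (pm y)) (ptl y)) *
        (\<Prod>\<zeta>\<in>?S. \<Prod>\<epsilon>\<in>{\<epsilon>\<in>?S. \<epsilon> \<inter> \<eta> = \<zeta>}. H \<epsilon> (A' (rs \<zeta> n) y))"
      unfolding D_def w by simp
    then show ?thesis by (simp add: G_def prod.distrib mult.assoc mult.commute)
  qed
  then show ?thesis
    unfolding X.cav_upd[OF S] by (simp add: X.cav_def sum_distrib_left)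
qed

end

text \<open>Closure under intersection provides the vertex \<epsilon> \<inter> \<eta> that receives
  the factor of \<epsilon>, and it survives the removal of a vertex of maximal size.\<close>

definition good_family :: "nat \<Rightarrow> nat set set \<Rightarrow> bool" where
  "good_family r S \<longleftrightarrow> finite S \<and> S \<subseteq> Pow {..<r} \<and> (\<forall>a\<in>S. \<forall>b\<in>S. a \<inter> b \<in> S)"

text \<open>The loss of energy is expressed through \<delta>, \<open>b\<close>, \<open>Q\<close> and
  the number of vertices. All of these persist in the new system, so the step can be repeated until
  the energy would be negative. \<open>IH\<close> ranges over all systems because it is applied to
  functions on the extension.\<close>

lemma energy_decrement:
  fixes E :: "('a pt \<Rightarrow> complex) set"
  assumes sys: "osys E L A" and S: "good_family r S" "\<eta> \<in> S"
    and Int: "\<And>\<epsilon>. \<epsilon> \<in> S - {\<eta>} \<Longrightarrow> \<epsilon> \<inter> \<eta> \<in> S - {\<eta>}"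
    and IH: "\<And>E' L' A' (G :: nat set \<Rightarrow> 'a pt \<Rightarrow> complex). osys E' L' A' \<Longrightarrow> (\<And>\<epsilon>. \<epsilon> \<in> S - {\<eta>} \<Longrightarrow> G \<epsilon> \<in> E') \<Longrightarrow>
        osys.ccauchy L' A' r (S - {\<eta>}) G"
    and F: "\<And>\<epsilon>. \<epsilon> \<in> S \<Longrightarrow> F \<epsilon> \<in> E"
    and b: "\<And>\<epsilon> y. \<epsilon> \<in> S - {\<eta>} \<Longrightarrow> norm (F \<epsilon> y) \<le> b" "1 \<le> b"
    and \<delta>: "\<delta> > 0" "osys.osc_ge L A \<delta> r S F"
    and Q: "Q > 0" "(osys.sn L (F \<eta>))\<^sup>2 \<le> Q"
  shows "\<exists>E' L' A' (F' :: nat set \<Rightarrow> 'a pt \<Rightarrow> complex). osys E' L' A' \<and> (\<forall>\<epsilon>\<in>S. F' \<epsilon> \<in> E') \<and>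
     (\<forall>\<epsilon>\<in>S - {\<eta>}. \<forall>y. norm (F' \<epsilon> y) \<le> b) \<and> osys.osc_ge L' A' \<delta> r S F' \<and>
     (osys.sn L' (F' \<eta>))\<^sup>2 \<le> (osys.sn L (F \<eta>))\<^sup>2 - (\<delta>\<^sup>2 / 16)\<^sup>2 / ((b ^ card (S - {\<eta>})) ^ 4 * Q)"
proof -
  interpret osys E L A by fact
  have finS: "finite S" and \<eta>: "\<eta> \<subseteq> {..<r}" using S by (auto simp: good_family_def)
  \<comment> \<open>A distance above \<open>\<delta> / 2\<close> forces one of the two averages
    above \<open>\<delta> / 4\<close>; this is the origin of
    \<open>\<kappa> = \<delta>\<^sup>2 / 16\<close>.\<close>
  have "\<exists>M\<ge>Suc k. \<delta> / 4 < sn (cav r S F M)" for k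
  proof -
    obtain M N where MN: "M \<ge> Suc k" "N \<ge> Suc k" "\<delta> / 2 < cdist r S F M N"
      using \<delta> unfolding osc_ge_def by (metis field_sum_of_halves less_add_same_cancel1 half_gt_zero)
    have "cdist r S F M N \<le> sn (cav r S F M) + sn (cav r S F N)"
      by (intro sn_triangle_diff cav_E F)
    with MN have "\<delta> / 4 < sn (cav r S F M) \<or> \<delta> / 4 < sn (cav r S F N)" by linarith
    with MN show ?thesis by blast
  qed
  then have "\<exists>K. \<forall>k. K k \<ge> Suc k \<and> \<delta> / 4 < sn (cav r S F (K k))"
    by (intro choice allI) blast
  then obtain K where K: "\<And>k. K k \<ge> Suc k" "\<And>k. \<delta> / 4 < sn (cav r S F (K k))" by blast
  have "filterlim K at_top sequentially"
    by (rule filterlim_at_top_mono[OF filterlim_ident]) (use K(1) in \<open>simp add: Suc_leD\<close>)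
  moreover have "K k > 0" for k using K(1)[of k] by linarith
  ultimately interpret ext: ext_sys E L A r K \<eta>
    using \<eta> by unfold_locales auto
  define \<kappa> where "\<kappa> = \<delta>\<^sup>2 / 16"
  have \<kappa>0: "\<kappa> > 0" using \<delta> by (simp add: \<kappa>_def)
  have \<kappa>: "\<kappa> \<le> (sn (cav r S F (K k)))\<^sup>2" for k
    using power_mono[of "\<delta> / 4" "sn (cav r S F (K k))" 2] K(2)[of k] \<delta> by (simp add: \<kappa>_def power2_eq_square)
  let ?w = "\<lambda>k. cav r S F (K k)"
  define H where "H = (\<lambda>\<epsilon> y. cnj (F \<epsilon> (A (rs \<epsilon> (pm y)) (A (- rs \<eta> (pm y)) (ptl y)))))"
  define D where "D = (\<lambda>y. ?w (pk y) (A (- rs \<eta> (pm y)) (ptl y)) * (\<Prod>\<epsilon>\<in>S - {\<eta>}. H \<epsilon> y))"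
  define G where "G = (\<lambda>\<zeta> y. F \<zeta> (ptl y) * (\<Prod>\<epsilon>\<in>{\<epsilon>\<in>S - {\<eta>}. \<epsilon> \<inter> \<eta> = \<zeta>}. H \<epsilon> y))"
  define FL where "FL = (\<lambda>\<epsilon> y. F \<epsilon> (ptl y))"
  let ?P = "b ^ card (S - {\<eta>})"
  have P1: "1 \<le> ?P" using b(2) by simp
  then have P0: "0 < ?P" by linarith
  have PQ: "0 < ?P ^ 4 * Q" by (intro mult_pos_pos zero_less_power P0 Q(1))
  note dc = ext.dual_correlation[OF finS S(2) F b(1) _ \<kappa> D_def[unfolded H_def]]
  have D: "D \<in> ext.E'" "\<kappa> \<le> Re (ext.X.ip (FL \<eta>) D)" "ext.X.sn D \<le> ?P\<^sup>2 * sn (F \<eta>)"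
    using dc b(2) by (auto simp: FL_def)
  have FL: "FL \<epsilon> \<in> ext.E'" if "\<epsilon> \<in> S" for \<epsilon> unfolding FL_def using that by (intro ext.ext_E_lift F)
  have H: "H \<epsilon> \<in> ext.E'" if "\<epsilon> \<in> S" for \<epsilon>
    using E_bdd[OF F[OF that]] F[OF that] by (auto simp: H_def ext_E_def intro!: E_cnj E_A)
  have G: "G \<epsilon> \<in> ext.E'" if "\<epsilon> \<in> S - {\<eta>}" for \<epsilon>
    unfolding G_def using that FL[unfolded FL_def] H by (intro ext.X.E_mult ext.X.E_prod) auto
  have w_bd: "\<exists>C>0. \<forall>k y. norm (?w k y) \<le> C"
  proof -
    have "\<forall>\<epsilon>\<in>S. \<exists>C. \<forall>y. norm (F \<epsilon> y) \<le> C" using F E_bdd by blast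
    then obtain C where C: "\<And>\<epsilon> y. \<epsilon> \<in> S \<Longrightarrow> norm (F \<epsilon> y) \<le> C \<epsilon>" by metis
    have "norm (F \<epsilon> y) \<le> 1 + (\<Sum>\<epsilon>\<in>S. \<bar>C \<epsilon>\<bar>)" if "\<epsilon> \<in> S" for \<epsilon> y
      using C[OF that, of y] that finS member_le_sum[of \<epsilon> S "\<lambda>\<epsilon>. \<bar>C \<epsilon>\<bar>"] by fastforce
    moreover have "0 < 1 + (\<Sum>\<epsilon>\<in>S. \<bar>C \<epsilon>\<bar>)" by (simp add: add_pos_nonneg sum_nonneg)
    ultimately show ?thesis
      by (intro exI[of _ "(1 + (\<Sum>\<epsilon>\<in>S. \<bar>C \<epsilon>\<bar>)) ^ card S"]) (auto intro!: cav_norm_bound)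
  qed
  then obtain C where C: "C > 0" "\<And>k y. norm (?w k y) \<le> C" by blast
  define W where "W = (\<lambda>y. ?w (pk y) (A (- rs \<eta> (pm y)) (ptl y)))"
  have W: "W \<in> ext.E'"
    using C(2) by (auto simp: W_def ext_E_def intro!: E_A cav_E F)
  have cavD: "ext.X.cav r S (FL(\<eta> := D)) N y = W y * ext.X.cav r (S - {\<eta>}) G N y" for N y
    unfolding FL_def W_def
    by (rule ext.cav_dual[OF finS S(2) Int H_def D_def G_def])
  \<comment> \<open>These averages are averages over \<open>S - {\<eta>}\<close> times the bounded
    function \<open>W\<close>, which does not depend on the side of the box.\<close>
  have ccD: "ext.X.ccauchy r S (FL(\<eta> := D))"
    unfolding ext.X.ccauchy_def
  proof (intro allI impI)
    fix e :: real assume e: "e > 0"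
    have "ext.X.ccauchy r (S - {\<eta>}) G" by (rule IH[OF ext.ext_osys G])
    then obtain N0 where N0: "\<And>M N. M \<ge> N0 \<Longrightarrow> N \<ge> N0 \<Longrightarrow>
        ext.X.cdist r (S - {\<eta>}) G M N < e / C"
      using e C(1) unfolding ext.X.ccauchy_def by (meson divide_pos_pos)
    have "ext.X.cdist r S (FL(\<eta> := D)) M N < e"
      if "M \<ge> N0" "N \<ge> N0" for M N
    proof -
      have "ext.X.sn (\<lambda>y. W y * (ext.X.cav r (S - {\<eta>}) G M y - ext.X.cav r (S - {\<eta>}) G N y))
          \<le> C * ext.X.cdist r (S - {\<eta>}) G M N"
        using C W by (intro ext.X.sn_bound_mult ext.X.E_diff ext.X.cav_E G) (auto simp: W_def)
      also have "\<dots> < C * (e / C)" using N0[OF that] C(1) by (intro mult_strict_left_mono)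
      finally show ?thesis using C(1) by (simp add: cavD right_diff_distrib)
    qed
    then show "\<exists>N0. \<forall>M\<ge>N0. \<forall>N\<ge>N0. ext.X.cdist r S (FL(\<eta> := D)) M N < e"
      by blast
  qed
  \<comment> \<open>With \<open>R = ?P ^ 4 * Q\<close>, a bound for the energy of \<open>D\<close>,
    this \<open>t\<close> minimises \<open>- 2 * t * \<kappa> + t\<^sup>2 * R\<close>; the minimum
    is \<open>- \<kappa>\<^sup>2 / R\<close>.\<close>
  define t where "t = \<kappa> / (?P ^ 4 * Q)"
  have t0: "t > 0" unfolding t_def by (rule divide_pos_pos[OF \<kappa>0 PQ])
  define u where "u = (\<lambda>y. FL \<eta> y - of_real t * D y)"
  define F' where "F' = FL(\<eta> := u)"
  have u: "u \<in> ext.E'" unfolding u_def using FL[OF S(2)] D(1) by (intro ext.X.E_diff ext.X.E_scale)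
  have F'E: "F' \<epsilon> \<in> ext.E'" if "\<epsilon> \<in> S" for \<epsilon> using that FL u by (simp add: F'_def)
  have "(ext.X.sn u)\<^sup>2 = (ext.X.sn (FL \<eta>))\<^sup>2 - 2 * t * Re (ext.X.ip (FL \<eta>) D) + t\<^sup>2 * (ext.X.sn D)\<^sup>2"
    unfolding u_def by (rule ext.X.sn_diff_sq[OF FL[OF S(2)] D(1)])
  also have "\<dots> \<le> (sn (F \<eta>))\<^sup>2 - 2 * t * \<kappa> + t\<^sup>2 * (?P ^ 4 * Q)"
  proof -
    have "(ext.X.sn D)\<^sup>2 \<le> (?P\<^sup>2 * sn (F \<eta>))\<^sup>2" using D(3) ext.X.sn_nonneg[OF D(1)] by (rule power_mono)
    also have "\<dots> = ?P ^ 4 * (sn (F \<eta>))\<^sup>2" by (simp add: power_mult_distrib mult.commute flip: power_mult)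
    also have "\<dots> \<le> ?P ^ 4 * Q" using Q(2) P0 by (intro mult_left_mono) auto
    finally have "t\<^sup>2 * (ext.X.sn D)\<^sup>2 \<le> t\<^sup>2 * (?P ^ 4 * Q)" by (intro mult_left_mono) auto
    moreover have "2 * t * \<kappa> \<le> 2 * t * Re (ext.X.ip (FL \<eta>) D)" using D(2) t0 by (intro mult_left_mono) auto
    moreover have "ext.X.sn (FL \<eta>) = sn (F \<eta>)" unfolding FL_def by (rule ext.sn_lift)
    ultimately show ?thesis by simp
  qed
  also have "\<dots> = (sn (F \<eta>))\<^sup>2 - \<kappa>\<^sup>2 / (?P ^ 4 * Q)"
  proof -
    have "?P ^ 4 * Q \<noteq> 0" using PQ by (rule less_imp_neq[symmetric])
    moreover have "x - 2 * (\<kappa> / R) * \<kappa> + (\<kappa> / R)\<^sup>2 * R = x - \<kappa>\<^sup>2 / R" if "R \<noteq> 0" for x R :: real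
      using that by (simp add: power2_eq_square field_simps)
    ultimately show ?thesis unfolding t_def by blast
  qed
  finally have sn_u: "(ext.X.sn (F' \<eta>))\<^sup>2 \<le> (sn (F \<eta>))\<^sup>2 - \<kappa>\<^sup>2 / (?P ^ 4 * Q)" by (simp add: F'_def)
  have osc: "ext.X.osc_ge \<delta> r S F'" unfolding ext.X.osc_ge_def
  proof (intro allI impI)
    fix \<delta>' N0 assume d': "\<delta>' < \<delta>"
    \<comment> \<open>The gap between \<open>\<delta>'\<close> and \<open>\<delta>1\<close> absorbs
      the averages with \<open>D\<close> at the vertex \<eta>.\<close>
    define \<delta>1 where "\<delta>1 = (\<delta>' + \<delta>) / 2"
    have d1: "\<delta>' < \<delta>1" "\<delta>1 < \<delta>" using d' by (auto simp: \<delta>1_def)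
    obtain N1 where N1: "\<And>M N. M \<ge> N1 \<Longrightarrow> N \<ge> N1 \<Longrightarrow>
        ext.X.cdist r S (FL(\<eta> := D)) M N < (\<delta>1 - \<delta>') / t"
      using ccD d1 t0 unfolding ext.X.ccauchy_def by (meson diff_gt_0_iff_gt divide_pos_pos)
    obtain M N where MN: "M \<ge> max N0 N1" "N \<ge> max N0 N1" "\<delta>1 < cdist r S F M N"
      using \<delta>(2) d1(2) unfolding osc_ge_def by blast
    let ?a = "\<lambda>y. ext.X.cav r S F' M y - ext.X.cav r S F' N y"
    let ?d = "\<lambda>y. ext.X.cav r S (FL(\<eta> := D)) M y - ext.X.cav r S (FL(\<eta> := D)) N y"
    have aE: "?a \<in> ext.E'" and dE: "?d \<in> ext.E'"
      using F'E FL D(1) by (auto intro!: ext.X.E_diff ext.X.cav_E)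
    have "cav r S F M (ptl y) - cav r S F N (ptl y) = ?a y + of_real t * ?d y" for y
    proof -
      have "ext.X.cav r S FL R y = ext.X.cav r S (FL(\<eta> := FL \<eta>)) R y" for R by simp
      moreover have "cav r S F R (ptl y) = ext.X.cav r S FL R y" for R
        unfolding FL_def by (simp add: ext.cav_lift)
      ultimately show ?thesis
        unfolding F'_def u_def ext.X.cav_upd_diff[OF finS S(2)] by (simp add: algebra_simps)
    qed
    then have "cdist r S F M N = ext.X.sn (\<lambda>y. ?a y + of_real t * ?d y)"
      using ext.sn_lift[of "\<lambda>y. cav r S F M y - cav r S F N y"] by simp
    also have "\<dots> \<le> ext.X.sn ?a + t * ext.X.sn ?d"
      using ext.X.sn_triangle[OF aE ext.X.E_scale[OF dE, of "of_real t"]] ext.X.sn_scale[OF dE, of "of_real t"] t0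
      by simp
    also have "t * ext.X.sn ?d < \<delta>1 - \<delta>'"
      using N1[of M N] MN t0 by (simp add: pos_less_divide_eq mult.commute)
    finally have "\<delta>' < ext.X.sn ?a" using MN(3) by linarith
    then show "\<exists>M\<ge>N0. \<exists>N\<ge>N0. \<delta>' < ext.X.cdist r S F' M N"
      using MN by auto
  qed
  have "\<forall>\<epsilon>\<in>S - {\<eta>}. \<forall>y. norm (F' \<epsilon> y) \<le> b" using b(1) by (auto simp: F'_def FL_def)
  then show ?thesis
    using ext.ext_osys F'E osc sn_u unfolding \<kappa>_def by blast
qed

theorem cube_averages_cauchy:
  fixes E :: "('a pt \<Rightarrow> complex) set"
  assumes "good_family r S" "osys E L A" "\<And>\<epsilon>. \<epsilon> \<in> S \<Longrightarrow> F \<epsilon> \<in> E"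
  shows "osys.ccauchy L A r S F"
  using assms
proof (induction "card S" arbitrary: S E L A F)
  case 0
  then interpret osys E L A by simp
  have "S = {}" using 0 by (simp add: good_family_def)
  \<comment> \<open>Side 0 is left out: for positive \<open>r\<close> the quotient there is 0 by
    convention, not 1.\<close>
  have "(\<lambda>y. cav r {} F M y - cav r {} F N y) = (\<lambda>y. 0)" if "M \<ge> 1" "N \<ge> 1" for M N
    using that by (simp add: cav_def fun_eq_iff)
  moreover have "sn (\<lambda>y. 0) = 0" by (simp add: sn_def ip_def L_const)
  ultimately have "sn (\<lambda>y. cav r {} F M y - cav r {} F N y) < e" if "M \<ge> 1" "N \<ge> 1" "e > 0" for M N e
    using that by simp
  then show ?case unfolding ccauchy_def \<open>S = {}\<close> by blast
next
  case (Suc n)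
  have finS: "finite S" using Suc by (simp add: good_family_def)
  have "S \<noteq> {}" using Suc.hyps(2) by auto
  \<comment> \<open>A vertex of maximal size is contained in no other, so \<epsilon> \<inter> \<eta>
    differs from \<eta> for every other \<epsilon>.\<close>
  then obtain \<eta> where \<eta>: "\<eta> \<in> S" "\<And>\<epsilon>. \<epsilon> \<in> S \<Longrightarrow> card \<epsilon> \<le> card \<eta>"
  proof -
    obtain \<eta> where "\<eta> \<in> S" "card \<eta> = Max (card ` S)"
      using obtains_MAX[OF finS \<open>S \<noteq> {}\<close>, of card] by metis
    then show ?thesis using finS by (intro that[of \<eta>]) auto
  qed
  have fin: "finite \<epsilon>" if "\<epsilon> \<in> S" for \<epsilon>
    using Suc.prems(1) that finite_subset unfolding good_family_def by blast
  have sub: "\<epsilon> = \<eta>" if "\<epsilon> \<in> S" "\<eta> \<subseteq> \<epsilon>" for \<epsilon>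
    using card_seteq[OF fin[OF that(1)] that(2)] \<eta>(2)[OF that(1)] by simp
  have Int: "\<epsilon> \<inter> \<eta> \<in> S - {\<eta>}" if "\<epsilon> \<in> S - {\<eta>}" for \<epsilon>
    using that sub[of \<epsilon>] \<eta>(1) Suc.prems(1) unfolding good_family_def by blast
  have good': "good_family r (S - {\<eta>})"
    using Suc.prems(1) sub unfolding good_family_def by blast
  have card': "n = card (S - {\<eta>})" using Suc.hyps(2) \<eta>(1) finS by simp
  have IH: "osys.ccauchy L' A' r (S - {\<eta>}) G" if "osys E' L' A'" "\<And>\<epsilon>. \<epsilon> \<in> S - {\<eta>} \<Longrightarrow> G \<epsilon> \<in> E'"
    for E' L' A' and G :: "nat set \<Rightarrow> 'a pt \<Rightarrow> complex"
    by (rule Suc.hyps(1)[OF card' good' that])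
  interpret osys E L A by fact
  show ?case
  proof (rule ccontr)
    assume "\<not> ?case"
    then obtain \<delta> where \<delta>: "\<delta> > 0" "osc_ge \<delta> r S F" by (rule not_ccauchy_osc)
    \<comment> \<open>\<open>Q\<close> bounds the energy throughout the iteration; the summand 1
      keeps it positive.\<close>
    define Q where "Q = (sn (F \<eta>))\<^sup>2 + 1"
    have Q: "Q > 0" by (simp add: Q_def add_nonneg_pos)
    have "\<forall>\<epsilon>\<in>S. \<exists>C. \<forall>y. norm (F \<epsilon> y) \<le> C" using Suc.prems(3) E_bdd by blast
    then obtain C where C: "\<And>\<epsilon> y. \<epsilon> \<in> S \<Longrightarrow> norm (F \<epsilon> y) \<le> C \<epsilon>" by metis
    define b where "b = 1 + (\<Sum>\<epsilon>\<in>S. \<bar>C \<epsilon>\<bar>)"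
    have b: "norm (F \<epsilon> y) \<le> b" if "\<epsilon> \<in> S - {\<eta>}" for \<epsilon> y
      using C[of \<epsilon> y] that finS member_le_sum[of \<epsilon> S "\<lambda>\<epsilon>. \<bar>C \<epsilon>\<bar>"] unfolding b_def by fastforce
    have b1: "1 \<le> b" by (simp add: b_def sum_nonneg)
    define c where "c = (\<delta>\<^sup>2 / 16)\<^sup>2 / ((b ^ card (S - {\<eta>})) ^ 4 * Q)"
    have c: "c > 0" unfolding c_def using \<delta>(1) Q b1 by simp
    \<comment> \<open>\<open>j\<close> bounds the number of decrements of size \<open>c\<close> that
      the energy can pay for; every decrement changes the system.\<close>
    have no: "False" if "osys E' L' A'" "\<And>\<epsilon>. \<epsilon> \<in> S \<Longrightarrow> F' \<epsilon> \<in> E'" "\<And>\<epsilon> y. \<epsilon> \<in> S - {\<eta>} \<Longrightarrow> norm (F' \<epsilon> y) \<le> b"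
        "osys.osc_ge L' A' \<delta> r S F'" "(osys.sn L' (F' \<eta>))\<^sup>2 \<le> Q" "(osys.sn L' (F' \<eta>))\<^sup>2 < real j * c"
      for j E' L' A' and F' :: "nat set \<Rightarrow> 'a pt \<Rightarrow> complex"
      using that
    proof (induction j arbitrary: E' L' A' F')
      case 0
      then show False by (metis mult_zero_left of_nat_0 not_less zero_le_power2)
    next
      case (Suc j)
      have "\<exists>E'' L'' A'' (F'' :: nat set \<Rightarrow> 'a pt \<Rightarrow> complex). osys E'' L'' A'' \<and> (\<forall>\<epsilon>\<in>S. F'' \<epsilon> \<in> E'') \<and>
          (\<forall>\<epsilon>\<in>S - {\<eta>}. \<forall>y. norm (F'' \<epsilon> y) \<le> b) \<and> osys.osc_ge L'' A'' \<delta> r S F'' \<and>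
          (osys.sn L'' (F'' \<eta>))\<^sup>2 \<le> (osys.sn L' (F' \<eta>))\<^sup>2 - c"
        unfolding c_def
        by (rule energy_decrement[OF Suc.prems(1) \<open>good_family r S\<close> \<eta>(1) Int IH Suc.prems(2) Suc.prems(3) b1 \<delta>(1) Suc.prems(4) Q Suc.prems(5)])
      then obtain E'' L'' A'' and F'' :: "nat set \<Rightarrow> 'a pt \<Rightarrow> complex" where *:
        "osys E'' L'' A''" "\<forall>\<epsilon>\<in>S. F'' \<epsilon> \<in> E''" "\<forall>\<epsilon>\<in>S - {\<eta>}. \<forall>y. norm (F'' \<epsilon> y) \<le> b"
        "osys.osc_ge L'' A'' \<delta> r S F''" "(osys.sn L'' (F'' \<eta>))\<^sup>2 \<le> (osys.sn L' (F' \<eta>))\<^sup>2 - c"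
        by (elim exE conjE) (rule that)
      show False
      proof (rule Suc.IH[OF *(1)])
        show "(osys.sn L'' (F'' \<eta>))\<^sup>2 < real j * c" using *(5) Suc.prems(6) by (simp add: algebra_simps)
        show "(osys.sn L'' (F'' \<eta>))\<^sup>2 \<le> Q" using *(5) Suc.prems(5) c by simp
      qed (use * in auto)
    qed
    obtain j where j: "(sn (F \<eta>))\<^sup>2 < real j * c" using c reals_Archimedean3 by blast
    show False
      by (rule no[OF Suc.prems(2,3) b \<delta>(2) _ j]) (simp_all add: Q_def)
  qed
qed

section \<open>Gowers--Host--Kra seminorms\<close>

definition zpow :: "('a \<Rightarrow> 'a) \<Rightarrow> int \<Rightarrow> 'a \<Rightarrow> 'a" where
  "zpow T z = (if 0 \<le> z then T ^^ nat z else (inv T) ^^ nat (- z))"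

lemma zpow_of_nat [simp]: "zpow T (int n) = T ^^ n"
  by (simp add: zpow_def)

lemma zpow_0 [simp]: "zpow T 0 x = x"
  by (simp add: zpow_def)

lemma zpow_Suc:
  assumes "bij T" shows "zpow T (z + 1) x = T (zpow T z x)"
proof (cases "0 \<le> z")
  case True
  then have "nat (z + 1) = Suc (nat z)" by simp
  then show ?thesis using True by (simp add: zpow_def)
next
  case False
  define n where "n = nat (- z - 1)"
  have z: "z = - int (Suc n)" using False by (simp add: n_def)
  have "zpow T (z + 1) x = (inv T ^^ n) x" by (auto simp: zpow_def z)
  moreover have "zpow T z x = inv T ((inv T ^^ n) x)"
  proof -
    have "nat (- z) = Suc n" "\<not> 0 \<le> z" by (simp_all add: z)
    then show ?thesis by (simp add: zpow_def)
  qed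
  ultimately show ?thesis using assms by (simp add: bij_is_surj surj_f_inv_f)
qed

lemma zpow_add:
  assumes T: "bij T" shows "zpow T (a + b) x = zpow T a (zpow T b x)"
proof (induction a rule: int_induct[where k = 0])
  case (step1 i)
  have "zpow T (i + 1 + b) x = T (zpow T (i + b) x)" using zpow_Suc[OF T, of "i + b" x] by (simp add: ac_simps)
  then show ?case using step1 zpow_Suc[OF T, of i] by simp
next
  case (step2 i)
  have "T (zpow T (i - 1 + b) x) = T (zpow T (i - 1) (zpow T b x))"
    using step2 zpow_Suc[OF T, of "i - 1 + b" x] zpow_Suc[OF T, of "i - 1" "zpow T b x"] by (simp add: ac_simps)
  then show ?case using T by (simp add: bij_is_inj inj_eq)
qed simp

text \<open>\<open>T\<close> permutes the whole type, so that its integer iterates form a group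
  action at every point.\<close>

locale mps = prob_space M for M :: "'a measure" +
  fixes T :: "'a \<Rightarrow> 'a"
  assumes bijT: "bij T" and T_meas [measurable]: "T \<in> measurable M M"
    and inv_meas [measurable]: "inv T \<in> measurable M M"
    and T_pres: "distr M M T = M"
begin

abbreviation "Tz \<equiv> zpow T"

lemma Tz_add: "Tz (a + b) x = Tz a (Tz b x)"
  by (rule zpow_add[OF bijT])

lemma Tz_meas [measurable]: "Tz z \<in> measurable M M"
  unfolding zpow_def by (auto intro!: measurable_compose_n)

text \<open>The bounds hold everywhere and not just almost everywhere, because those of
  \<open>osys\<close> are pointwise.\<close>

definition BM :: "('a \<Rightarrow> complex) set" where
  "BM = {f \<in> borel_measurable M. \<exists>C. \<forall>x. norm (f x) \<le> C}"

lemma BM_measurable: "f \<in> BM \<Longrightarrow> f \<in> borel_measurable M" by (simp add: BM_def)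
lemma BM_bdd: "f \<in> BM \<Longrightarrow> \<exists>C. \<forall>x. norm (f x) \<le> C" by (simp add: BM_def)
lemma BM_I: "f \<in> borel_measurable M \<Longrightarrow> (\<And>x. norm (f x) \<le> C) \<Longrightarrow> f \<in> BM" by (auto simp: BM_def)

lemma BM_integrable: "f \<in> BM \<Longrightarrow> integrable M f"
  unfolding BM_def using integrable_const_bound by blast

lemma BM_const: "(\<lambda>_. c) \<in> BM" by (auto simp: BM_def)

lemma BM_add: assumes "f \<in> BM" "g \<in> BM" shows "(\<lambda>x. f x + g x) \<in> BM"
proof -
  obtain C D where "\<And>x. norm (f x) \<le> C" "\<And>x. norm (g x) \<le> D" using assms BM_bdd by meson
  then have "norm (f x + g x) \<le> C + D" for x by (meson norm_triangle_mono)
  then show ?thesis using assms by (auto simp: BM_def)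
qed

lemma BM_mult: assumes "f \<in> BM" "g \<in> BM" shows "(\<lambda>x. f x * g x) \<in> BM"
proof -
  obtain C D where "\<And>x. norm (f x) \<le> C" "\<And>x. norm (g x) \<le> D" using assms BM_bdd by meson
  then have "norm (f x * g x) \<le> C * D" for x by (simp add: norm_mult mult_mono')
  then show ?thesis using assms by (auto simp: BM_def)
qed

lemma BM_cnj: "f \<in> BM \<Longrightarrow> (\<lambda>x. cnj (f x)) \<in> BM"
  unfolding BM_def by (auto intro: borel_measurable_continuous_on[OF continuous_on_cnj[OF continuous_on_id]])

lemma BM_Tz: "f \<in> BM \<Longrightarrow> (\<lambda>x. f (Tz z x)) \<in> BM"
  by (auto simp: BM_def intro: measurable_compose[OF Tz_meas])

lemma BM_sum: "(\<And>i. i \<in> I \<Longrightarrow> f i \<in> BM) \<Longrightarrow> (\<lambda>x. \<Sum>i\<in>I. f i x) \<in> BM"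
  by (induction I rule: infinite_finite_induct) (auto simp: BM_const intro!: BM_add)

lemma BM_prod: "(\<And>i. i \<in> I \<Longrightarrow> f i \<in> BM) \<Longrightarrow> (\<lambda>x. \<Prod>i\<in>I. f i x) \<in> BM"
  by (induction I rule: infinite_finite_induct) (auto simp: BM_const intro!: BM_mult)

lemma BM_divide: "f \<in> BM \<Longrightarrow> (\<lambda>x. f x / c) \<in> BM"
  using BM_mult[OF _ BM_const[of "inverse c"]] by (simp add: divide_inverse)

lemma BM_diff: "f \<in> BM \<Longrightarrow> g \<in> BM \<Longrightarrow> (\<lambda>x. f x - g x) \<in> BM"
  using BM_add[OF _ BM_mult[OF BM_const[of "-1"]], of f g] by simp

lemma BM_Tn: "f \<in> BM \<Longrightarrow> (\<lambda>x. f ((T ^^ n) x)) \<in> BM"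
  using BM_Tz[of f "int n"] by simp

lemmas BM_intros = BM_const BM_add BM_diff BM_mult BM_cnj BM_Tz BM_Tn BM_sum BM_prod BM_divide

lemma integral_T: "f \<in> borel_measurable M \<Longrightarrow> (LINT x|M. f (T x)) = (LINT x|M. (f x :: complex))"
  using integral_distr[OF T_meas, of f] by (simp add: T_pres)

lemma integral_Tn: "f \<in> borel_measurable M \<Longrightarrow> (LINT x|M. f ((T ^^ n) x)) = (LINT x|M. (f x :: complex))"
proof (induction n arbitrary: f)
  case (Suc n)
  have "(LINT x|M. f ((T ^^ Suc n) x)) = (LINT x|M. (\<lambda>x. f (T x)) ((T ^^ n) x))" by simp
  also have "\<dots> = (LINT x|M. f (T x))" by (intro Suc.IH measurable_compose[OF T_meas Suc.prems])
  also have "\<dots> = (LINT x|M. f x)" by (rule integral_T[OF Suc.prems])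
  finally show ?case .
qed simp

lemma integral_Tz: "f \<in> borel_measurable M \<Longrightarrow> (LINT x|M. f (Tz z x)) = (LINT x|M. (f x :: complex))"
proof (cases "0 \<le> z")
  case False
  assume f: "f \<in> borel_measurable M"
  have "(LINT x|M. f (Tz z x)) = (LINT x|M. (\<lambda>x. f (Tz z x)) ((T ^^ nat (- z)) x))"
    by (intro integral_Tn[symmetric] measurable_compose[OF Tz_meas f])
  also have "\<dots> = (LINT x|M. f x)"
  proof -
    have "Tz z ((T ^^ nat (- z)) x) = x" for x
      using Tz_add[of z "- z" x] zpow_of_nat[of T "nat (- z)"] False by simp
    then show ?thesis by simp
  qed
  finally show ?thesis .
qed (simp add: zpow_def integral_Tn)

definition pt0 :: "'a \<Rightarrow> 'a pt" where "pt0 x = Pt (\<lambda>_. 0) (\<lambda>_ _. 0) x"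

definition E0 :: "('a pt \<Rightarrow> complex) set" where "E0 = (\<lambda>g y. g (base y)) ` BM"
definition L0 :: "('a pt \<Rightarrow> complex) \<Rightarrow> complex" where "L0 \<phi> = (LINT x|M. \<phi> (pt0 x))"
text \<open>All \<open>r\<close> directions act through the same \<open>T\<close>, so
  \<open>A0 r (rs \<epsilon> n)\<close> applies the iterate of \<open>T\<close> whose exponent is
  the dot product of \<epsilon> and \<open>n\<close>.\<close>

definition A0 :: "nat \<Rightarrow> (nat \<Rightarrow> int) \<Rightarrow> 'a pt \<Rightarrow> 'a pt" where
  "A0 r v y = Pt (ks y) (ms y) (Tz (\<Sum>i<r. v i) (base y))"

lemma base_pt0 [simp]: "base (pt0 x) = x" by (simp add: pt0_def)
lemma base_A0 [simp]: "base (A0 r v y) = Tz (\<Sum>i<r. v i) (base y)" by (simp add: A0_def)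
lemma L0_base [simp]: "L0 (\<lambda>y. g (base y)) = (LINT x|M. g x)" by (simp add: L0_def)
lemma E0_I: "g \<in> BM \<Longrightarrow> (\<lambda>y. g (base y)) \<in> E0" by (simp add: E0_def)

lemma base_osys: "osys E0 L0 (A0 r)"
proof
  fix c show "(\<lambda>_. c) \<in> E0" using E0_I[OF BM_const] by simp
next
  fix \<phi> \<psi> assume "\<phi> \<in> E0" "\<psi> \<in> E0"
  then obtain f g where fg: "\<phi> = (\<lambda>y. f (base y))" "\<psi> = (\<lambda>y. g (base y))" "f \<in> BM" "g \<in> BM"
    by (auto simp: E0_def)
  show "(\<lambda>y. \<phi> y + \<psi> y) \<in> E0" "(\<lambda>y. \<phi> y * \<psi> y) \<in> E0"
    using E0_I[OF BM_add[OF fg(3,4)]] E0_I[OF BM_mult[OF fg(3,4)]] by (simp_all add: fg)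
  show "L0 (\<lambda>y. \<phi> y + \<psi> y) = L0 \<phi> + L0 \<psi>"
    using fg BM_integrable by (simp add: L0_def)
next
  fix \<phi> assume "\<phi> \<in> E0"
  then obtain f where f: "\<phi> = (\<lambda>y. f (base y))" "f \<in> BM" by (auto simp: E0_def)
  show "(\<lambda>y. cnj (\<phi> y)) \<in> E0" using E0_I[OF BM_cnj[OF f(2)]] by (simp add: f)
  show "\<exists>C. \<forall>y. norm (\<phi> y) \<le> C" using BM_bdd[OF f(2)] by (auto simp: f)
  show "(\<lambda>y. \<phi> (A0 r v y)) \<in> E0" for v using E0_I[OF BM_Tz[OF f(2)]] by (simp add: f)
  show "L0 (\<lambda>y. c * \<phi> y) = c * L0 \<phi>" for c using f BM_integrable by (simp add: L0_def)
  show "L0 (\<lambda>y. \<phi> (A0 r v y)) = L0 \<phi>" for v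
    using integral_Tz[OF BM_measurable[OF f(2)]] by (simp add: f L0_def)
  assume "\<And>y. 0 \<le> Re (\<phi> y)"
  then have "0 \<le> Re (f x)" for x using f(1) base_pt0 by metis
  moreover have "Re (L0 \<phi>) = (LINT x|M. Re (f x))"
    using BM_integrable[OF f(2)] by (simp add: f L0_def)
  ultimately show "0 \<le> Re (L0 \<phi>)" by simp
next
  show "L0 (\<lambda>_. 1) = 1" by (simp add: L0_def prob_space)
next
  fix u v y
  show "A0 r (u + v) y = A0 r u (A0 r v y)"
    by (simp add: A0_def sum.distrib Tz_add)
  show "A0 r 0 y = y" by (simp add: A0_def)
qed

section \<open>Models in which the powers of the seminorms are linear\<close>

definition unit :: "int \<Rightarrow> nat \<Rightarrow> int" where "unit z = (\<lambda>i. if i = 0 then z else 0)"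

lemma unit_add: "unit (a + b) = unit a + unit b" by (auto simp: unit_def fun_eq_iff)
lemma rs_unit [simp]: "rs {0} (unit z) = unit z" by (auto simp: unit_def rs_def fun_eq_iff)

lemma sum_box1: "(\<Sum>m\<in>box 1 N. g m) = (\<Sum>h=1..N. g (unit (int h)))"
proof -
  have "box 1 N = (\<lambda>h. unit (int h)) ` {1..N}"
  proof (intro set_eqI iffI)
    fix m assume m: "m \<in> box 1 N"
    then have "m 0 \<ge> 1" "m 0 \<le> int N" "\<And>i. i > 0 \<Longrightarrow> m i = 0" by (auto simp: box_def split: if_splits)
    then have "m = unit (int (nat (m 0)))" "nat (m 0) \<in> {1..N}" by (auto simp: unit_def fun_eq_iff)
    then show "m \<in> (\<lambda>h. unit (int h)) ` {1..N}" by blast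
  qed (auto simp: unit_def box_def)
  moreover have "inj_on (\<lambda>h. unit (int h)) {1..N}" by (auto simp: inj_on_def unit_def fun_eq_iff split: if_splits)
  ultimately show ?thesis by (simp add: sum.reindex)
qed

text \<open>
  In a model the power of the seminorm is linear: it is the functional \<open>L\<close> applied to \<open>\<Phi> F\<close>, the function
  \<open>\<Delta>\<^bsub>h\<^esub> F\<close> of \<open>h\<close> and \<open>x\<close>. The limit defining the next seminorm is then a mean ergodic limit.
\<close>

definition model :: "nat \<Rightarrow> ('a pt \<Rightarrow> complex) set \<Rightarrow> (('a pt \<Rightarrow> complex) \<Rightarrow> complex) \<Rightarrow>
    ((nat \<Rightarrow> int) \<Rightarrow> 'a pt \<Rightarrow> 'a pt) \<Rightarrow> (('a \<Rightarrow> complex) \<Rightarrow> 'a pt \<Rightarrow> complex) \<Rightarrow> bool" where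
  "model s E L A \<Phi> \<longleftrightarrow> osys E L A \<and> (\<forall>F\<in>BM. \<Phi> F \<in> E \<and> ghk M T s F ^ (2 ^ s) = L (\<Phi> F)) \<and>
     (\<forall>F G. \<Phi> (\<lambda>x. F x * G x) = (\<lambda>y. \<Phi> F y * \<Phi> G y)) \<and>
     (\<forall>F. \<Phi> (\<lambda>x. cnj (F x)) = (\<lambda>y. cnj (\<Phi> F y))) \<and>
     (\<forall>F z. \<Phi> (\<lambda>x. F (Tz z x)) = (\<lambda>y. \<Phi> F (A (unit z) y))) \<and>
     (\<forall>F C. (\<forall>x. norm (F x) \<le> C) \<longrightarrow> (\<forall>y. norm (\<Phi> F y) \<le> C ^ (2 ^ s)))"

lemma model_mult: "model s E L A \<Phi> \<Longrightarrow> \<Phi> (\<lambda>x. F x * G x) = (\<lambda>y. \<Phi> F y * \<Phi> G y)"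
  and model_cnj: "model s E L A \<Phi> \<Longrightarrow> \<Phi> (\<lambda>x. cnj (F x)) = (\<lambda>y. cnj (\<Phi> F y))"
  and model_Tz: "model s E L A \<Phi> \<Longrightarrow> \<Phi> (\<lambda>x. F (Tz z x)) = (\<lambda>y. \<Phi> F (A (unit z) y))"
  unfolding model_def by simp_all

abbreviation gp :: "nat \<Rightarrow> ('a \<Rightarrow> complex) \<Rightarrow> complex" where
  "gp s F \<equiv> ghk M T s F ^ (2 ^ s)"

abbreviation cesaro :: "nat \<Rightarrow> ('a \<Rightarrow> complex) \<Rightarrow> nat \<Rightarrow> complex" where
  "cesaro s F H \<equiv> (\<Sum>h=1..H. gp s (mderiv T h F)) / of_nat H"

text \<open>This is the average that Cauchy-Schwarz produces; in a model it is the squared norm of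
  an ergodic average. Both signs of \<sigma> occur because the window moves the point backward in
  some directions.\<close>

abbreviation fejer :: "nat \<Rightarrow> ('a \<Rightarrow> complex) \<Rightarrow> int \<Rightarrow> nat \<Rightarrow> complex" where
  "fejer s F \<sigma> K \<equiv>
     (\<Sum>a=1..K. \<Sum>b=1..K. gp s (\<lambda>x. F (Tz (\<sigma> * int a) x) * cnj (F (Tz (\<sigma> * int b) x)))) / of_nat K ^ 2"

lemma model_0: "model 0 E0 L0 (A0 1) (\<lambda>F y. F (base y))"
  unfolding model_def using base_osys by (auto simp: E0_I unit_def)

lemma BM_mderiv: "F \<in> BM \<Longrightarrow> mderiv T h F \<in> BM"
  unfolding mderiv_def shift_def by (intro BM_intros)

text \<open>The mean ergodic theorem for \<open>X = \<Phi> F\<close>. With \<open>V N\<close> the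
  ergodic averages of \<open>X\<close>, \<open>cesaro\<close> is \<open>ip X (V N)\<close> and
  \<open>fejer\<close> is \<open>ip (V K) (V K)\<close>; both tend to the square of the limit of
  \<open>sn (V N)\<close>.\<close>

lemma model_cesaro:
  assumes model: "model s E L A \<Phi>" and F: "F \<in> BM"
  shows "\<exists>l\<ge>0. cesaro s F \<longlonglongrightarrow> of_real l \<and>
    (\<forall>\<sigma>\<in>{1,-1}. fejer s F \<sigma> \<longlonglongrightarrow> of_real l)"
proof -
  interpret osys E L A using model by (simp add: model_def)
  define X where "X = \<Phi> F"
  let ?U = "\<lambda>z y. X (A (unit z) y)"
  have X: "X \<in> E" using model F by (simp add: model_def X_def)
  obtain C where C: "\<And>y. norm (X y) \<le> C" using E_bdd[OF X] by blast
  have g: "gp s (\<lambda>x. F (Tz a x) * cnj (F (Tz b x))) = ip (?U a) (?U b)" for a b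
  proof -
    have "(\<lambda>x. F (Tz a x) * cnj (F (Tz b x))) \<in> BM" using F by (intro BM_intros)
    then have "gp s (\<lambda>x. F (Tz a x) * cnj (F (Tz b x))) = L (\<Phi> (\<lambda>x. F (Tz a x) * cnj (F (Tz b x))))"
      using model unfolding model_def by blast
    also have "\<Phi> (\<lambda>x. F (Tz a x) * cnj (F (Tz b x))) = (\<lambda>y. \<Phi> (\<lambda>x. F (Tz a x)) y * \<Phi> (\<lambda>x. cnj (F (Tz b x))) y)"
      by (rule model_mult[OF model])
    also have "\<Phi> (\<lambda>x. cnj (F (Tz b x))) = (\<lambda>y. cnj (\<Phi> (\<lambda>x. F (Tz b x)) y))"
      by (rule model_cnj[OF model])
    finally show ?thesis by (simp add: ip_def X_def model_Tz[OF model])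
  qed
  define V where "V N = (\<lambda>y. (\<Sum>h=1..N. X (A (unit (int h)) y)) / of_nat N)" for N
  have V: "V N = cav 1 {{0}} (\<lambda>_. X) N" for N
    by (simp only: V_def cav_def[abs_def] sum_box1) simp
  have VE: "V N \<in> E" for N unfolding V by (intro cav_E X)
  \<comment> \<open>With the single vertex \<open>{0}\<close> a cube average is an ergodic
    average.\<close>
  have cc: "ccauchy 1 {{0}} (\<lambda>_. X)"
    by (rule cube_averages_cauchy[OF _ osys_axioms]) (auto simp: good_family_def X)
  have XA: "(\<lambda>y. X (A v y)) \<in> E" for v using X by (rule E_A)
  have ipV: "ip Y (V N) = (\<Sum>h=1..N. ip Y (?U (int h))) / of_nat N"
    "ip (V N) Y = (\<Sum>h=1..N. ip (?U (int h)) Y) / of_nat N" if Y: "Y \<in> E" for Y N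
  proof -
    have "ip Y (V N) = L (\<lambda>y. (\<Sum>h=1..N. Y y * cnj (X (A (unit (int h)) y))) / of_nat N)"
      by (simp add: ip_def V_def sum_distrib_left)
    also have "\<dots> = (\<Sum>h=1..N. ip Y (?U (int h))) / of_nat N"
      unfolding ip_def using Y X XA by (subst L_divide) (auto intro!: E_intros simp: L_sum E_mult E_cnj)
    finally show "ip Y (V N) = (\<Sum>h=1..N. ip Y (?U (int h))) / of_nat N" .
    have "ip (V N) Y = L (\<lambda>y. (\<Sum>h=1..N. X (A (unit (int h)) y) * cnj (Y y)) / of_nat N)"
      by (simp add: ip_def V_def sum_distrib_right)
    also have "\<dots> = (\<Sum>h=1..N. ip (?U (int h)) Y) / of_nat N"
      unfolding ip_def using Y X XA by (subst L_divide) (auto intro!: E_intros simp: L_sum E_mult E_cnj)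
    finally show "ip (V N) Y = (\<Sum>h=1..N. ip (?U (int h)) Y) / of_nat N" .
  qed
  have "Cauchy (\<lambda>N. sn (V N))"
  proof (rule metric_CauchyI)
    fix e :: real assume "e > 0"
    then obtain N0 where N0: "\<And>M N. M \<ge> N0 \<Longrightarrow> N \<ge> N0 \<Longrightarrow> sn (\<lambda>y. V M y - V N y) < e"
      using cc unfolding ccauchy_def V by meson
    have le: "sn (V M) \<le> sn (V N) + sn (\<lambda>y. V M y - V N y)" for M N
      using sn_triangle[OF VE[of N] E_diff[OF VE[of M] VE[of N]]] by simp
    have "dist (sn (V M)) (sn (V N)) < e" if "M \<ge> N0" "N \<ge> N0" for M N
      using le[of M N] le[of N M] N0[OF that] N0[OF that(2,1)] by (simp add: dist_real_def)
    then show "\<exists>N0. \<forall>m\<ge>N0. \<forall>n\<ge>N0. dist (sn (V m)) (sn (V n)) < e" by blast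
  qed
  then obtain q where q: "(\<lambda>N. sn (V N)) \<longlonglongrightarrow> q" using Cauchy_convergent_iff convergent_def by blast
  define l where "l = q\<^sup>2"
  have lim2: "(\<lambda>N. ip (V N) (V N)) \<longlonglongrightarrow> of_real l"
    unfolding ip_self[OF VE] l_def by (intro tendsto_of_real tendsto_power q)
  \<comment> \<open>\<open>V N\<close> is almost invariant under a fixed shift, so in the inner
    product \<open>X\<close> may be replaced by its shifts and hence by their average
    \<open>V K\<close> with \<open>K\<close> fixed; \<open>V K\<close> in turn is close to
    \<open>V N\<close>.\<close>
  have lim1: "(\<lambda>N. ip X (V N) - ip (V N) (V N)) \<longlonglongrightarrow> 0"
  proof (rule LIMSEQ_I)
    fix e :: real assume e: "e > 0"
    define c where "c = sn X + 1"
    have c: "c > 0" "sn X \<le> c" using sn_nonneg[OF X] by (auto simp: c_def)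
    obtain N0 where N0: "\<And>M N. M \<ge> N0 \<Longrightarrow> N \<ge> N0 \<Longrightarrow> sn (\<lambda>y. V M y - V N y) < e / (2 * c)"
      using cc e c unfolding ccauchy_def V by (meson divide_pos_pos mult_pos_pos zero_less_numeral)
    define K where "K = Suc N0"
    have snV: "sn (V N) \<le> c" if "N > 0" for N
      using cav_sn_bound[of "{{0}}" "{0}" "\<lambda>_. X" 1 N 1] X that c(2) by (simp add: V)
    have each: "(\<lambda>N. ip X (V N) - ip (?U (int a)) (V N)) \<longlonglongrightarrow> 0" for a
    proof -
      obtain d where d: "d \<longlonglongrightarrow> 0" "\<And>N C (z :: (nat \<Rightarrow> int) \<Rightarrow> complex). (\<And>n. norm (z n) \<le> C) \<Longrightarrow>
         norm (((\<Sum>n\<in>box 1 N. z (n + unit (- int a))) - (\<Sum>n\<in>box 1 N. z n)) / of_nat N ^ 1) \<le> C * d N"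
      proof -
        have "unit (- int a) i = 0" if "i \<ge> 1" for i using that by (simp add: unit_def)
        from box_shift_uniform[of 1 "unit (- int a)", OF this] that show ?thesis by blast
      qed
      have le: "norm (ip X (V N) - ip (?U (int a)) (V N)) \<le> sn X * (C * d N)" for N
      proof -
        have "ip (?U (int a)) (V N) = ip X (\<lambda>y. V N (A (unit (- int a)) y))"
          using L_A[of "\<lambda>y. X y * cnj (V N (A (unit (- int a)) y))" "unit (int a)"] X VE[of N]
          by (simp add: ip_def E_mult E_cnj E_A A_add[symmetric] unit_add[symmetric])
             (simp add: unit_def A_zero flip: zero_fun_def)
        then have "ip X (V N) - ip (?U (int a)) (V N) = ip X (\<lambda>y. V N y - V N (A (unit (- int a)) y))"
          using X VE[of N] by (simp add: ip_diff_right E_A)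
        also have "norm \<dots> \<le> sn X * sn (\<lambda>y. V N y - V N (A (unit (- int a)) y))"
          using X VE[of N] by (intro cauchy_schwarz E_diff E_A)
        also have "\<dots> \<le> sn X * (C * d N)"
        proof (intro mult_left_mono sn_bound sn_nonneg X E_diff E_A VE)
          fix y
          have "V N (A (unit (- int a)) y) = (\<Sum>n\<in>box 1 N. X (A (n + unit (- int a)) y)) / of_nat N ^ 1"
            unfolding V_def sum_box1 by (simp add: A_add)
          moreover have "V N y = (\<Sum>n\<in>box 1 N. X (A n y)) / of_nat N ^ 1"
            unfolding V_def sum_box1 by simp
          ultimately show "norm (V N y - V N (A (unit (- int a)) y)) \<le> C * d N"
            using d(2)[of "\<lambda>n. X (A n y)" C N] C by (simp add: diff_divide_distrib norm_minus_commute)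
        qed
        finally show ?thesis .
      qed
      have lim: "(\<lambda>N. sn X * (C * d N)) \<longlonglongrightarrow> 0"
        by (intro tendsto_mult_right_zero d(1))
      show ?thesis by (rule Lim_null_comparison[OF _ lim]) (simp add: le)
    qed
    have "(\<lambda>N. (\<Sum>a=1..K. ip X (V N) - ip (?U (int a)) (V N)) / of_nat K) \<longlonglongrightarrow> (\<Sum>a=1..K. 0) / of_nat K"
      by (intro tendsto_divide tendsto_sum each tendsto_const) (simp add: K_def del: of_nat_Suc)
    moreover have "(\<Sum>a=1..K. ip X (V N) - ip (?U (int a)) (V N)) / of_nat K = ip X (V N) - ip (V K) (V N)" for N
      using ipV(2)[OF VE, of K N] by (simp add: sum_subtractf diff_divide_distrib K_def del: of_nat_Suc)
    ultimately have "(\<lambda>N. ip X (V N) - ip (V K) (V N)) \<longlonglongrightarrow> 0" by simp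
    then obtain N1 where N1: "\<And>N. N \<ge> N1 \<Longrightarrow> norm (ip X (V N) - ip (V K) (V N)) < e / 2"
      using e LIMSEQ_D[of _ 0 "e / 2"] by force
    have "norm (ip X (V N) - ip (V N) (V N) - 0) < e" if N: "N \<ge> max N1 K" for N
    proof -
      have N': "N > 0" "N \<ge> N0" "K \<ge> N0" using N by (auto simp: K_def)
      have "norm (ip (V K) (V N) - ip (V N) (V N)) = norm (ip (\<lambda>y. V K y - V N y) (V N))"
        using VE by (simp add: ip_diff_left)
      also have "\<dots> \<le> sn (\<lambda>y. V K y - V N y) * sn (V N)" using VE by (intro cauchy_schwarz E_diff)
      also have "\<dots> \<le> e / (2 * c) * c"
        using N0[OF N'(3,2)] snV[OF N'(1)] sn_nonneg[OF VE] c(1) e by (intro mult_mono) auto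
      finally have "norm (ip (V K) (V N) - ip (V N) (V N)) \<le> e / 2" using c(1) by simp
      then show ?thesis using N1[of N] N norm_triangle_ineq[of "ip X (V N) - ip (V K) (V N)" "ip (V K) (V N) - ip (V N) (V N)"]
        by simp
    qed
    then show "\<exists>no. \<forall>n\<ge>no. norm (ip X (V n) - ip (V n) (V n) - 0) < e" by blast
  qed
  have "(\<lambda>N. ip X (V N)) \<longlonglongrightarrow> of_real l" using tendsto_add[OF lim1 lim2] by simp
  moreover have "ip X (V N) = (\<Sum>h=1..N. gp s (mderiv T h F)) / of_nat N" for N
  proof -
    have "gp s (mderiv T h F) = ip X (?U (int h))" for h
    proof -
      have "mderiv T h F = (\<lambda>x. F (Tz 0 x) * cnj (F (Tz (int h) x)))"
        by (simp add: mderiv_def shift_def fun_eq_iff)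
      moreover have "(\<lambda>y. X (A (unit 0) y)) = X" by (simp add: unit_def A_zero flip: zero_fun_def)
      ultimately show ?thesis using g[of 0 "int h"] by simp
    qed
    then show ?thesis by (simp add: ipV(1)[OF X])
  qed
  moreover have "fejer s F \<sigma> K = ip (V K) (V K)"
    if "\<sigma> \<in> {1,-1}" for \<sigma> K
  proof -
    have VV: "ip (V K) (V K) = (\<Sum>a=1..K. \<Sum>b=1..K. ip (?U (int a)) (?U (int b))) / of_nat K ^ 2"
      by (simp add: ipV(2)[OF VE] ipV(1)[OF XA] power2_eq_square flip: sum_divide_distrib)
    show ?thesis
    proof (cases "\<sigma> = 1")
      case True
      then show ?thesis unfolding g VV by simp
    next
      case False
      then have s: "\<sigma> = -1" using that by simp
      \<comment> \<open>Translation by \<open>a + b\<close> turns the backward pair into the forward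
        pair with exchanged indices.\<close>
      have "ip (?U (- int a)) (?U (- int b)) = ip (?U (int b)) (?U (int a))" for a b
        using L_A[of "\<lambda>y. X (A (unit (- int a)) y) * cnj (X (A (unit (- int b)) y))" "unit (int a + int b)"] X
        by (simp add: ip_def E_mult E_cnj E_A A_add[symmetric] unit_add[symmetric])
      then have "(\<Sum>a=1..K. \<Sum>b=1..K. ip (?U (- int a)) (?U (- int b)))
          = (\<Sum>a=1..K. \<Sum>b=1..K. ip (?U (int b)) (?U (int a)))" by simp
      also have "\<dots> = (\<Sum>a=1..K. \<Sum>b=1..K. ip (?U (int a)) (?U (int b)))"
        by (rule sum.swap)
      finally show ?thesis unfolding g VV s by simp
    qed
  qed
  moreover have "0 \<le> l" by (simp add: l_def)
  ultimately show ?thesis using lim2 by (intro exI[of _ l]) simp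
qed

lemma model_ghk_Suc:
  assumes model: "model s E L A \<Phi>" and F: "F \<in> BM"
    and l: "l \<ge> 0" "cesaro s F \<longlonglongrightarrow> of_real l"
  shows "gp (Suc s) F = of_real l"
proof -
  have "lim (cesaro s F) = of_real l"
    using l(2) by (rule limI)
  then show ?thesis
    using l(1) real_root_pow_pos2[of "2 ^ Suc s" l] by (simp del: power_Suc flip: of_real_power)
qed

text \<open>The adjoined parameter is \<open>h\<close>; as \<open>\<eta>\<close> is empty, the
  action does not move it. The limit that defines the next seminorm exists by
  \<open>model_cesaro\<close>, so the ultralimit in \<open>ext_L\<close> equals it. Sides
  \<open>Suc k\<close> avoid the empty box.\<close>

lemma model_Suc:
  assumes model: "model s E L A \<Phi>"
  shows "model (Suc s) (ext_E E) (ext_L 1 Suc L) (ext_A {} A) (\<lambda>F y. \<Phi> (mderiv T (nat (pm y 0)) F) (ptl y))"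
proof -
  interpret osys E L A using model by (simp add: model_def)
  interpret ext: ext_sys E L A 1 Suc "{}"
    by unfold_locales (auto intro: filterlim_Suc)
  have bound: "norm (\<Phi> (mderiv T h F) y) \<le> C ^ (2 ^ Suc s)" if "\<forall>x. norm (F x) \<le> C" for F C h y
  proof -
    have "norm (mderiv T h F x) \<le> C ^ 2" for x
      unfolding mderiv_def shift_def norm_mult complex_mod_cnj power2_eq_square
      using that norm_ge_zero order_trans by (intro mult_mono) blast+
    then have "norm (\<Phi> (mderiv T h F) y) \<le> (C ^ 2) ^ (2 ^ s)" using model unfolding model_def by blast
    then show ?thesis by (simp add: power_mult)
  qed
  have mem: "(\<lambda>y. \<Phi> (mderiv T (nat (pm y 0)) F) (ptl y)) \<in> ext_E E" if F: "F \<in> BM" for F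
    unfolding ext_E_def
  proof (intro CollectI conjI allI)
    obtain C where "\<forall>x. norm (F x) \<le> C" using BM_bdd[OF F] by blast
    then show "\<exists>C. \<forall>y. norm (\<Phi> (mderiv T (nat (pm y 0)) F) (ptl y)) \<le> C" using bound by blast
    show "(\<lambda>y. \<Phi> (mderiv T (nat (pm (pcons k m y) 0)) F) (ptl (pcons k m y))) \<in> E" for k m
      using model BM_mderiv[OF F] by (simp add: model_def)
  qed
  have val: "gp (Suc s) F = ext_L 1 Suc L (\<lambda>y. \<Phi> (mderiv T (nat (pm y 0)) F) (ptl y))" if F: "F \<in> BM" for F
  proof -
    obtain l where l: "l \<ge> 0" "cesaro s F \<longlonglongrightarrow> of_real l"
      using model_cesaro[OF model F] by blast
    have "ext_s 1 Suc L (\<lambda>y. \<Phi> (mderiv T (nat (pm y 0)) F) (ptl y))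
        = (\<lambda>k. (\<Sum>h=1..Suc k. gp s (mderiv T h F)) / of_nat (Suc k))"
      using model BM_mderiv[OF F] unfolding ext_s_def[abs_def] sum_box1
      by (simp add: model_def unit_def del: of_nat_Suc sum.cl_ivl_Suc)
    then have "ext_L 1 Suc L (\<lambda>y. \<Phi> (mderiv T (nat (pm y 0)) F) (ptl y)) = of_real l"
      unfolding ext_L_def using LIMSEQ_Suc[OF l(2)] by (intro ulim_eq_lim) (simp del: of_nat_Suc sum.cl_ivl_Suc)
    then show ?thesis using model_ghk_Suc[OF model F l] by simp
  qed
  have m1: "mderiv T h (\<lambda>x. F x * G x) = (\<lambda>x. mderiv T h F x * mderiv T h G x)" for h F G
    by (simp add: mderiv_def shift_def fun_eq_iff)
  have m2: "mderiv T h (\<lambda>x. cnj (F x)) = (\<lambda>x. cnj (mderiv T h F x))" for h F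
    by (simp add: mderiv_def shift_def fun_eq_iff)
  have m3: "mderiv T h (\<lambda>x. F (Tz z x)) = (\<lambda>x. mderiv T h F (Tz z x))" for h F z
    using Tz_add[of z "int h"] Tz_add[of "int h" z] by (simp add: mderiv_def shift_def fun_eq_iff add.commute)
  show ?thesis
    unfolding model_def
  proof (intro conjI ballI allI impI)
    show "osys (ext_E E) (ext_L 1 Suc L) (ext_A {} A)" by (rule ext.ext_osys)
    fix F G :: "'a \<Rightarrow> complex" and z C
    show "(\<lambda>y. \<Phi> (mderiv T (nat (pm y 0)) (\<lambda>x. F x * G x)) (ptl y)) =
        (\<lambda>y. \<Phi> (mderiv T (nat (pm y 0)) F) (ptl y) * \<Phi> (mderiv T (nat (pm y 0)) G) (ptl y))"
      unfolding m1 using model by (simp add: model_def)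
    show "(\<lambda>y. \<Phi> (mderiv T (nat (pm y 0)) (\<lambda>x. cnj (F x))) (ptl y)) = (\<lambda>y. cnj (\<Phi> (mderiv T (nat (pm y 0)) F) (ptl y)))"
      unfolding m2 using model by (simp add: model_def)
    show "(\<lambda>y. \<Phi> (mderiv T (nat (pm y 0)) (\<lambda>x. F (Tz z x))) (ptl y)) =
        (\<lambda>y. \<Phi> (mderiv T (nat (pm (ext_A {} A (unit z) y) 0)) F) (ptl (ext_A {} A (unit z) y)))"
      unfolding m3 using model by (simp add: model_def)
    show "norm (\<Phi> (mderiv T (nat (pm y 0)) F) (ptl y)) \<le> C ^ 2 ^ Suc s" if "\<forall>x. norm (F x) \<le> C" for y
      using bound[OF that] .
  qed (use mem val in auto)
qed

lemma model_exists: "\<exists>E L A \<Phi>. model s E L A \<Phi>"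
  by (induction s) (use model_0 model_Suc in blast)+

end

section \<open>Dual functions\<close>

lemma cjn_norm [simp]: "norm ((cnj ^^ k) z) = norm z"
  by (induction k) auto
lemma cjn_mult: "(cnj ^^ k) (a * b) = (cnj ^^ k) a * (cnj ^^ k) b"
  by (induction k) auto
lemma cjn_1 [simp]: "(cnj ^^ k) 1 = 1"
  by (induction k) auto
lemma cjn_prod: "(cnj ^^ k) (\<Prod>i\<in>I. g i) = (\<Prod>i\<in>I. (cnj ^^ k) (g i))"
  by (induction I rule: infinite_finite_induct) (auto simp: cjn_mult)
lemma cjn_add: "(cnj ^^ (j + k)) z = (cnj ^^ j) ((cnj ^^ k) z)"
  by (simp add: funpow_add)

text \<open>Vertices are sets in \<open>cav\<close> but 0-1 functions in \<open>dual_avg\<close>;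
  \<open>chi\<close> translates between them, as \<open>sum_grid_box\<close> does for the averaged
  vectors.\<close>

definition chi :: "nat \<Rightarrow> nat set \<Rightarrow> nat \<Rightarrow> nat" where
  "chi r S = (\<lambda>j\<in>{..<r}. if j \<in> S then 1 else 0)"

lemma bij_chi: "bij_betw (chi r) (Pow {..<r}) (cube r)"
  unfolding cube_def
  by (rule bij_betwI[where g = "\<lambda>\<epsilon>. {j. j < r \<and> \<epsilon> j = 1}"])
     (auto simp: chi_def fun_eq_iff PiE_iff extensional_def)

lemma weight_chi: "S \<subseteq> {..<r} \<Longrightarrow> weight r (chi r S) = card S"
  by (simp add: weight_def chi_def sum.If_cases Int_absorb1 flip: sum.inter_restrict)

lemma finite_cube [simp]: "finite (cube r)" unfolding cube_def by (intro finite_PiE) auto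
lemma card_cube [simp]: "card (cube r) = 2 ^ r" by (simp add: cube_def card_PiE numeral_2_eq_2)
lemma finite_grid [simp]: "finite (grid r N)" unfolding grid_def by (intro finite_PiE) auto
lemma card_grid [simp]: "card (grid r N) = N ^ r" by (simp add: grid_def card_PiE)

lemma sum_grid_box: "(\<Sum>m\<in>grid r N. g (\<lambda>i. if i < r then int (m i) else 0)) = (\<Sum>n\<in>box r N. g n)"
proof (rule sum.reindex_bij_betw)
  have b: "1 \<le> n i" "n i \<le> int N" if "n \<in> box r N" "i < r" for n i
    using that by (auto simp: box_def dest: spec[of _ i])
  have z: "n i = 0" if "n \<in> box r N" "\<not> i < r" for n i
    using that by (auto simp: box_def dest: spec[of _ i])
  show "bij_betw (\<lambda>m i. if i < r then int (m i) else 0) (grid r N) (box r N)"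
  proof (rule bij_betwI[where g = "\<lambda>n. \<lambda>i\<in>{..<r}. nat (n i)"])
    show "(\<lambda>n. \<lambda>i\<in>{..<r}. nat (n i)) \<in> box r N \<rightarrow> grid r N"
    proof
      fix n assume n: "n \<in> box r N"
      have "nat (n i) \<in> {1..N}" if "i < r" for i using b[OF n that] by auto
      then show "(\<lambda>i\<in>{..<r}. nat (n i)) \<in> grid r N" by (auto simp: grid_def)
    qed
    show "(\<lambda>i. if i < r then int ((\<lambda>i\<in>{..<r}. nat (n i)) i) else 0) = n" if n: "n \<in> box r N" for n
      using b(1)[OF n] z[OF n] by (force simp: fun_eq_iff)
  qed (auto simp: grid_def box_def fun_eq_iff PiE_iff extensional_def)
qed

context mps begin

lemma sq_integrable:
  fixes v :: "'a \<Rightarrow> complex"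
  assumes "v \<in> borel_measurable M" "\<And>x. norm (v x) \<le> D"
  shows "integrable M (\<lambda>x. (norm (v x))\<^sup>2)"
proof (rule integrable_const_bound[where B = "D\<^sup>2"])
  show "AE x in M. norm ((norm (v x))\<^sup>2) \<le> D\<^sup>2"
    using assms(2) by (intro AE_I2) (simp add: power_mono)
qed (use assms in measurable)

lemma BM_cjn: "f \<in> BM \<Longrightarrow> (\<lambda>x. (cnj ^^ k) (f x)) \<in> BM"
  by (induction k) (auto intro: BM_cnj)

text \<open>A model exists in every degree, so its conclusions hold unconditionally. The limit is a
  non-negative real, so the real part in \<open>ghk\<close> loses nothing.\<close>

lemma ghk_cesaro:
  assumes F: "F \<in> BM"
  shows "cesaro s F \<longlonglongrightarrow> gp (Suc s) F"
    and "\<sigma> \<in> {1,-1} \<Longrightarrow> fejer s F \<sigma> \<longlonglongrightarrow> gp (Suc s) F"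
    and "\<exists>l\<ge>0. ghk M T (Suc s) F = of_real l"
proof -
  obtain E L A \<Phi> where m: "model s E L A \<Phi>" using model_exists by blast
  obtain l where l: "l \<ge> 0" "cesaro s F \<longlonglongrightarrow> of_real l"
    "\<And>\<sigma>. \<sigma> \<in> {1,-1} \<Longrightarrow> fejer s F \<sigma> \<longlonglongrightarrow> of_real l"
    using model_cesaro[OF m F] by blast
  have e: "gp (Suc s) F = of_real l" by (rule model_ghk_Suc[OF m F l(1,2)])
  show "cesaro s F \<longlonglongrightarrow> gp (Suc s) F"
    unfolding e by (rule l(2))
  show "\<sigma> \<in> {1,-1} \<Longrightarrow> fejer s F \<sigma> \<longlonglongrightarrow> gp (Suc s) F"
    unfolding e by (rule l(3))
  have "Re (lim (cesaro s F)) \<ge> 0"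
    using l(1) limI[OF l(2)] by simp
  then show "\<exists>l\<ge>0. ghk M T (Suc s) F = of_real l"
    by (intro exI[of _ "root (2 ^ Suc s) (Re (lim (cesaro s F)))"])
       (simp del: power_Suc)
qed

lemma ghk_norm_bound:
  assumes "F \<in> BM" "\<And>x. norm (F x) \<le> C"
  shows "norm (gp s F) \<le> C ^ (2 ^ s)"
proof -
  obtain E L A \<Phi> where m: "model s E L A \<Phi>" using model_exists by blast
  then interpret osys E L A by (simp add: model_def)
  have "gp s F = L (\<Phi> F)" "\<Phi> F \<in> E" "\<And>y. norm (\<Phi> F y) \<le> C ^ (2 ^ s)"
    using m assms unfolding model_def by blast+
  then show ?thesis using L_bound by simp
qed

lemma AE_Tn:
  assumes "AE x in M. P x" shows "AE x in M. P ((T ^^ n) x)"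
proof (induction n)
  case (Suc n)
  have "AE x in distr M M T. P ((T ^^ n) x)" unfolding T_pres by (rule Suc)
  then have "AE x in M. P ((T ^^ n) (T x))" by (rule AE_distrD[OF T_meas])
  then show ?case by (simp add: funpow_swap1)
qed (use assms in simp)

text \<open>Allows dual functions, which are bounded only almost everywhere, to be replaced by
  bounded representatives.\<close>

lemma ghk_cong_AE:
  assumes "f \<in> borel_measurable M" "g \<in> borel_measurable M" "AE x in M. f x = g x"
  shows "ghk M T s f = ghk M T s g"
  using assms
proof (induction s arbitrary: f g)
  case 0
  show ?case unfolding ghk.simps by (rule integral_cong_AE[OF 0])
next
  case (Suc s)
  have "ghk M T s (mderiv T h f) = ghk M T s (mderiv T h g)" for h
  proof (rule Suc.IH)
    have Tn: "T ^^ h \<in> measurable M M" by (intro measurable_compose_n T_meas)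
    have meas: "mderiv T h u \<in> borel_measurable M" if "u \<in> borel_measurable M" for u
      unfolding mderiv_def shift_def
      using that by (auto intro!: borel_measurable_times borel_measurable_continuous_on[OF continuous_on_cnj[OF continuous_on_id]]
          measurable_compose[OF Tn])
    show "mderiv T h f \<in> borel_measurable M" "mderiv T h g \<in> borel_measurable M"
      using Suc.prems meas by auto
    show "AE x in M. mderiv T h f x = mderiv T h g x"
      using Suc.prems(3) AE_Tn[OF Suc.prems(3), of h] by eventually_elim (simp add: mderiv_def shift_def)
  qed
  then show ?case by simp
qed

lemma L2_unique:
  assumes u: "\<And>n. u n \<in> borel_measurable M" and g: "L2_tendsto M u g" and h: "L2_tendsto M u h"
  shows "AE x in M. g x = h x"
proof -
  have gm [measurable]: "g \<in> borel_measurable M" and hm [measurable]: "h \<in> borel_measurable M"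
    using g h by (auto simp: L2_tendsto_def)
  note [measurable] = u
  let ?I = "\<integral>\<^sup>+ x. ennreal ((norm (g x - h x))\<^sup>2) \<partial>M"
  let ?a = "\<lambda>n. \<integral>\<^sup>+ x. ennreal ((norm (u n x - g x))\<^sup>2) \<partial>M"
  let ?b = "\<lambda>n. \<integral>\<^sup>+ x. ennreal ((norm (u n x - h x))\<^sup>2) \<partial>M"
  have le: "?I \<le> 2 * ?a n + 2 * ?b n" for n
  proof -
    have "?I \<le> (\<integral>\<^sup>+ x. 2 * ennreal ((norm (u n x - g x))\<^sup>2) + 2 * ennreal ((norm (u n x - h x))\<^sup>2) \<partial>M)"
    proof (rule nn_integral_mono)
      fix x
      have "norm (g x - h x) \<le> norm (u n x - g x) + norm (u n x - h x)"
        using norm_triangle_ineq4[of "u n x - h x" "u n x - g x"] by simp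
      then have "(norm (g x - h x))\<^sup>2 \<le> (norm (u n x - g x) + norm (u n x - h x))\<^sup>2"
        by (intro power_mono) auto
      also have "\<dots> \<le> 2 * (norm (u n x - g x))\<^sup>2 + 2 * (norm (u n x - h x))\<^sup>2"
        using sum_squares_bound[of "norm (u n x - g x)" "norm (u n x - h x)"] by (simp add: power2_sum)
      finally show "ennreal ((norm (g x - h x))\<^sup>2) \<le> 2 * ennreal ((norm (u n x - g x))\<^sup>2) + 2 * ennreal ((norm (u n x - h x))\<^sup>2)"
        by (simp add: ennreal_mult[symmetric] flip: ennreal_plus ennreal_numeral)
    qed
    also have "\<dots> = 2 * ?a n + 2 * ?b n" by (simp add: nn_integral_add nn_integral_cmult)
    finally show ?thesis .
  qed
  have "(\<lambda>n. 2 * ?a n + 2 * ?b n) \<longlonglongrightarrow> (0 + 0) + (0 + 0)"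
    using g h unfolding L2_tendsto_def mult_2 by (intro tendsto_add) auto
  then have "?I \<le> 0" using le by (intro tendsto_lowerbound[of "\<lambda>n. 2 * ?a n + 2 * ?b n" _ sequentially]) auto
  then have "?I = 0" by simp
  then have "AE x in M. ennreal ((norm (g x - h x))\<^sup>2) = 0" by (subst (asm) nn_integral_0_iff_AE) auto
  then show ?thesis by eventually_elim (simp add: ennreal_eq_0_iff)
qed

text \<open>Completeness for uniformly bounded sequences: a subsequence with summable increments
  converges almost everywhere, and its limit inherits the bound \<open>C\<close>.\<close>

lemma L2_limit_exists:
  assumes u: "\<And>n. u n \<in> borel_measurable M" and bd: "\<And>n x. norm (u n x) \<le> C"
    and cauchy: "\<And>e. e > 0 \<Longrightarrow> \<exists>N0. \<forall>m\<ge>N0. \<forall>n\<ge>N0. (LINT x|M. (norm (u m x - u n x))\<^sup>2) < e"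
  shows "\<exists>g\<in>BM. (\<forall>x. norm (g x) \<le> C) \<and> L2_tendsto M u g"
proof -
  note [measurable] = u
  let ?I = "\<lambda>m n. LINT x|M. (norm (u m x - u n x))\<^sup>2" and ?I1 = "\<lambda>m n. LINT x|M. norm (u m x - u n x)"
  have C0: "0 \<le> C" using bd norm_ge_zero order_trans by blast
  have bd2: "norm (u m x - u n x) \<le> 2 * C" for m n x
    using norm_triangle_ineq4[of "u m x" "u n x"] bd[of m x] bd[of n x] by linarith
  have int: "integrable M (\<lambda>x. norm (u m x - u n x))" "integrable M (\<lambda>x. (norm (u m x - u n x))\<^sup>2)" for m n
    using bd2 by (auto intro!: integrable_const_bound[where B = "2 * C"] sq_integrable[where D = "2 * C"])
  \<comment> \<open>The pointwise inequality \<open>2 * e * a \<le> e\<^sup>2 + a\<^sup>2\<close>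
    passes from mean squares to means.\<close>
  have L1: "?I1 m n \<le> e" if e: "e > 0" "?I m n < e\<^sup>2" for m n e
  proof -
    have "2 * e * ?I1 m n = (LINT x|M. 2 * e * norm (u m x - u n x))" by simp
    also have "\<dots> \<le> (LINT x|M. e\<^sup>2 + (norm (u m x - u n x))\<^sup>2)"
      using int[of m n] sum_squares_bound[of e] by (intro integral_mono) auto
    also have "\<dots> = e\<^sup>2 + ?I m n" using int[of m n] by (simp add: prob_space)
    also have "\<dots> \<le> 2 * e * e" using e by (simp add: power2_eq_square)
    finally show ?thesis using e(1) by simp
  qed
  have "\<exists>N. \<forall>m\<ge>N. \<forall>n\<ge>N. ?I1 m n \<le> (1/2) ^ k" for k :: nat
    using cauchy[of "((1/2) ^ k)\<^sup>2"] L1[of "(1/2) ^ k"] by (meson zero_less_power half_gt_zero zero_less_one)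
  then have "\<exists>N. \<forall>k m n. N k \<le> m \<longrightarrow> N k \<le> n \<longrightarrow> ?I1 m n \<le> (1/2) ^ (k::nat)"
    by (subst choice_iff[symmetric]) blast
  then obtain N where N: "\<And>k m n. N k \<le> m \<Longrightarrow> N k \<le> n \<Longrightarrow> ?I1 m n \<le> (1/2) ^ k"
    by blast
  \<comment> \<open>The sum puts both \<open>q k\<close> and \<open>q (Suc k)\<close> above
    \<open>N k\<close>; the summand \<open>k\<close> makes \<open>q\<close> diverge.\<close>
  define q where "q k = k + (\<Sum>j\<le>k. N j)" for k
  have qN: "N k \<le> q k" "N k \<le> q (Suc k)" for k
    using member_le_sum[of k "{..k}" N] member_le_sum[of k "{..Suc k}" N] by (auto simp: q_def)
  have "k \<le> q k" for k by (simp add: q_def)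
  then have q_lim: "filterlim q at_top sequentially"
    by (intro filterlim_at_top_mono[OF filterlim_ident]) simp
  let ?d = "\<lambda>k x. norm (u (q (Suc k)) x - u (q k) x)"
  have "(\<integral>\<^sup>+ x. (\<Sum>k. ennreal (?d k x)) \<partial>M) = (\<Sum>k. \<integral>\<^sup>+ x. ennreal (?d k x) \<partial>M)"
    by (intro nn_integral_suminf) measurable
  also have "\<dots> \<le> (\<Sum>k. ennreal ((1/2) ^ k))"
  proof (intro suminf_le summableI)
    fix k
    have "(\<integral>\<^sup>+ x. ennreal (?d k x) \<partial>M) = ennreal (LINT x|M. ?d k x)"
      by (intro nn_integral_eq_integral int) auto
    also have "\<dots> \<le> ennreal ((1/2) ^ k)" using N[OF qN(2,1)] by (intro ennreal_leI)
    finally show "(\<integral>\<^sup>+ x. ennreal (?d k x) \<partial>M) \<le> ennreal ((1/2) ^ k)" .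
  qed
  also have "\<dots> = ennreal (\<Sum>k. (1/2) ^ k)" by (intro suminf_ennreal2) (auto intro: summable_geometric)
  finally have "(\<integral>\<^sup>+ x. (\<Sum>k. ennreal (?d k x)) \<partial>M) \<noteq> \<infinity>"
    by (metis ennreal_less_top infinity_ennreal_def leD)
  then have "AE x in M. (\<Sum>k. ennreal (?d k x)) \<noteq> \<infinity>"
    by (intro nn_integral_noteq_infinite) auto
  then have conv: "AE x in M. convergent (\<lambda>k. u (q k) x)"
  proof eventually_elim
    case (elim x)
    then have "summable (\<lambda>k. ?d k x)" by (intro summable_suminf_not_top) auto
    then have "summable (\<lambda>k. u (q (Suc k)) x - u (q k) x)" by (rule summable_norm_cancel)
    then have "convergent (\<lambda>n. \<Sum>k<n. u (q (Suc k)) x - u (q k) x)" by (simp add: summable_iff_convergent)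
    then have "convergent (\<lambda>n. u (q n) x - u (q 0) x)" by (simp add: sum_lessThan_telescope[of "\<lambda>k. u (q k) x"])
    then have "convergent (\<lambda>n. (u (q n) x - u (q 0) x) + u (q 0) x)" by (rule convergent_add[OF _ convergent_const])
    then show ?case by simp
  qed
  \<comment> \<open>\<open>lim\<close> is arbitrary where the subsequence diverges; the value 0
    restores the bound \<open>C\<close> wherever it fails.\<close>
  define g where "g x = (if norm (lim (\<lambda>k. u (q k) x)) \<le> C then lim (\<lambda>k. u (q k) x) else 0)" for x
  let ?Ig = "\<lambda>n. LINT x|M. (norm (u n x - g x))\<^sup>2"
  have g_meas [measurable]: "g \<in> borel_measurable M" unfolding g_def by measurable
  have g_bd: "norm (g x) \<le> C" for x using C0 by (simp add: g_def)
  have ug: "AE x in M. (\<lambda>k. u (q k) x) \<longlonglongrightarrow> g x"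
    using conv
  proof eventually_elim
    case (elim x)
    then have l: "(\<lambda>k. u (q k) x) \<longlonglongrightarrow> lim (\<lambda>k. u (q k) x)" by (simp add: convergent_LIMSEQ_iff)
    then have "norm (lim (\<lambda>k. u (q k) x)) \<le> C"
      using bd by (intro Lim_norm_ubound[OF _ l]) auto
    then show ?case using l by (simp add: g_def)
  qed
  have bdg: "norm (u n x - g x) \<le> 2 * C" for n x
    using norm_triangle_ineq4[of "u n x" "g x"] bd[of n x] g_bd[of x] by linarith
  have intg: "integrable M (\<lambda>x. (norm (u n x - g x))\<^sup>2)" for n
    using bdg by (intro sq_integrable) auto
  have lim: "(\<lambda>n. LINT x|M. (norm (u n x - g x))\<^sup>2) \<longlonglongrightarrow> 0"
  proof (rule LIMSEQ_I)
    fix e :: real assume e: "e > 0"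
    then obtain N0 where N0: "\<And>m n. m \<ge> N0 \<Longrightarrow> n \<ge> N0 \<Longrightarrow> ?I m n < e / 2"
      using cauchy[of "e / 2"] by auto
    have "norm (?Ig n - 0) < e" if n: "n \<ge> N0" for n
    proof -
      have "(\<lambda>k. LINT x|M. (norm (u n x - u (q k) x))\<^sup>2) \<longlonglongrightarrow> ?Ig n"
      proof (rule integral_dominated_convergence[where w = "\<lambda>_. (2 * C)\<^sup>2"])
        show "AE x in M. (\<lambda>k. (norm (u n x - u (q k) x))\<^sup>2) \<longlonglongrightarrow> (norm (u n x - g x))\<^sup>2"
          using ug by eventually_elim (intro tendsto_intros)
        show "AE x in M. norm ((norm (u n x - u (q k) x))\<^sup>2) \<le> (2 * C)\<^sup>2" for k
          using power_mono[OF bd2[of n _ "q k"] norm_ge_zero, where n = 2] by (intro AE_I2) simp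
      qed auto
      moreover have "eventually (\<lambda>k. ?I n (q k) \<le> e / 2) sequentially"
        using filterlim_at_top[THEN iffD1, OF q_lim, rule_format, of N0]
        by eventually_elim (use N0[OF n] in \<open>auto intro: less_imp_le\<close>)
      ultimately have "?Ig n \<le> e / 2"
        by (intro tendsto_upperbound[of _ _ sequentially]) auto
      then show ?thesis using e by (simp add: abs_of_nonneg)
    qed
    then show "\<exists>no. \<forall>n\<ge>no. norm (?Ig n - 0) < e" by blast
  qed
  have "L2_tendsto M u g"
    unfolding L2_tendsto_def
  proof (intro conjI)
    show "integrable M (\<lambda>x. (norm (g x))\<^sup>2)"
      using g_bd by (intro sq_integrable) auto
    have "(\<integral>\<^sup>+ x. ennreal ((norm (u n x - g x))\<^sup>2) \<partial>M) = ennreal (?Ig n)" for n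
      by (intro nn_integral_eq_integral intg) auto
    then show "(\<lambda>n. \<integral>\<^sup>+ x. ennreal ((norm (u n x - g x))\<^sup>2) \<partial>M) \<longlonglongrightarrow> 0"
      using tendsto_ennrealI[OF lim] by simp
  qed (rule g_meas)
  then show ?thesis using g_bd g_meas by (intro bexI[of _ g]) (auto simp: BM_def)
qed

text \<open>Lets a dual function inside an integral be replaced by its finite averages.\<close>

lemma L2_weak:
  assumes u: "\<And>n. u n \<in> BM" and g: "g \<in> BM" and R: "R \<in> BM" and lim: "L2_tendsto M u g"
  shows "(\<lambda>n. LINT x|M. u n x * R x) \<longlonglongrightarrow> (LINT x|M. g x * R x)"
proof -
  obtain B where B: "\<And>x. norm (R x) \<le> B" using BM_bdd[OF R] by blast
  have B0: "0 \<le> B" using B norm_ge_zero order_trans by blast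
  have d: "(\<lambda>x. u n x - g x) \<in> BM" for n using u g by (intro BM_diff)
  have [measurable]: "u n \<in> borel_measurable M" "g \<in> borel_measurable M" for n using u g BM_measurable by auto
  have int2: "integrable M (\<lambda>x. (norm (u n x - g x))\<^sup>2)" for n
  proof -
    obtain D where "\<And>x. norm (u n x - g x) \<le> D" using BM_bdd[OF d] by blast
    then show ?thesis by (intro sq_integrable) auto
  qed
  have "(\<lambda>n. ennreal (LINT x|M. (norm (u n x - g x))\<^sup>2)) \<longlonglongrightarrow> ennreal 0"
  proof -
    have "(\<integral>\<^sup>+ x. ennreal ((norm (u n x - g x))\<^sup>2) \<partial>M) = ennreal (LINT x|M. (norm (u n x - g x))\<^sup>2)" for n
      by (intro nn_integral_eq_integral int2) auto
    then show ?thesis using lim by (simp add: L2_tendsto_def)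
  qed
  then have l2: "(\<lambda>n. LINT x|M. (norm (u n x - g x))\<^sup>2) \<longlonglongrightarrow> 0"
    by (subst (asm) tendsto_ennreal_iff) auto
  have "(\<lambda>n. LINT x|M. norm (u n x - g x)) \<longlonglongrightarrow> 0"
  proof (rule LIMSEQ_I)
    fix e :: real assume e: "e > 0"
    obtain no where no: "\<And>n. n \<ge> no \<Longrightarrow> (LINT x|M. (norm (u n x - g x))\<^sup>2) < (e/2)\<^sup>2"
      using LIMSEQ_D[OF l2, of "(e/2)\<^sup>2"] e by fastforce
    have "norm ((LINT x|M. norm (u n x - g x)) - 0) < e" if "n \<ge> no" for n
    proof -
      have int1: "integrable M (\<lambda>x. norm (u n x - g x))" using BM_integrable[OF d] by (rule integrable_norm)
      have "2 * (e/2) * (LINT x|M. norm (u n x - g x)) = (LINT x|M. 2 * (e/2) * norm (u n x - g x))" by simp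
      also have "\<dots> \<le> (LINT x|M. (e/2)\<^sup>2 + (norm (u n x - g x))\<^sup>2)"
        using int1 int2 sum_squares_bound[of "e/2"] by (intro integral_mono) (auto simp: prob_space)
      also have "\<dots> = (e/2)\<^sup>2 + (LINT x|M. (norm (u n x - g x))\<^sup>2)" using int2 by (simp add: prob_space)
      also have "\<dots> \<le> e * (e / 2)" using no[OF that] e by (simp add: power2_eq_square)
      finally have "(LINT x|M. norm (u n x - g x)) \<le> e / 2" using e by simp
      then show ?thesis using e by (simp add: abs_of_nonneg)
    qed
    then show "\<exists>no. \<forall>n\<ge>no. norm ((LINT x|M. norm (u n x - g x)) - 0) < e" by blast
  qed
  then have lim0: "(\<lambda>n. B * (LINT x|M. norm (u n x - g x))) \<longlonglongrightarrow> 0"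
    by (rule tendsto_mult_right_zero)
  have le: "norm ((LINT x|M. u n x * R x) - (LINT x|M. g x * R x)) \<le> B * (LINT x|M. norm (u n x - g x))" for n
  proof -
    have "(LINT x|M. u n x * R x) - (LINT x|M. g x * R x) = (LINT x|M. (u n x - g x) * R x)"
      using BM_integrable[OF BM_mult[OF u R]] BM_integrable[OF BM_mult[OF g R]]
      by (simp add: left_diff_distrib)
    also have "norm \<dots> \<le> (LINT x|M. norm ((u n x - g x) * R x))" by (rule integral_norm_bound)
    also have "\<dots> \<le> (LINT x|M. B * norm (u n x - g x))"
    proof (rule integral_mono)
      show "integrable M (\<lambda>x. norm ((u n x - g x) * R x))"
        using BM_integrable[OF BM_mult[OF d R]] by (rule integrable_norm)
      show "integrable M (\<lambda>x. B * norm (u n x - g x))" using BM_integrable[OF d] by auto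
      show "norm ((u n x - g x) * R x) \<le> B * norm (u n x - g x)" for x
        using B[of x] by (simp add: norm_mult mult.commute mult_right_mono)
    qed
    finally show ?thesis by simp
  qed
  have "(\<lambda>n. (LINT x|M. u n x * R x) - (LINT x|M. g x * R x)) \<longlonglongrightarrow> 0"
    by (rule Lim_null_comparison[OF _ lim0]) (simp add: le)
  then show ?thesis by (simp add: LIM_zero_iff)
qed

text \<open>Without the empty vertex the family would not be closed under intersection, so the
  vertex stays and carries the constant function 1.\<close>

lemma dual_avg_cav:
  "dual_avg T r f N x = osys.cav (A0 r) r (Pow {..<r})
     (\<lambda>\<epsilon> y. if \<epsilon> = {} then 1 else (cnj ^^ card \<epsilon>) (f (base y))) N (pt0 x)"
proof -
  interpret osys E0 L0 "A0 r" by (rule base_osys)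
  let ?P = "\<lambda>m. \<Prod>\<epsilon>\<in>cube r - {\<lambda>j\<in>{..<r}. 0}. (cnj ^^ weight r \<epsilon>) (shift T (\<Sum>j<r. \<epsilon> j * m j) f x)"
    and ?i = "\<lambda>m i. if i < r then int (m i) else 0"
  have "?P m
      = (\<Prod>\<epsilon>\<in>Pow {..<r}. if \<epsilon> = {} then 1 else (cnj ^^ card \<epsilon>) (f (base (A0 r (rs \<epsilon> (?i m)) (pt0 x)))))"
    for m
  proof -
    have z: "chi r {} = (\<lambda>j\<in>{..<r}. 0)" by (simp add: chi_def)
    have "bij_betw (chi r) (Pow {..<r} - {{}}) (cube r - {\<lambda>j\<in>{..<r}. 0})"
      unfolding z[symmetric] using bij_chi[of r] by (intro bij_betw_DiffI) (auto simp: bij_betw_def)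
    from prod.reindex_bij_betw[OF this, symmetric]
    have "?P m
       = (\<Prod>S\<in>Pow {..<r} - {{}}. (cnj ^^ weight r (chi r S)) (shift T (\<Sum>j<r. chi r S j * m j) f x))" .
    also have "\<dots> = (\<Prod>\<epsilon>\<in>Pow {..<r} - {{}}. (cnj ^^ card \<epsilon>) (f (base (A0 r (rs \<epsilon> (?i m)) (pt0 x)))))"
    proof (rule prod.cong)
      fix S assume S: "S \<in> Pow {..<r} - {{}}"
      have "int (\<Sum>j<r. chi r S j * m j) = (\<Sum>i<r. rs S (?i m) i)"
        unfolding of_nat_sum by (rule sum.cong) (auto simp: chi_def rs_def)
      then have "base (A0 r (rs S (?i m)) (pt0 x)) = (T ^^ (\<Sum>j<r. chi r S j * m j)) x"
        by (metis base_A0 base_pt0 zpow_of_nat)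
      then show "(cnj ^^ weight r (chi r S)) (shift T (\<Sum>j<r. chi r S j * m j) f x)
        = (cnj ^^ card S) (f (base (A0 r (rs S (?i m)) (pt0 x))))"
        using S by (simp add: weight_chi shift_def)
    qed simp
    also have "\<dots> = (\<Prod>\<epsilon>\<in>Pow {..<r}. if \<epsilon> = {} then 1 else (cnj ^^ card \<epsilon>) (f (base (A0 r (rs \<epsilon> (?i m)) (pt0 x)))))"
      by (subst prod.remove[of "Pow {..<r}" "{}"]) (auto intro!: prod.cong)
    finally show ?thesis .
  qed
  then show ?thesis
    unfolding dual_avg_def cav_def
    using sum_grid_box[of "\<lambda>n. \<Prod>\<epsilon>\<in>Pow {..<r}. if \<epsilon> = {} then 1 else (cnj ^^ card \<epsilon>) (f (base (A0 r (rs \<epsilon> n) (pt0 x))))" r N]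
    by simp
qed

lemma dual_avg_BM: "f \<in> BM \<Longrightarrow> dual_avg T r f N \<in> BM"
  unfolding dual_avg_def shift_def by (intro BM_divide BM_sum BM_prod BM_cjn BM_Tn)

lemma dual_avg_bound:
  assumes C: "\<And>x. norm (f x) \<le> C" "1 \<le> C"
  shows "norm (dual_avg T r f N x) \<le> C ^ (2 ^ r)"
proof -
  let ?P = "\<lambda>m. \<Prod>\<epsilon>\<in>cube r - {\<lambda>j\<in>{..<r}. 0}. (cnj ^^ weight r \<epsilon>) (shift T (\<Sum>j<r. \<epsilon> j * m j) f x)"
  have "norm (?P m) \<le> C ^ (2 ^ r)" for m
  proof -
    have "norm (?P m)
       \<le> C ^ card (cube r - {\<lambda>j\<in>{..<r}. 0})"
      using C(1) by (intro osys.prod_bound[OF base_osys]) (simp add: shift_def)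
    also have "\<dots> \<le> C ^ (2 ^ r)"
      using C(2) card_mono[of "cube r" "cube r - {\<lambda>j\<in>{..<r}. 0}"] by (intro power_increasing) auto
    finally show ?thesis .
  qed
  then have "norm (\<Sum>m\<in>grid r N. ?P m)
     \<le> real N ^ r * C ^ (2 ^ r)"
    by (intro order_trans[OF sum_norm_bound]) auto
  then have "norm (dual_avg T r f N x) \<le> real N ^ r * C ^ (2 ^ r) / real N ^ r"
    unfolding dual_avg_def norm_divide norm_power norm_of_nat by (intro divide_right_mono) auto
  also have "\<dots> \<le> C ^ (2 ^ r)" using C(2) by simp
  finally show ?thesis .
qed

text \<open>Convergence of cube averages makes the choice in \<open>dual_fun\<close> a genuine
  limit. The chosen function is bounded only almost everywhere, hence the second function
  \<open>g\<close>.\<close>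

lemma dual_fun_exists:
  assumes f: "f \<in> BM" and C: "\<And>x. norm (f x) \<le> C" "1 \<le> C"
  shows "\<exists>g\<in>BM. (\<forall>x. norm (g x) \<le> C ^ (2 ^ r)) \<and> (AE x in M. dual_fun M T r f x = g x) \<and>
      L2_tendsto M (dual_avg T r f) g \<and> dual_fun M T r f \<in> borel_measurable M"
proof -
  interpret osys E0 L0 "A0 r" by (rule base_osys)
  let ?F = "\<lambda>\<epsilon> y. if \<epsilon> = {} then 1 else (cnj ^^ card \<epsilon>) (f (base y))"
  let ?I = "\<lambda>m n. LINT x|M. (norm (dual_avg T r f m x - dual_avg T r f n x))\<^sup>2" and ?c = "cav r (Pow {..<r}) ?F"
  have FE: "?F \<epsilon> \<in> E0" for \<epsilon>
    using E0_I[OF BM_cjn[OF f], of "card \<epsilon>"] E_const[of 1] by (cases "\<epsilon> = {}") simp_all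
  have cc: "ccauchy r (Pow {..<r}) ?F"
    by (rule cube_averages_cauchy[OF _ base_osys FE]) (auto simp: good_family_def)
  have cauchy: "\<exists>N0. \<forall>m\<ge>N0. \<forall>n\<ge>N0. ?I m n < e" if e: "e > 0" for e
  proof -
    obtain N0 where N0: "\<And>m n. m \<ge> N0 \<Longrightarrow> n \<ge> N0 \<Longrightarrow>
       sn (\<lambda>y. ?c m y - ?c n y) < sqrt e"
      using cc e unfolding ccauchy_def by (meson real_sqrt_gt_zero)
    have "?I m n < e" if "m \<ge> N0" "n \<ge> N0" for m n
    proof -
      let ?\<phi> = "\<lambda>y. ?c m y - ?c n y"
      have \<phi>: "?\<phi> \<in> E0" by (intro E_diff cav_E FE)
      have "ip ?\<phi> ?\<phi> = (LINT x|M. of_real ((norm (dual_avg T r f m x - dual_avg T r f n x))\<^sup>2))"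
        unfolding ip_def L0_def dual_avg_cav complex_norm_square ..
      also have "\<dots> = of_real (?I m n)"
        by (rule integral_complex_of_real)
      finally have "sn ?\<phi> = sqrt (?I m n)"
        by (simp only: sn_def Re_complex_of_real)
      then show ?thesis using N0[OF that] by simp
    qed
    then show ?thesis by blast
  qed
  have u: "dual_avg T r f n \<in> borel_measurable M" for n by (rule BM_measurable[OF dual_avg_BM[OF f]])
  have "\<exists>g\<in>BM. (\<forall>x. norm (g x) \<le> C ^ (2 ^ r)) \<and> L2_tendsto M (dual_avg T r f) g"
    by (rule L2_limit_exists[OF u dual_avg_bound[OF C] cauchy])
  then obtain g where g: "g \<in> BM" "\<forall>x. norm (g x) \<le> C ^ (2 ^ r)" "L2_tendsto M (dual_avg T r f) g"
    by blast
  have d: "L2_tendsto M (dual_avg T r f) (dual_fun M T r f)"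
    unfolding dual_fun_def by (rule someI[of "L2_tendsto M (dual_avg T r f)", OF g(3)])
  have "AE x in M. dual_fun M T r f x = g x"
    by (rule L2_unique[OF u d g(3)])
  moreover have "dual_fun M T r f \<in> borel_measurable M" using d by (simp add: L2_tendsto_def)
  ultimately show ?thesis using g by blast
qed

end

section \<open>Box averages over windows\<close>

text \<open>The side depends on the coordinate because \<open>box_pow_approx\<close> fixes the outer
  sides before the inner ones.\<close>

definition gridK :: "nat \<Rightarrow> (nat \<Rightarrow> nat) \<Rightarrow> (nat \<Rightarrow> nat) set" where
  "gridK r K = (\<Pi>\<^sub>E i\<in>{..<r}. {1..K i})"

lemma finite_gridK [simp]: "finite (gridK r K)" unfolding gridK_def by (intro finite_PiE) auto
lemma card_gridK [simp]: "card (gridK r K) = (\<Prod>i<r. K i)" by (simp add: gridK_def card_PiE)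

lemma sum_PiE_Suc:
  "(\<Sum>\<tau>\<in>PiE {..<Suc r} B. a \<tau>) = (\<Sum>t\<in>B r. \<Sum>\<tau>\<in>PiE {..<r} B. a (\<tau>(r := t)))"
proof -
  have "PiE {..<Suc r} B = (\<lambda>(t, \<tau>). \<tau>(r := t)) ` (B r \<times> PiE {..<r} B)"
    using PiE_insert_eq[of r "{..<r}" B] by (simp add: lessThan_Suc)
  then have "(\<Sum>\<tau>\<in>PiE {..<Suc r} B. a \<tau>) = (\<Sum>(t, \<tau>)\<in>B r \<times> PiE {..<r} B. a (\<tau>(r := t)))"
    using inj_combinator[of r "{..<r}" B] by (simp add: sum.reindex case_prod_unfold)
  then show ?thesis by (simp add: sum.cartesian_product)
qed

lemma sum_gridK_Suc:
  "(\<Sum>\<tau>\<in>gridK (Suc r) K. a \<tau>) = (\<Sum>t=1..K r. \<Sum>\<tau>\<in>gridK r K. a (\<tau>(r := t)))"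
  unfolding gridK_def by (rule sum_PiE_Suc)

lemma gridK_0 [simp]: "gridK 0 K = {\<lambda>_. undefined}"
  by (simp add: gridK_def)

text \<open>Jensen's inequality for the power \<open>2 ^ n\<close>, by iterating
  Cauchy-Schwarz.\<close>

lemma mean_pow2:
  fixes a :: "'i \<Rightarrow> real"
  assumes "finite I" "\<And>i. i \<in> I \<Longrightarrow> 0 \<le> a i"
  shows "((\<Sum>i\<in>I. a i) / card I) ^ (2 ^ n) \<le> (\<Sum>i\<in>I. a i ^ (2 ^ n)) / card I"
  using assms(2)
proof (induction n arbitrary: a)
  case (Suc n)
  have sq: "((\<Sum>i\<in>I. a i) / card I)\<^sup>2 \<le> (\<Sum>i\<in>I. (a i)\<^sup>2) / card I"
  proof (cases "card I = 0")
    case False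
    have "(\<Sum>i\<in>I. a i)\<^sup>2 / (real (card I))\<^sup>2 \<le> (\<Sum>i\<in>I. (a i)\<^sup>2) * card I / (real (card I))\<^sup>2"
      by (intro divide_right_mono sum_squared_le_sum_of_squares) simp
    then show ?thesis using False by (simp add: power_divide power2_eq_square)
  qed simp
  have "((\<Sum>i\<in>I. a i) / card I) ^ (2 ^ Suc n) = (((\<Sum>i\<in>I. a i) / card I)\<^sup>2) ^ (2 ^ n)"
    by (simp add: power_mult[symmetric])
  also have "\<dots> \<le> ((\<Sum>i\<in>I. (a i)\<^sup>2) / card I) ^ (2 ^ n)"
    by (intro power_mono sq) simp
  also have "\<dots> \<le> (\<Sum>i\<in>I. ((a i)\<^sup>2) ^ (2 ^ n)) / card I" by (rule Suc.IH) simp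
  finally show ?case by (simp add: power_mult[symmetric])
qed simp

context mps begin

definition lin :: "(nat \<Rightarrow> int) \<Rightarrow> nat \<Rightarrow> (nat \<Rightarrow> nat) \<Rightarrow> int" where
  "lin c r \<tau> = (\<Sum>i<r. c i * int (\<tau> i))"

text \<open>The power of the seminorm with every limit replaced by a Fejer mean of finite side;
  \<open>c i\<close> is the direction of the coordinate \<open>i\<close>.\<close>

primrec box_pow :: "(nat \<Rightarrow> int) \<Rightarrow> (nat \<Rightarrow> nat) \<Rightarrow> nat \<Rightarrow> ('a \<Rightarrow> complex) \<Rightarrow> complex" where
  "box_pow c K 0 F = (LINT x|M. F x)"
| "box_pow c K (Suc r) F = (\<Sum>a=1..K r. \<Sum>b=1..K r.
      box_pow c K r (\<lambda>x. F (Tz (c r * int a) x) * cnj (F (Tz (c r * int b) x)))) / of_nat (K r) ^ 2"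

lemma box_pow_cong: "(\<And>i. i < r \<Longrightarrow> K i = K' i) \<Longrightarrow> box_pow c K r F = box_pow c K' r F"
  by (induction r arbitrary: F) auto

lemma box_pow_Tz: "F \<in> BM \<Longrightarrow> box_pow c K r (\<lambda>x. F (Tz z x)) = box_pow c K r F"
proof (induction r arbitrary: F)
  case 0
  then show ?case by (simp add: integral_Tz BM_measurable)
next
  case (Suc r)
  have "box_pow c K r (\<lambda>x. F (Tz z (Tz a x)) * cnj (F (Tz z (Tz b x)))) = box_pow c K r (\<lambda>x. F (Tz a x) * cnj (F (Tz b x)))" for a b
  proof -
    have "box_pow c K r (\<lambda>x. F (Tz z (Tz a x)) * cnj (F (Tz z (Tz b x)))) = box_pow c K r (\<lambda>x. (\<lambda>x. F (Tz a x) * cnj (F (Tz b x))) (Tz z x))"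
      by (simp add: Tz_add[symmetric] add.commute)
    also have "\<dots> = box_pow c K r (\<lambda>x. F (Tz a x) * cnj (F (Tz b x)))"
      by (rule Suc.IH) (intro BM_intros Suc.prems)
    finally show ?thesis .
  qed
  then show ?case by simp
qed

lemma box_pow_cnj: "box_pow c K r (\<lambda>x. cnj (F x)) = cnj (box_pow c K r F)"
proof (induction r arbitrary: F)
  case (Suc r)
  have "box_pow c K r (\<lambda>x. cnj (F (Tz a x)) * F (Tz b x)) = cnj (box_pow c K r (\<lambda>x. F (Tz a x) * cnj (F (Tz b x))))" for a b
    using Suc.IH[of "\<lambda>x. F (Tz a x) * cnj (F (Tz b x))"] by simp
  then show ?case by simp
qed simp

lemma box_pow_cjn: "norm (box_pow c K r (\<lambda>x. (cnj ^^ k) (F x))) = norm (box_pow c K r F)"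
proof (induction k)
  case (Suc k)
  then show ?case using box_pow_cnj[of c K r "\<lambda>x. (cnj ^^ k) (F x)"] by simp
qed simp

text \<open>The outermost Fejer mean turns one function into finitely many, which all need the same
  inner sides; hence the statement for finite families.\<close>

lemma box_pow_approx:
  assumes c: "\<And>i. c i \<in> {1, -1}" and \<F>: "finite \<F>" "\<F> \<subseteq> BM" and e: "e > 0"
  shows "\<exists>K. (\<forall>i. K i > 0) \<and> (\<forall>F\<in>\<F>. norm (box_pow c K r F - gp r F) < e)"
  using \<F> e
proof (induction r arbitrary: \<F> e)
  case 0
  then show ?case by (intro exI[of _ "\<lambda>_. 1"]) auto
next
  case (Suc r)
  let ?G = "\<lambda>F a b x. F (Tz (c r * int a) x) * cnj (F (Tz (c r * int b) x))"
  let ?A = "\<lambda>F k. (\<Sum>a=1..k. \<Sum>b=1..k. gp r (?G F a b)) / of_nat k ^ 2"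
  have "\<forall>\<^sub>F k in sequentially. \<forall>F\<in>\<F>. norm (?A F k - gp (Suc r) F) < e / 2"
  proof (intro eventually_ball_finite Suc.prems ballI)
    fix F assume "F \<in> \<F>"
    then have "?A F \<longlonglongrightarrow> gp (Suc r) F"
      using ghk_cesaro(2)[of F "c r" r] c Suc.prems by blast
    from tendstoD[OF this half_gt_zero[OF Suc.prems(3)]]
    show "\<forall>\<^sub>F k in sequentially. norm (?A F k - gp (Suc r) F) < e / 2"
      by (simp only: dist_norm)
  qed
  from eventually_happens'[OF sequentially_bot eventually_conj[OF eventually_gt_at_top[of 0] this]]
  obtain k where k: "k > 0" "\<And>F. F \<in> \<F> \<Longrightarrow> norm (?A F k - gp (Suc r) F) < e / 2"
    by blast
  define \<G> where "\<G> = (\<lambda>(F, a, b). ?G F a b) ` (\<F> \<times> {1..k} \<times> {1..k})"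
  have "finite \<G>" using Suc.prems by (simp add: \<G>_def)
  moreover have "\<G> \<subseteq> BM" using Suc.prems by (auto simp: \<G>_def intro!: BM_mult BM_cnj BM_Tz)
  moreover have "e / 2 > 0" using Suc.prems by simp
  ultimately obtain K where K: "\<And>i. K i > 0" "\<And>G. G \<in> \<G> \<Longrightarrow> norm (box_pow c K r G - gp r G) < e / 2"
    using Suc.IH[of \<G> "e / 2"] by blast
  define K' where "K' = K(r := k)"
  have "norm (box_pow c K' (Suc r) F - gp (Suc r) F) < e" if F: "F \<in> \<F>" for F
  proof -
    have JK: "box_pow c K' r G = box_pow c K r G" for G by (rule box_pow_cong) (simp add: K'_def)
    have "norm (\<Sum>a=1..k. \<Sum>b=1..k. box_pow c K r (?G F a b) - gp r (?G F a b)) \<le> (\<Sum>a=1..k. \<Sum>b=1..k. e / 2)"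
    proof (intro order_trans[OF norm_sum] sum_mono)
      fix a b assume "a \<in> {1..k}" "b \<in> {1..k}"
      then have "?G F a b \<in> \<G>" using F by (auto simp: \<G>_def intro!: image_eqI[of _ _ "(F, a, b)"])
      then show "norm (box_pow c K r (?G F a b) - gp r (?G F a b)) \<le> e / 2"
        using K(2) less_imp_le by blast
    qed
    then have "norm ((\<Sum>a=1..k. \<Sum>b=1..k. box_pow c K r (?G F a b) - gp r (?G F a b)) / of_nat k ^ 2) \<le> e / 2"
      using k(1) unfolding norm_divide norm_power norm_of_nat by (simp add: divide_le_eq power2_eq_square ac_simps)
    moreover have "box_pow c K' (Suc r) F - ?A F k = (\<Sum>a=1..k. \<Sum>b=1..k. box_pow c K r (?G F a b) - gp r (?G F a b)) / of_nat k ^ 2"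
      unfolding box_pow.simps(2) JK by (simp add: K'_def sum_subtractf diff_divide_distrib)
    ultimately have "norm (box_pow c K' (Suc r) F - ?A F k) \<le> e / 2" by simp
    then show ?thesis using k(2)[OF F] norm_triangle_ineq[of "box_pow c K' (Suc r) F - ?A F k" "?A F k - gp (Suc r) F"]
      by simp
  qed
  moreover have "K' i > 0" for i using K(1) k(1) by (simp add: K'_def)
  ultimately show ?case by blast
qed

lemma integral_cauchy_schwarz:
  assumes "b \<in> BM" "S \<in> BM" "\<And>x. norm (b x) \<le> 1"
  shows "(norm (LINT x|M. b x * S x))\<^sup>2 \<le> (LINT x|M. (norm (S x))\<^sup>2)"
proof -
  let ?g = "\<lambda>x. norm (S x)"
  have S1: "integrable M ?g" using BM_integrable[OF assms(2)] by (rule integrable_norm)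
  obtain D where "\<And>x. norm (S x) \<le> D" using BM_bdd[OF assms(2)] by blast
  then have S2: "integrable M (\<lambda>x. (?g x)\<^sup>2)" using BM_measurable[OF assms(2)] by (intro sq_integrable) auto
  define m where "m = (LINT x|M. ?g x)"
  have "norm (LINT x|M. b x * S x) \<le> (LINT x|M. norm (b x * S x))" by (rule integral_norm_bound)
  also have "\<dots> \<le> m" unfolding m_def
  proof (rule integral_mono[OF _ S1])
    show "integrable M (\<lambda>x. norm (b x * S x))"
      using BM_integrable[OF BM_mult[OF assms(1,2)]] by (rule integrable_norm)
    show "norm (b x * S x) \<le> ?g x" for x
      using assms(3)[of x] mult_right_mono[of "norm (b x)" 1 "norm (S x)"] by (simp add: norm_mult)
  qed
  finally have "(norm (LINT x|M. b x * S x))\<^sup>2 \<le> m\<^sup>2" by (rule power_mono) simp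
  also have "m\<^sup>2 \<le> (LINT x|M. (?g x)\<^sup>2)"
  proof -
    have "2 * m * m = (LINT x|M. 2 * m * ?g x)" by (simp add: m_def)
    also have "\<dots> \<le> (LINT x|M. m\<^sup>2 + (?g x)\<^sup>2)"
      using S1 S2 sum_squares_bound[of m] by (intro integral_mono) auto
    also have "\<dots> = m\<^sup>2 + (LINT x|M. (?g x)\<^sup>2)" using S2 by (simp add: prob_space)
    finally show ?thesis by (simp add: power2_eq_square)
  qed
  finally show ?thesis .
qed

definition box_form :: "(nat \<Rightarrow> int) \<Rightarrow> (nat \<Rightarrow> nat) \<Rightarrow> nat \<Rightarrow> ('a \<Rightarrow> complex) \<Rightarrow> (nat \<Rightarrow> (nat \<Rightarrow> nat) \<Rightarrow> 'a \<Rightarrow> complex) \<Rightarrow> complex" where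
  "box_form c K r F b = (\<Sum>\<tau>\<in>gridK r K. LINT x|M. F (Tz (lin c r \<tau>) x) * (\<Prod>i<r. b i \<tau> x)) / of_nat (\<Prod>i<r. K i)"

text \<open>\<open>b r\<close> does not depend on the coordinate \<open>r\<close>, so it leaves the
  sum over that coordinate and Cauchy-Schwarz discards it. Expanding the square of the remaining sum
  doubles the coordinate into \<open>t\<close> and \<open>u\<close>.\<close>

lemma box_form_step:
  assumes F: "F \<in> BM" and b: "\<And>i \<tau>. i < Suc r \<Longrightarrow> b i \<tau> \<in> BM" "\<And>\<tau> x. norm (b r \<tau> x) \<le> 1"
    and indep: "\<And>\<tau> v. b r (\<tau>(r := v)) = b r \<tau>" and K: "\<And>i. K i > 0"
  shows "(norm (box_form c K (Suc r) F b))\<^sup>2 \<le> Re ((\<Sum>t=1..K r. \<Sum>u=1..K r.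
      box_form c K r (\<lambda>x. F (Tz (c r * int t) x) * cnj (F (Tz (c r * int u) x)))
        (\<lambda>i \<tau> x. b i (\<tau>(r := t)) x * cnj (b i (\<tau>(r := u)) x))) / of_nat (K r) ^ 2)"
proof -
  define P where "P = (\<Prod>i<r. K i)"
  have P0: "P > 0" using K by (simp add: P_def prod_pos)
  let ?G = "gridK r K"
  have cG: "card ?G = P" by (simp add: P_def)
  let ?g = "\<lambda>t \<tau> x. F (Tz (lin c r \<tau> + c r * int t) x) * (\<Prod>i<r. b i (\<tau>(r := t)) x)"
  define S where "S \<tau> x = (\<Sum>t=1..K r. ?g t \<tau> x)" for \<tau> x
  let ?N = "\<Sum>\<tau>\<in>?G. LINT x|M. (norm (S \<tau> x))\<^sup>2" and ?Y = "\<Sum>\<tau>\<in>?G. LINT x|M. b r \<tau> x * S \<tau> x"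
  have S: "S \<tau> \<in> BM" for \<tau> unfolding S_def[abs_def] using F b by (intro BM_sum BM_mult BM_Tz BM_prod) auto
  have linu: "lin c (Suc r) (\<tau>(r := t)) = lin c r \<tau> + c r * int t" for \<tau> t
    by (simp add: lin_def)
  have term_BM: "(\<lambda>x. ?g t \<tau> x) \<in> BM" for \<tau> t
    using F b by (intro BM_mult BM_Tz BM_prod) auto
  have "box_form c K (Suc r) F b = ?Y / of_nat (P * K r)"
  proof -
    have "(\<Sum>\<tau>\<in>gridK (Suc r) K. LINT x|M. F (Tz (lin c (Suc r) \<tau>) x) * (\<Prod>i<Suc r. b i \<tau> x))
      = (\<Sum>t=1..K r. \<Sum>\<tau>\<in>?G. LINT x|M. b r \<tau> x * (?g t \<tau> x))"
      unfolding sum_gridK_Suc linu by (simp add: indep ac_simps)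
    also have "\<dots> = (\<Sum>\<tau>\<in>?G. \<Sum>t=1..K r. LINT x|M. b r \<tau> x * (?g t \<tau> x))"
      by (rule sum.swap)
    also have "\<dots> = ?Y"
    proof (rule sum.cong[OF refl])
      fix \<tau>
      show "(\<Sum>t=1..K r. LINT x|M. b r \<tau> x * (?g t \<tau> x)) = (LINT x|M. b r \<tau> x * S \<tau> x)"
        unfolding S_def sum_distrib_left
        by (subst Bochner_Integration.integral_sum) (auto intro!: BM_integrable BM_mult[OF _ term_BM] b)
    qed
    finally show ?thesis by (simp add: box_form_def P_def)
  qed
  then have "(norm (box_form c K (Suc r) F b))\<^sup>2 = (norm ?Y)\<^sup>2 / (real P * real (K r))\<^sup>2"
    by (simp add: norm_divide norm_mult power_divide)
  also have "\<dots> \<le> (real P * ?N) / (real P * real (K r))\<^sup>2"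
  proof (rule divide_right_mono)
    have "(norm ?Y)\<^sup>2 \<le> (\<Sum>\<tau>\<in>?G. norm (LINT x|M. b r \<tau> x * S \<tau> x))\<^sup>2"
      by (intro power_mono norm_sum) simp
    also have "\<dots> \<le> (\<Sum>\<tau>\<in>?G. (norm (LINT x|M. b r \<tau> x * S \<tau> x))\<^sup>2) * card ?G"
      by (rule sum_squared_le_sum_of_squares)
    also have "\<dots> \<le> ?N * card ?G"
      using S b by (intro mult_right_mono sum_mono integral_cauchy_schwarz) (auto intro: prod_nonneg)
    finally show "(norm ?Y)\<^sup>2 \<le> real P * ?N"
      unfolding cG by (simp only: mult.commute)
  qed simp
  also have "\<dots> = ?N / real P / (real (K r))\<^sup>2"
    using P0 by (simp add: power2_eq_square field_simps)
  also have "\<dots> = Re ((\<Sum>t=1..K r. \<Sum>u=1..K r.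
      box_form c K r (\<lambda>x. F (Tz (c r * int t) x) * cnj (F (Tz (c r * int u) x)))
        (\<lambda>i \<tau> x. b i (\<tau>(r := t)) x * cnj (b i (\<tau>(r := u)) x))) / of_nat (K r) ^ 2)"
  proof -
    let ?f = "\<lambda>t u \<tau> x. (?g t \<tau> x) *
        cnj (F (Tz (lin c r \<tau> + c r * int u) x) * (\<Prod>i<r. b i (\<tau>(r := u)) x))"
    have "of_real (LINT x|M. (norm (S \<tau> x))\<^sup>2) = (\<Sum>t=1..K r. \<Sum>u=1..K r. LINT x|M. ?f t u \<tau> x)" for \<tau>
    proof -
      have "of_real (LINT x|M. (norm (S \<tau> x))\<^sup>2) = (LINT x|M. S \<tau> x * cnj (S \<tau> x))"
        unfolding integral_complex_of_real[symmetric] complex_norm_square ..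
      also have "\<dots> = (LINT x|M. (\<Sum>t=1..K r. \<Sum>u=1..K r. ?f t u \<tau> x))"
        unfolding S_def cnj_sum sum_product ..
      also have "\<dots> = (\<Sum>t=1..K r. \<Sum>u=1..K r. LINT x|M. ?f t u \<tau> x)"
        by (subst Bochner_Integration.integral_sum, intro BM_integrable BM_sum BM_mult[OF term_BM BM_cnj[OF term_BM]])
           (intro sum.cong refl, subst Bochner_Integration.integral_sum, intro BM_integrable BM_mult[OF term_BM BM_cnj[OF term_BM]], rule refl)
      finally show ?thesis .
    qed
    then have "of_real ?N = (\<Sum>\<tau>\<in>?G. \<Sum>t=1..K r. \<Sum>u=1..K r. LINT x|M. ?f t u \<tau> x)"
      by (simp only: of_real_sum)
    also have "\<dots> = (\<Sum>t=1..K r. \<Sum>u=1..K r. \<Sum>\<tau>\<in>?G. LINT x|M. ?f t u \<tau> x)"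
      by (subst sum.swap, rule sum.cong[OF refl], rule sum.swap)
    finally have 1: "of_real ?N = (\<Sum>t=1..K r. \<Sum>u=1..K r. \<Sum>\<tau>\<in>?G. LINT x|M. ?f t u \<tau> x)" .
    have 2: "box_form c K r (\<lambda>x. F (Tz (c r * int t) x) * cnj (F (Tz (c r * int u) x)))
        (\<lambda>i \<tau> x. b i (\<tau>(r := t)) x * cnj (b i (\<tau>(r := u)) x)) = (\<Sum>\<tau>\<in>?G. LINT x|M. ?f t u \<tau> x) / of_nat P" for t u
    proof -
      have "F (Tz (c r * int t) (Tz (lin c r \<tau>) x)) = F (Tz (lin c r \<tau> + c r * int t) x)" for t \<tau> x
        by (simp add: Tz_add[symmetric] add.commute)
      then show ?thesis by (simp add: box_form_def P_def prod.distrib ac_simps)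
    qed
    have "complex_of_real (?N / real P / (real (K r))\<^sup>2)
      = (\<Sum>t=1..K r. \<Sum>u=1..K r. (\<Sum>\<tau>\<in>?G. LINT x|M. ?f t u \<tau> x) / of_nat P) / of_nat (K r) ^ 2"
      by (simp only: of_real_divide of_real_power of_real_of_nat_eq 1) (simp only: sum_divide_distrib)
    then show ?thesis unfolding 2 by (metis Re_complex_of_real)
  qed
  finally show ?thesis .
qed

text \<open>There is at least one coordinate: with none, the right side would be the real part of an
  integral, which may be negative. In the induction each \<open>b i\<close> becomes a product of two
  copies at different values of the last coordinate and still ignores the coordinate
  \<open>i\<close>.\<close>

lemma box_cauchy_schwarz:
  assumes F: "F \<in> BM" and b: "\<And>i \<tau>. i < Suc r \<Longrightarrow> b i \<tau> \<in> BM" "\<And>i \<tau> x. i < Suc r \<Longrightarrow> norm (b i \<tau> x) \<le> 1"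
    and indep: "\<And>i \<tau> v. i < Suc r \<Longrightarrow> b i (\<tau>(i := v)) = b i \<tau>" and K: "\<And>i. K i > 0"
  shows "norm (box_form c K (Suc r) F b) ^ (2 ^ Suc r) \<le> Re (box_pow c K (Suc r) F)"
  using F b indep
proof (induction r arbitrary: F b)
  case 0
  have "(norm (box_form c K (Suc 0) F b))\<^sup>2 \<le> Re ((\<Sum>t=1..K 0. \<Sum>u=1..K 0.
      box_form c K 0 (\<lambda>x. F (Tz (c 0 * int t) x) * cnj (F (Tz (c 0 * int u) x)))
        (\<lambda>i \<tau> x. b i (\<tau>(0 := t)) x * cnj (b i (\<tau>(0 := u)) x))) / of_nat (K 0) ^ 2)"
  proof (rule box_form_step[OF 0(1) _ _ _ K])
    show "b 0 (\<tau>(0 := v)) = b 0 \<tau>" for \<tau> v by (rule 0(4)) simp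
  qed (use 0(2,3) in simp_all)
  then show ?case by (simp add: box_form_def lin_def)
next
  case (Suc r)
  let ?G = "\<lambda>t u x. F (Tz (c (Suc r) * int t) x) * cnj (F (Tz (c (Suc r) * int u) x))"
  let ?b = "\<lambda>t u i \<tau> x. b i (\<tau>(Suc r := t)) x * cnj (b i (\<tau>(Suc r := u)) x)"
  let ?k = "K (Suc r)"
  let ?I = "{1..?k} \<times> {1..?k}"
  let ?z = "\<lambda>p. norm (box_form c K (Suc r) (?G (fst p) (snd p)) (?b (fst p) (snd p)))"
  have step: "(norm (box_form c K (Suc (Suc r)) F b))\<^sup>2 \<le> Re ((\<Sum>t=1..?k. \<Sum>u=1..?k. box_form c K (Suc r) (?G t u) (?b t u)) / of_nat ?k ^ 2)"
  proof (rule box_form_step[OF Suc.prems(1) _ _ _ K])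
    show "b (Suc r) (\<tau>(Suc r := v)) = b (Suc r) \<tau>" for \<tau> v by (rule Suc.prems(4)) simp
  qed (use Suc.prems(2,3) in simp_all)
  have cI: "real (card ?I) = real ?k ^ 2" by (simp add: power2_eq_square)
  have "Re ((\<Sum>t=1..?k. \<Sum>u=1..?k. box_form c K (Suc r) (?G t u) (?b t u)) / of_nat ?k ^ 2)
     \<le> norm ((\<Sum>t=1..?k. \<Sum>u=1..?k. box_form c K (Suc r) (?G t u) (?b t u)) / of_nat ?k ^ 2)"
    by (rule complex_Re_le_cmod)
  also have "\<dots> = norm (\<Sum>p\<in>?I. box_form c K (Suc r) (?G (fst p) (snd p)) (?b (fst p) (snd p))) / card ?I"
    unfolding cI sum.cartesian_product by (simp add: norm_divide norm_power case_prod_unfold)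
  also have "\<dots> \<le> (\<Sum>p\<in>?I. ?z p) / card ?I"
    by (intro divide_right_mono norm_sum) simp
  finally have le: "(norm (box_form c K (Suc (Suc r)) F b))\<^sup>2 \<le> (\<Sum>p\<in>?I. ?z p) / card ?I" using step by simp
  have "norm (box_form c K (Suc (Suc r)) F b) ^ (2 ^ Suc (Suc r)) = ((norm (box_form c K (Suc (Suc r)) F b))\<^sup>2) ^ (2 ^ Suc r)"
    by (simp add: power_mult[symmetric])
  also have "\<dots> \<le> ((\<Sum>p\<in>?I. ?z p) / card ?I) ^ (2 ^ Suc r)"
    by (intro power_mono le) simp
  also have "\<dots> \<le> (\<Sum>p\<in>?I. ?z p ^ (2 ^ Suc r)) / card ?I"
    by (rule mean_pow2) auto
  also have "\<dots> \<le> (\<Sum>p\<in>?I. Re (box_pow c K (Suc r) (?G (fst p) (snd p)))) / card ?I"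
  proof (intro divide_right_mono sum_mono)
    fix p
    show "?z p ^ (2 ^ Suc r) \<le> Re (box_pow c K (Suc r) (?G (fst p) (snd p)))"
    proof (rule Suc.IH)
      show "?G (fst p) (snd p) \<in> BM" by (intro BM_intros Suc.prems)
      fix i \<tau> assume i: "i < Suc r"
      then show "?b (fst p) (snd p) i \<tau> \<in> BM" by (intro BM_mult BM_cnj Suc.prems) auto
      show "norm (?b (fst p) (snd p) i \<tau> x) \<le> 1" for x
        using Suc.prems(3)[of i] i mult_le_one[of "norm (b i (\<tau>(Suc r := fst p)) x)" "norm (b i (\<tau>(Suc r := snd p)) x)"]
        by (simp add: norm_mult)
      have sw: "(\<tau>(i := v))(Suc r := t) = (\<tau>(Suc r := t))(i := v)" for v t using i by auto
      show "?b (fst p) (snd p) i (\<tau>(i := v)) = ?b (fst p) (snd p) i \<tau>" for v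
        unfolding sw Suc.prems(4)[OF less_SucI[OF i]] ..
    qed
  qed simp
  also have "\<dots> = Re (box_pow c K (Suc (Suc r)) F)"
  proof -
    have "box_pow c K (Suc (Suc r)) F = (\<Sum>p\<in>?I. box_pow c K (Suc r) (?G (fst p) (snd p))) / of_real (card ?I)"
      unfolding cI by (simp only: box_pow.simps(2)[of c K "Suc r"] sum.cartesian_product case_prod_unfold of_real_power of_real_of_nat_eq)
    then show ?thesis by (simp only: Re_divide_of_real Re_sum)
  qed
  finally show ?case .
qed

text \<open>The shape that \<open>box_cauchy_schwarz\<close> needs, closed under products.
  \<open>1 \<le> B\<close> allows empty slots to be filled with the constant 1.\<close>

definition splits :: "nat \<Rightarrow> real \<Rightarrow> ((nat \<Rightarrow> nat) \<Rightarrow> 'a \<Rightarrow> complex) \<Rightarrow> bool" where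
  "splits r B q \<longleftrightarrow> 1 \<le> B \<and> (\<exists>b. (\<forall>i<r. \<forall>\<tau>. b i \<tau> \<in> BM \<and> (\<forall>x. norm (b i \<tau> x) \<le> B) \<and> (\<forall>v. b i (\<tau>(i := v)) = b i \<tau>)) \<and>
     (\<forall>\<tau> x. q \<tau> x = (\<Prod>i<r. b i \<tau> x)))"

lemma splits_one: "splits r 1 (\<lambda>_ _. 1)"
  unfolding splits_def by (auto intro!: exI[of _ "\<lambda>_ _ _. 1"] BM_const)

lemma splits_single:
  assumes "i < r" "1 \<le> B" "\<And>\<tau>. q \<tau> \<in> BM" "\<And>\<tau> x. norm (q \<tau> x) \<le> B" "\<And>\<tau> v. q (\<tau>(i := v)) = q \<tau>"
  shows "splits r B q"
  unfolding splits_def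
proof (intro conjI exI[of _ "\<lambda>j \<tau> x. if j = i then q \<tau> x else 1"] allI impI)
  show "q \<tau> x = (\<Prod>j<r. if j = i then q \<tau> x else 1)" for \<tau> x
    using assms(1) by (simp add: prod.delta)
  show "(\<lambda>x. if j = i then q \<tau> x else 1) \<in> BM" for j \<tau>
    using assms(3)[of \<tau>] BM_const by (cases "j = i") auto
qed (use assms in auto)

lemma splits_mult:
  assumes "splits r B q" "splits r B' q'"
  shows "splits r (B * B') (\<lambda>\<tau> x. q \<tau> x * q' \<tau> x)"
proof -
  obtain b where b: "1 \<le> B" "\<And>i \<tau>. i < r \<Longrightarrow> b i \<tau> \<in> BM" "\<And>i \<tau> x. i < r \<Longrightarrow> norm (b i \<tau> x) \<le> B"
    "\<And>i \<tau> v. i < r \<Longrightarrow> b i (\<tau>(i := v)) = b i \<tau>" "\<And>\<tau> x. q \<tau> x = (\<Prod>i<r. b i \<tau> x)"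
    using assms(1) unfolding splits_def by blast
  obtain b' where b': "1 \<le> B'" "\<And>i \<tau>. i < r \<Longrightarrow> b' i \<tau> \<in> BM" "\<And>i \<tau> x. i < r \<Longrightarrow> norm (b' i \<tau> x) \<le> B'"
    "\<And>i \<tau> v. i < r \<Longrightarrow> b' i (\<tau>(i := v)) = b' i \<tau>" "\<And>\<tau> x. q' \<tau> x = (\<Prod>i<r. b' i \<tau> x)"
    using assms(2) unfolding splits_def by blast
  have "1 \<le> B * B'" using mult_mono[OF b(1) b'(1)] b(1) by simp
  moreover have "norm (b i \<tau> x * b' i \<tau> x) \<le> B * B'" if "i < r" for i \<tau> x
    using mult_mono[OF b(3)[OF that] b'(3)[OF that]] b(1) by (simp add: norm_mult)
  ultimately show ?thesis unfolding splits_def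
    using b b' by (intro conjI exI[of _ "\<lambda>i \<tau> x. b i \<tau> x * b' i \<tau> x"]) (auto simp: prod.distrib intro: BM_mult)
qed

lemma splits_prod:
  assumes "finite I" "\<And>j. j \<in> I \<Longrightarrow> splits r B (q j)"
  shows "splits r (B ^ card I) (\<lambda>\<tau> x. \<Prod>j\<in>I. q j \<tau> x)"
  using assms
proof (induction I rule: finite_induct)
  case empty
  then show ?case by (simp add: splits_one)
next
  case (insert j I)
  then show ?case using splits_mult[of r B "q j" "B ^ card I" "\<lambda>\<tau> x. \<Prod>j\<in>I. q j \<tau> x"] by simp
qed

lemma splits_box_bound:
  assumes F: "F \<in> BM" and q: "splits r B q" and K: "\<And>i. K i > 0"
  shows "norm ((\<Sum>\<tau>\<in>gridK r K. LINT x|M. F (Tz (lin c r \<tau>) x) * q \<tau> x) / of_nat (\<Prod>i<r. K i)) ^ (2 ^ r)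
     \<le> (B ^ r) ^ (2 ^ r) * norm (box_pow c K r F)"
proof (cases r)
  case 0
  then show ?thesis using q by (auto simp: splits_def lin_def)
next
  case (Suc r')
  obtain b where b: "1 \<le> B" "\<And>i \<tau>. i < r \<Longrightarrow> b i \<tau> \<in> BM" "\<And>i \<tau> x. i < r \<Longrightarrow> norm (b i \<tau> x) \<le> B"
    "\<And>i \<tau> v. i < r \<Longrightarrow> b i (\<tau>(i := v)) = b i \<tau>" "\<And>\<tau> x. q \<tau> x = (\<Prod>i<r. b i \<tau> x)"
    using q unfolding splits_def by blast
  \<comment> \<open>Cauchy-Schwarz needs factors bounded by 1; normalising the \<open>r\<close>
    factors costs \<open>B ^ r\<close>.\<close>
  define b' where "b' i \<tau> x = b i \<tau> x / of_real B" for i \<tau> x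
  have B0: "B > 0" using b(1) by simp
  have q': "q \<tau> x = of_real (B ^ r) * (\<Prod>i<r. b' i \<tau> x)" for \<tau> x
    using B0 by (simp add: b(5) b'_def prod_dividef)
  have e: "(\<Sum>\<tau>\<in>gridK r K. LINT x|M. F (Tz (lin c r \<tau>) x) * q \<tau> x) / of_nat (\<Prod>i<r. K i) = of_real (B ^ r) * box_form c K r F b'"
    unfolding box_form_def q' mult.left_commute[of _ "of_real (B ^ r)"] by (simp add: sum_distrib_left)
  have "norm (box_form c K (Suc r') F b') ^ (2 ^ Suc r') \<le> Re (box_pow c K (Suc r') F)"
  proof (rule box_cauchy_schwarz[OF F _ _ _ K])
    fix i \<tau> assume i: "i < Suc r'"
    show "b' i \<tau> \<in> BM" unfolding b'_def[abs_def] using i Suc by (intro BM_divide b(2)) simp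
    show "norm (b' i \<tau> x) \<le> 1" for x using b(3)[of i \<tau> x] i Suc B0 by (simp add: b'_def norm_divide)
    show "b' i (\<tau>(i := v)) = b' i \<tau>" for v using b(4)[of i \<tau> v] i Suc by (simp add: b'_def fun_eq_iff)
  qed
  then have le: "norm (box_form c K r F b') ^ (2 ^ r) \<le> norm (box_pow c K r F)"
    using complex_Re_le_cmod[of "box_pow c K r F"] unfolding Suc by linarith
  have "norm (of_real (B ^ r) * box_form c K r F b') ^ (2 ^ r) = (B ^ r) ^ (2 ^ r) * norm (box_form c K r F b') ^ (2 ^ r)"
    using B0 by (simp add: norm_mult power_mult_distrib norm_power)
  also have "\<dots> \<le> (B ^ r) ^ (2 ^ r) * norm (box_pow c K r F)"
    using le B0 by (intro mult_left_mono) auto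
  finally show ?thesis unfolding e .
qed

end

section \<open>Shifting the averages\<close>

lemma prod_PiE_Suc:
  "(\<Prod>\<tau>\<in>PiE {..<Suc r} B. a \<tau>) = (\<Prod>t\<in>B r. \<Prod>\<tau>\<in>PiE {..<r} B. a (\<tau>(r := t)))"
proof -
  have "PiE {..<Suc r} B = (\<lambda>(t, \<tau>). \<tau>(r := t)) ` (B r \<times> PiE {..<r} B)"
    using PiE_insert_eq[of r "{..<r}" B] by (simp add: lessThan_Suc)
  then have "(\<Prod>\<tau>\<in>PiE {..<Suc r} B. a \<tau>) = (\<Prod>(t, \<tau>)\<in>B r \<times> PiE {..<r} B. a (\<tau>(r := t)))"
    using inj_combinator[of r "{..<r}" B] by (simp add: prod.reindex case_prod_unfold)
  then show ?thesis by (simp add: prod.cartesian_product)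
qed

section \<open>Iterated derivatives as products over the cube\<close>

lemma mderivs_0: "mderivs T 0 h f = f"
  by (simp add: mderivs_def)

lemma mderivs_Suc: "mderivs T (Suc s) h f = mderivs T s h (mderiv T (h s) f)"
  by (simp add: mderivs_def)

lemma mderivs_cong: "(\<And>j. j < s \<Longrightarrow> h j = h' j) \<Longrightarrow> mderivs T s h f = mderivs T s h' f"
  by (induction s arbitrary: f) (auto simp: mderivs_0 mderivs_Suc)

lemma mderivs_cube:
  "mderivs T s h f x = (\<Prod>\<alpha>\<in>cube s. (cnj ^^ weight s \<alpha>) (f ((T ^^ (\<Sum>j<s. \<alpha> j * h j)) x)))"
proof (induction s arbitrary: f)
  case 0
  then show ?case by (simp add: mderivs_0 cube_def weight_def)
next
  case (Suc s)
  have "mderivs T (Suc s) h f x = (\<Prod>\<alpha>\<in>cube s. (cnj ^^ weight s \<alpha>) (mderiv T (h s) f ((T ^^ (\<Sum>j<s. \<alpha> j * h j)) x)))"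
    unfolding mderivs_Suc Suc.IH ..
  also have "\<dots> = (\<Prod>\<alpha>\<in>cube s. \<Prod>t\<in>{0,1}. (cnj ^^ weight (Suc s) (\<alpha>(s := t))) (f ((T ^^ (\<Sum>j<Suc s. (\<alpha>(s := t)) j * h j)) x)))"
  proof (rule prod.cong[OF refl])
    fix \<alpha>
    have w: "weight (Suc s) (\<alpha>(s := t)) = weight s \<alpha> + t" for t by (simp add: weight_def)
    have e: "(\<Sum>j<Suc s. (\<alpha>(s := t)) j * h j) = (\<Sum>j<s. \<alpha> j * h j) + t * h s" for t by simp
    have c: "(cnj ^^ (k + Suc 0)) z = (cnj ^^ k) (cnj z)" for k z
      by (simp only: add_Suc_right add_0_right funpow_Suc_right o_apply)
    have cj: "(cnj ^^ k) (cnj z) = cnj ((cnj ^^ k) z)" for k z by (induction k) auto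
    have p: "(T ^^ (a + b)) x = (T ^^ b) ((T ^^ a) x)" for a b by (simp add: funpow_add add.commute[of a])
    show "(cnj ^^ weight s \<alpha>) (mderiv T (h s) f ((T ^^ (\<Sum>j<s. \<alpha> j * h j)) x))
      = (\<Prod>t\<in>{0,1}. (cnj ^^ weight (Suc s) (\<alpha>(s := t))) (f ((T ^^ (\<Sum>j<Suc s. (\<alpha>(s := t)) j * h j)) x)))"
      unfolding w e by (simp add: mderiv_def shift_def cjn_mult c cj p)
  qed
  also have "\<dots> = (\<Prod>t\<in>{0,1}. \<Prod>\<alpha>\<in>cube s. (cnj ^^ weight (Suc s) (\<alpha>(s := t))) (f ((T ^^ (\<Sum>j<Suc s. (\<alpha>(s := t)) j * h j)) x)))"
    by (rule prod.swap)
  also have "\<dots> = (\<Prod>\<alpha>\<in>cube (Suc s). (cnj ^^ weight (Suc s) \<alpha>) (f ((T ^^ (\<Sum>j<Suc s. \<alpha> j * h j)) x)))"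
    unfolding cube_def prod_PiE_Suc ..
  finally show ?case .
qed

definition czero :: "nat \<Rightarrow> nat \<Rightarrow> nat" where "czero r = (\<lambda>j\<in>{..<r}. 0)"
definition cone :: "nat \<Rightarrow> nat \<Rightarrow> nat" where "cone r = (\<lambda>j\<in>{..<r}. 1)"

lemma czero_cube [simp]: "czero r \<in> cube r" and cone_cube [simp]: "cone r \<in> cube r"
  by (auto simp: czero_def cone_def cube_def)

lemma cube_ext:
  assumes "\<theta> \<in> cube r" "\<theta>' \<in> cube r" "\<And>i. i < r \<Longrightarrow> \<theta> i = \<theta>' i" shows "\<theta> = \<theta>'"
  using assms unfolding cube_def by (intro PiE_ext) auto

lemma cube_val: "\<theta> \<in> cube r \<Longrightarrow> i < r \<Longrightarrow> \<theta> i = 0 \<or> \<theta> i = 1"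
  by (auto simp: cube_def PiE_iff)

lemma cube_not_zero:
  assumes "\<theta> \<in> cube r" "\<theta> \<noteq> czero r" shows "\<exists>i<r. \<theta> i = 1"
proof (rule ccontr)
  assume "\<not> ?thesis"
  then have "\<theta> = czero r" using cube_val[OF assms(1)]
    by (intro cube_ext[OF assms(1) czero_cube]) (auto simp: czero_def)
  with assms show False by simp
qed

lemma cube_not_one:
  assumes "\<theta> \<in> cube r" "\<theta> \<noteq> cone r" shows "\<exists>i<r. \<theta> i = 0"
proof (rule ccontr)
  assume "\<not> ?thesis"
  then have "\<theta> i = cone r i" if "i < r" for i
    using cube_val[OF assms(1) that] that by (auto simp: cone_def)
  then have "\<theta> = cone r" by (rule cube_ext[OF assms(1) cone_cube])
  with assms show False by simp
qed

lemma weight_zero [simp]: "weight r (czero r) = 0" and weight_one [simp]: "weight r (cone r) = r"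
  by (simp_all add: weight_def czero_def cone_def)

text \<open>A shifted grid point is no longer extensional, so \<open>a\<close> has to depend on the
  first \<open>r\<close> coordinates only. As before, the error is fixed before \<open>N\<close>,
  \<open>C\<close> and \<open>a\<close>.\<close>

lemma grid_shift:
  fixes v :: "nat \<Rightarrow> nat"
  shows "\<exists>dd. dd \<longlonglongrightarrow> 0 \<and> (\<forall>N C (a :: (nat \<Rightarrow> nat) \<Rightarrow> complex).
     (\<forall>m. norm (a m) \<le> C) \<longrightarrow> (\<forall>m m'. (\<forall>i<r. m i = m' i) \<longrightarrow> a m = a m') \<longrightarrow>
     norm (((\<Sum>m\<in>grid r N. a (\<lambda>i. m i + v i)) - (\<Sum>m\<in>grid r N. a m)) / of_nat N ^ r) \<le> C * dd N)"
proof -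
  define w where "w i = (if i < r then int (v i) else 0)" for i
  have "w i = 0" if "i \<ge> r" for i using that by (simp add: w_def)
  from box_shift_uniform[of r w, OF this] obtain dd where dd: "dd \<longlonglongrightarrow> 0" "\<And>N C (a :: (nat \<Rightarrow> int) \<Rightarrow> complex).
      (\<And>n. norm (a n) \<le> C) \<Longrightarrow> norm (((\<Sum>n\<in>box r N. a (n + w)) - (\<Sum>n\<in>box r N. a n)) / of_nat N ^ r) \<le> C * dd N"
    by blast
  have "norm (((\<Sum>m\<in>grid r N. a (\<lambda>i. m i + v i)) - (\<Sum>m\<in>grid r N. a m)) / of_nat N ^ r) \<le> C * dd N"
    if bd: "\<forall>m. norm (a m) \<le> C" and dep: "\<forall>m m'. (\<forall>i<r. m i = m' i) \<longrightarrow> a m = a m'"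
    for N C and a :: "(nat \<Rightarrow> nat) \<Rightarrow> complex"
  proof -
    define a' where "a' n = a (\<lambda>i. nat (n i))" for n :: "nat \<Rightarrow> int"
    have "(\<Sum>n\<in>box r N. a' n) = (\<Sum>m\<in>grid r N. a m)"
      unfolding sum_grid_box[symmetric] a'_def using dep by (intro sum.cong refl) simp
    moreover have "(\<Sum>n\<in>box r N. a' (n + w)) = (\<Sum>m\<in>grid r N. a (\<lambda>i. m i + v i))"
      unfolding sum_grid_box[symmetric] a'_def using dep by (intro sum.cong refl) (simp add: w_def nat_add_distrib)
    ultimately show ?thesis using dd(2)[of a' C N] bd by (simp add: a'_def)
  qed
  with dd(1) show ?thesis by blast
qed

lemma sum_gridK_add:
  "(\<Sum>\<rho>\<in>gridK (d + s) K. a \<rho>) = (\<Sum>\<sigma>\<in>gridK s (\<lambda>j. K (d + j)). \<Sum>\<tau>\<in>gridK d K.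
     a (\<lambda>i. if i < d then \<tau> i else if i < d + s then \<sigma> (i - d) else undefined))"
proof -
  have "bij_betw (\<lambda>(\<sigma>, \<tau>) i. if i < d then \<tau> i else if i < d + s then \<sigma> (i - d) else undefined)
     (gridK s (\<lambda>j. K (d + j)) \<times> gridK d K) (gridK (d + s) K)"
  proof (rule bij_betwI[where g = "\<lambda>\<rho>. (\<lambda>j\<in>{..<s}. \<rho> (d + j), \<lambda>i\<in>{..<d}. \<rho> i)"])
    show "(\<lambda>(\<sigma>, \<tau>) i. if i < d then \<tau> i else if i < d + s then \<sigma> (i - d) else undefined)
        \<in> gridK s (\<lambda>j. K (d + j)) \<times> gridK d K \<rightarrow> gridK (d + s) K"
    proof (intro funcsetI, clarify)
      fix \<sigma> \<tau> assume \<sigma>: "\<sigma> \<in> gridK s (\<lambda>j. K (d + j))" and \<tau>: "\<tau> \<in> gridK d K"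
      have "\<sigma> (i - d) \<in> {1..K i}" if "\<not> i < d" "i < d + s" for i
        using PiE_mem[OF \<sigma>[unfolded gridK_def], of "i - d"] that by simp
      then show "(\<lambda>i. if i < d then \<tau> i else if i < d + s then \<sigma> (i - d) else undefined) \<in> gridK (d + s) K"
        using \<tau> by (auto simp: gridK_def PiE_iff extensional_def)
    qed
  qed (auto simp: gridK_def PiE_iff extensional_def fun_eq_iff)
  from sum.reindex_bij_betw[OF this, of a] show ?thesis
    by (simp add: sum.cartesian_product case_prod_unfold)
qed

context mps begin

lemma BM_mderivs: "f \<in> BM \<Longrightarrow> mderivs T s h f \<in> BM"
  by (induction s arbitrary: f) (auto simp: mderivs_0 mderivs_Suc BM_mderiv)

lemma mderivs_bound:
  assumes "\<And>x. norm (f x) \<le> C"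
  shows "norm (mderivs T s h f x) \<le> C ^ (2 ^ s)"
  unfolding mderivs_cube using osys.prod_bound[OF base_osys, of "cube s" _ C] assms by simp

lemma cesaro_shift:
  fixes a :: "nat \<Rightarrow> complex"
  assumes a: "(\<lambda>H. (\<Sum>h=1..H. a h) / of_nat H) \<longlonglongrightarrow> l" and bd: "\<And>h. norm (a h) \<le> C"
  shows "(\<lambda>H. (\<Sum>h=1..H. a (h + t)) / of_nat H) \<longlonglongrightarrow> l"
proof -
  obtain d where d: "d \<longlonglongrightarrow> 0" "\<And>N C (z :: (nat \<Rightarrow> int) \<Rightarrow> complex). (\<And>n. norm (z n) \<le> C) \<Longrightarrow>
     norm (((\<Sum>n\<in>box 1 N. z (n + unit (int t))) - (\<Sum>n\<in>box 1 N. z n)) / of_nat N ^ 1) \<le> C * d N"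
  proof -
    have "unit (int t) i = 0" if "i \<ge> 1" for i using that by (simp add: unit_def)
    from box_shift_uniform[of 1 "unit (int t)", OF this] that show ?thesis by blast
  qed
  have le: "norm ((\<Sum>h=1..N. a (h + t)) / of_nat N - (\<Sum>h=1..N. a h) / of_nat N) \<le> C * d N" for N
  proof -
    have "nat (unit (int h) 0 + unit (int t) 0) = h + t" for h by (simp add: unit_def)
    then show ?thesis
      using d(2)[of "\<lambda>n. a (nat (n 0))" C N] bd unfolding sum_box1
      by (simp add: diff_divide_distrib unit_def)
  qed
  have "(\<lambda>N. C * d N) \<longlonglongrightarrow> 0" by (intro tendsto_mult_right_zero d(1))
  then have "(\<lambda>N. (\<Sum>h=1..N. a (h + t)) / of_nat N - (\<Sum>h=1..N. a h) / of_nat N) \<longlonglongrightarrow> 0"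
    by (rule Lim_null_comparison[rotated]) (intro always_eventually allI le)
  from tendsto_add[OF this a] show ?thesis by simp
qed

text \<open>The limits in \<open>gp d\<close> are unchanged when their variables are shifted by
  window coordinates, so summing over the window multiplies the left side by the number of its
  points, and a bound uniform in \<open>n\<close> passes to the limit. The sum over \<open>P\<close>
  is carried along because the norm is taken after summing.\<close>

lemma ghk_window:
  fixes F :: "nat \<Rightarrow> 'a \<Rightarrow> complex"
  assumes "finite P" "\<And>p. p \<in> P \<Longrightarrow> F p \<in> BM"
    and "\<And>n. norm (\<Sum>p\<in>P. \<Sum>\<tau>\<in>gridK d K. LINT x|M. mderivs T d (\<lambda>i. n i + \<tau> i) (F p) x) \<le> B"
  shows "norm (\<Sum>p\<in>P. gp d (F p)) * (\<Prod>i<d. real (K i)) \<le> B"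
  using assms
proof (induction d arbitrary: P F)
  case 0
  then show ?case by (simp add: mderivs_0)
next
  case (Suc d)
  let ?a = "\<lambda>p h. gp d (mderiv T h (F p))" and ?k = "\<Prod>i<d. real (K i)"
  let ?S = "\<lambda>H. \<Sum>h=1..H. \<Sum>p\<in>P. \<Sum>t=1..K d. ?a p (h + t)"
  have lim: "(\<lambda>H. (\<Sum>h=1..H. ?a p (h + t)) / of_nat H) \<longlonglongrightarrow> gp (Suc d) (F p)" if p: "p \<in> P" for p t
  proof -
    obtain C where C: "\<And>x. norm (F p x) \<le> C" using BM_bdd[OF Suc.prems(2)[OF p]] by blast
    have "norm (mderiv T h (F p) x) \<le> C * C" for h x
      unfolding mderiv_def shift_def norm_mult complex_mod_cnj
      using C norm_ge_zero order_trans by (intro mult_mono) blast+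
    then have "norm (?a p h) \<le> (C * C) ^ (2 ^ d)" for h
      by (intro ghk_norm_bound BM_mderiv Suc.prems(2) p)
    then show ?thesis by (intro cesaro_shift[OF ghk_cesaro(1)] Suc.prems(2) p)
  qed
  have each: "norm (\<Sum>p\<in>P. \<Sum>t=1..K d. ?a p (h + t)) * ?k \<le> B" for h
  proof -
    \<comment> \<open>The new index is a pair of \<open>p\<close> and the shift \<open>t\<close>;
      encoding it as a number keeps the index type fixed in the induction.\<close>
    define P' where "P' = prod_encode ` (P \<times> {1..K d})"
    define F' where "F' k = mderiv T (h + snd (prod_decode k)) (F (fst (prod_decode k)))" for k
    have sumP': "(\<Sum>k\<in>P'. g k) = (\<Sum>p\<in>P. \<Sum>t=1..K d. g (prod_encode (p, t)))" for g :: "nat \<Rightarrow> complex"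
      unfolding P'_def by (subst sum.reindex) (auto simp: inj_prod_encode sum.cartesian_product case_prod_unfold)
    have "norm (\<Sum>k\<in>P'. gp d (F' k)) * ?k \<le> B"
    proof (rule Suc.IH)
      show "finite P'" using Suc.prems(1) by (simp add: P'_def)
      show "F' k \<in> BM" if "k \<in> P'" for k
        using that Suc.prems(2) by (auto simp: P'_def F'_def intro!: BM_mderiv)
      fix n :: "nat \<Rightarrow> nat"
      define n' where "n' = n(d := h)"
      have "mderivs T (Suc d) (\<lambda>i. n' i + (\<tau>(d := t)) i) G = mderivs T d (\<lambda>i. n i + \<tau> i) (mderiv T (h + t) G)" for \<tau> t G
      proof -
        have e: "n' d + (\<tau>(d := t)) d = h + t" by (simp add: n'_def)
        show ?thesis unfolding mderivs_Suc e by (rule mderivs_cong) (simp add: n'_def)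
      qed
      then have "(\<Sum>\<tau>\<in>gridK (Suc d) K. LINT x|M. mderivs T (Suc d) (\<lambda>i. n' i + \<tau> i) (F p) x)
         = (\<Sum>t=1..K d. \<Sum>\<tau>\<in>gridK d K. LINT x|M. mderivs T d (\<lambda>i. n i + \<tau> i) (mderiv T (h + t) (F p)) x)" for p
        unfolding sum_gridK_Suc by simp
      then show "norm (\<Sum>k\<in>P'. \<Sum>\<tau>\<in>gridK d K. LINT x|M. mderivs T d (\<lambda>i. n i + \<tau> i) (F' k) x) \<le> B"
        using Suc.prems(3)[of n'] unfolding sumP' by (simp add: F'_def)
    qed
    then show ?thesis unfolding sumP' by (simp add: F'_def)
  qed
  have "(\<lambda>H. ?S H / of_nat H) \<longlonglongrightarrow> (\<Sum>p\<in>P. \<Sum>t=1..K d. gp (Suc d) (F p))"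
  proof -
    have "?S H / of_nat H = (\<Sum>p\<in>P. \<Sum>t=1..K d. (\<Sum>h=1..H. ?a p (h + t)) / of_nat H)" for H
    proof -
      have "?S H = (\<Sum>p\<in>P. \<Sum>t=1..K d. \<Sum>h=1..H. ?a p (h + t))"
        by (subst sum.swap, rule sum.cong[OF refl], rule sum.swap)
      then show ?thesis by (simp add: sum_divide_distrib)
    qed
    then show ?thesis using lim by (simp only:) (intro tendsto_sum)
  qed
  then have "(\<lambda>H. norm (?S H / of_nat H) * ?k)
     \<longlonglongrightarrow> norm (\<Sum>p\<in>P. \<Sum>t=1..K d. gp (Suc d) (F p)) * ?k"
    by (intro tendsto_intros)
  moreover have "norm (?S H / of_nat H) * ?k \<le> B" if "H > 0" for H
  proof -
    have "norm (?S H) * ?k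
        \<le> (\<Sum>h=1..H. norm (\<Sum>p\<in>P. \<Sum>t=1..K d. ?a p (h + t))) * ?k"
      by (intro mult_right_mono norm_sum prod_nonneg) auto
    also have "\<dots> \<le> (\<Sum>h=1..H. B)" unfolding sum_distrib_right by (intro sum_mono each)
    finally show ?thesis using that by (simp add: norm_divide divide_le_eq mult.commute)
  qed
  then have "eventually (\<lambda>H. norm (?S H / of_nat H) * ?k \<le> B) sequentially"
    by (rule eventually_mono[OF eventually_gt_at_top[of 0]])
  ultimately have "norm (\<Sum>p\<in>P. \<Sum>t=1..K d. gp (Suc d) (F p)) * ?k \<le> B"
    by (rule tendsto_upperbound) simp
  moreover have "(\<Sum>p\<in>P. \<Sum>t=1..K d. gp (Suc d) (F p)) = of_nat (K d) * (\<Sum>p\<in>P. gp (Suc d) (F p))"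
    by (simp add: sum_distrib_left)
  ultimately show ?case by (simp add: norm_mult mult.commute mult.left_commute del: power_Suc)
qed

end

lemma sum_lessThan_add:
  fixes g :: "nat \<Rightarrow> int"
  shows "(\<Sum>i<d + s. g i) = (\<Sum>i<d. g i) + (\<Sum>j<s. g (d + j))"
  by (induction s) auto

section \<open>The product of dual functions\<close>

locale prop_setup = mps M T for M :: "'a measure" and T +
  fixes f :: "'a \<Rightarrow> complex" and C :: real and d s :: nat
  assumes f: "f \<in> BM" and fC: "\<And>x. norm (f x) \<le> C" and C1: "1 \<le> C"
begin

text \<open>\<open>C2\<close> bounds the derivatives of \<open>f\<close>, \<open>C3\<close> their
  dual functions and \<open>C4\<close> the product of the dual functions; each exponent counts the
  vertices of a cube.\<close>

definition C2 :: real where "C2 = C ^ (2 ^ s)"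
definition C3 :: real where "C3 = C2 ^ (2 ^ Suc d)"
definition C4 :: real where "C4 = C3 ^ (2 ^ s)"

lemma C_bounds: "1 \<le> C2" "1 \<le> C3" "1 \<le> C4" "C \<le> C4" "C2 \<le> C4" "C3 \<le> C4"
proof -
  show 2: "1 \<le> C2" using C1 by (simp add: C2_def)
  then show 3: "1 \<le> C3" by (simp add: C3_def)
  then show "1 \<le> C4" by (simp add: C4_def)
  have "C \<le> C2" unfolding C2_def using C1 by (intro self_le_power) auto
  also have "C2 \<le> C3" unfolding C3_def using 2 by (intro self_le_power) auto
  finally have "C \<le> C3" .
  show 4: "C3 \<le> C4" unfolding C4_def using 3 by (intro self_le_power) auto
  show "C \<le> C4" using \<open>C \<le> C3\<close> 4 by linarith
  show "C2 \<le> C4" using \<open>C2 \<le> C3\<close> 4 by linarith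
qed

text \<open>Dual functions are bounded only almost everywhere; \<open>dsel\<close> picks a bounded representative.\<close>

definition dsel :: "('a \<Rightarrow> complex) \<Rightarrow> 'a \<Rightarrow> complex" where
  "dsel F = (SOME g. g \<in> BM \<and> (\<forall>x. norm (g x) \<le> C3) \<and> (AE x in M. dual_fun M T (Suc d) F x = g x) \<and>
      L2_tendsto M (dual_avg T (Suc d) F) g \<and> dual_fun M T (Suc d) F \<in> borel_measurable M)"

definition dual_rep :: "(nat \<Rightarrow> nat) \<Rightarrow> 'a \<Rightarrow> complex" where "dual_rep h = dsel (mderivs T s h f)"

lemma mderivs_f: "mderivs T s h f \<in> BM" "norm (mderivs T s h f x) \<le> C2"
  using BM_mderivs[OF f] mderivs_bound[where f = f and C = C and s = s and h = h and x = x] fC by (auto simp: C2_def)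

lemma dual_rep: "dual_rep h \<in> BM" "norm (dual_rep h x) \<le> C3" "AE x in M. dual_fun M T (Suc d) (mderivs T s h f) x = dual_rep h x"
    "L2_tendsto M (dual_avg T (Suc d) (mderivs T s h f)) (dual_rep h)" "dual_fun M T (Suc d) (mderivs T s h f) \<in> borel_measurable M"
proof -
  let ?F = "mderivs T s h f"
  have "\<exists>g. g \<in> BM \<and> (\<forall>x. norm (g x) \<le> C3) \<and> (AE x in M. dual_fun M T (Suc d) ?F x = g x) \<and>
      L2_tendsto M (dual_avg T (Suc d) ?F) g \<and> dual_fun M T (Suc d) ?F \<in> borel_measurable M"
    using dual_fun_exists[where f = ?F and C = C2 and r = "Suc d", OF mderivs_f(1) mderivs_f(2) C_bounds(1)] unfolding C3_def by blast
  from someI_ex[OF this] show "dual_rep h \<in> BM" "norm (dual_rep h x) \<le> C3" "AE x in M. dual_fun M T (Suc d) ?F x = dual_rep h x"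
    "L2_tendsto M (dual_avg T (Suc d) ?F) (dual_rep h)" "dual_fun M T (Suc d) ?F \<in> borel_measurable M"
    unfolding dual_rep_def dsel_def by blast+
qed

lemma dual_rep_cong: "(\<And>j. j < s \<Longrightarrow> h j = h' j) \<Longrightarrow> dual_rep h = dual_rep h'"
  unfolding dual_rep_def using mderivs_cong[of s h h' T f] by simp

definition fs :: "(nat \<Rightarrow> nat) \<Rightarrow> (nat \<Rightarrow> nat) \<Rightarrow> 'a \<Rightarrow> complex" where
  "fs h h' x = (\<Prod>\<epsilon>\<in>cube s. (cnj ^^ weight s \<epsilon>) (dual_rep (select \<epsilon> h h') x))"

lemma fs_BM: "fs h h' \<in> BM"
  unfolding fs_def[abs_def] by (intro BM_prod BM_cjn dual_rep)

lemma fs_bound: "norm (fs h h' x) \<le> C4"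
  unfolding fs_def C4_def
  using osys.prod_bound[OF base_osys, of "cube s" "\<lambda>\<epsilon>. (cnj ^^ weight s \<epsilon>) (dual_rep (select \<epsilon> h h') x)" C3] dual_rep(2) by simp

lemma fs_cong:
  assumes "\<And>j. j < s \<Longrightarrow> h j = h1 j" "\<And>j. j < s \<Longrightarrow> h' j = h1' j" shows "fs h h' = fs h1 h1'"
proof -
  have "dual_rep (select \<epsilon> h h') = dual_rep (select \<epsilon> h1 h1')" for \<epsilon>
    using assms by (intro dual_rep_cong) (simp add: select_def)
  then show ?thesis by (simp add: fs_def fun_eq_iff)
qed

lemma ghk_dual_cube_prod: "ghk M T d (dual_cube_prod M T d s f h h') = ghk M T d (fs h h')"
proof (rule ghk_cong_AE)
  show "fs h h' \<in> borel_measurable M" by (rule BM_measurable[OF fs_BM])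
  have cm: "(\<lambda>x. (cnj ^^ k) (g x)) \<in> borel_measurable M" if "g \<in> borel_measurable M" for k and g :: "'a \<Rightarrow> complex"
    using that by (induction k) (auto intro: borel_measurable_continuous_on[OF continuous_on_cnj[OF continuous_on_id]])
  show "dual_cube_prod M T d s f h h' \<in> borel_measurable M"
    unfolding dual_cube_prod_def by (intro borel_measurable_prod cm dual_rep(5))
  have "AE x in M. \<forall>\<epsilon>\<in>cube s. dual_fun M T (Suc d) (mderivs T s (select \<epsilon> h h') f) x = dual_rep (select \<epsilon> h h') x"
    using dual_rep(3) by (intro AE_finite_allI) auto
  then show "AE x in M. dual_cube_prod M T d s f h h' x = fs h h' x"
    by eventually_elim (simp add: dual_cube_prod_def fs_def)
qed

text \<open>
  The window variable \<open>\<rho>\<close> has \<open>d + s\<close> coordinates; the first \<open>d\<close> shift \<open>m\<close>, \<open>n\<close> and the point,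
  the last \<open>s\<close> shift \<open>h\<close>.
\<close>

definition hr :: "(nat \<Rightarrow> nat) \<Rightarrow> (nat \<Rightarrow> nat) \<Rightarrow> nat \<Rightarrow> nat" where
  "hr h \<rho> = (\<lambda>j. h j + \<rho> (d + j))"
definition mr :: "(nat \<Rightarrow> nat) \<Rightarrow> (nat \<Rightarrow> nat) \<Rightarrow> nat \<Rightarrow> nat" where
  "mr m \<rho> = (\<lambda>i. m i + (if i < d then \<rho> i else 0))"

text \<open>What remains of the derivative of \<open>fs (hr h \<rho>) h'\<close> after the one dual
  function that will be expanded is taken out.\<close>

definition Rf :: "(nat \<Rightarrow> nat) \<Rightarrow> (nat \<Rightarrow> nat) \<Rightarrow> (nat \<Rightarrow> nat) \<Rightarrow> (nat \<Rightarrow> nat) \<Rightarrow> 'a \<Rightarrow> complex" where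
  "Rf h h' n \<rho> x = (\<Prod>\<epsilon>\<in>cube s - {czero s}. (cnj ^^ weight s \<epsilon>) (dual_rep (select \<epsilon> (hr h \<rho>) h') x)) *
     (\<Prod>\<theta>\<in>cube d - {czero d}. (cnj ^^ weight d \<theta>) (fs (hr h \<rho>) h' ((T ^^ (\<Sum>i<d. \<theta> i * (n i + \<rho> i))) x)))"

lemma Rf_BM: "Rf h h' n \<rho> \<in> BM"
  unfolding Rf_def[abs_def] by (intro BM_mult BM_prod BM_cjn dual_rep BM_Tn fs_BM)

definition dprod :: "(nat \<Rightarrow> nat) \<Rightarrow> (nat \<Rightarrow> nat) \<Rightarrow> 'a \<Rightarrow> complex" where
  "dprod h m x = (\<Prod>\<eta>\<in>cube (Suc d) - {czero (Suc d)}. (cnj ^^ weight (Suc d) \<eta>) (mderivs T s h f ((T ^^ (\<Sum>j<Suc d. \<eta> j * m j)) x)))"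

lemma dprod_BM: "dprod h m \<in> BM"
  unfolding dprod_def[abs_def] by (intro BM_prod BM_cjn BM_Tn mderivs_f)

lemma dual_avg_dprod: "dual_avg T (Suc d) (mderivs T s h f) N x = (\<Sum>m\<in>grid (Suc d) N. dprod h m x) / of_nat N ^ Suc d"
  by (simp add: dual_avg_def dprod_def shift_def czero_def)

text \<open>The top vertex of the derivative of \<open>f\<close> moves the point forward by the last
  \<open>s\<close> coordinates of \<rho>; the translation by \<open>- low_sum \<rho>\<close> moves
  it backward by the first \<open>d\<close>.\<close>

definition dirs :: "nat \<Rightarrow> int" where "dirs i = (if i < d then -1 else 1)"

definition low_sum :: "(nat \<Rightarrow> nat) \<Rightarrow> int" where "low_sum \<rho> = (\<Sum>i<d. int (\<rho> i))"

lemma low_sum_upd: "i \<ge> d \<Longrightarrow> low_sum (\<rho>(i := v)) = low_sum \<rho>"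
  by (auto simp: low_sum_def)

lemma lin_dirs: "lin dirs (d + s) \<rho> = (\<Sum>j<s. int (\<rho> (d + j))) - low_sum \<rho>"
  by (simp add: lin_def sum_lessThan_add dirs_def low_sum_def sum_negf)

text \<open>One factor \<open>C4\<close> for each factor of the integrand except the translate of
  \<open>f\<close> that sees the whole window. The vertex removed besides zero has its only 1 at
  \<open>d\<close>.\<close>

definition Bt :: real where
  "Bt = C4 ^ card (cube s - {cone s}) * C4 ^ card (cube (Suc d) - {czero (Suc d)} - {\<lambda>j\<in>{..<Suc d}. if j = d then 1 else 0}) *
    C4 ^ card (cube s - {czero s}) * C4 ^ card (cube d - {czero d})"

lemma shift_out: "(LINT x|M. g x) = (LINT x|M. g (Tz (- low_sum \<rho>) x))" if "g \<in> BM"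
  using integral_Tz[OF BM_measurable[OF that]] by simp

lemma TnTz: "(T ^^ k) (Tz z x) = Tz (int k + z) x"
  by (simp add: Tz_add)

text \<open>After the translation by \<open>- low_sum \<rho>\<close> each remaining factor ignores a
  coordinate. In \<open>q1\<close> a vertex with a 0 at \<open>j\<close> ignores
  \<open>\<rho> (d + j)\<close>. In \<open>q2\<close> and \<open>q4\<close> a vertex with a 1 at
  some \<open>i < d\<close> ignores \<open>\<rho> i\<close>. In \<open>q3\<close> a vertex with a 1
  at \<open>j\<close> selects \<open>h'\<close> there and ignores
  \<open>\<rho> (d + j)\<close>.\<close>

lemma core_bound:
  assumes K: "\<And>i. K i > 0"
  shows "norm ((\<Sum>\<rho>\<in>gridK (d + s) K. LINT x|M. dprod (hr h \<rho>) (mr m \<rho>) x * Rf h h' n \<rho> x) / of_nat (\<Prod>i<d + s. K i)) ^ (2 ^ (d + s))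
    \<le> (Bt ^ (d + s)) ^ (2 ^ (d + s)) * norm (box_pow dirs K (d + s) f)"
proof -
  let ?ed = "\<lambda>j\<in>{..<Suc d}. if j = d then 1 else (0::nat)"
  let ?Q1 = "cube s - {cone s}" and ?Q2 = "cube (Suc d) - {czero (Suc d)} - {?ed}"
    and ?Q3 = "cube s - {czero s}" and ?Q4 = "cube d - {czero d}"
  \<comment> \<open>the factor \<open>F\<close>, from the vertex \<open>?ed\<close> of the dual function and the top vertex of \<open>\<Delta>\<^bsub>h\<^esub> f\<close>, is the
    only one to depend on all coordinates of \<open>\<rho>\<close>\<close>
  define q1 where "q1 \<alpha> \<rho> x = (cnj ^^ (1 + weight s \<alpha>)) (f (Tz (int (m d + (\<Sum>j<s. \<alpha> j * hr h \<rho> j)) - low_sum \<rho>) x))" for \<alpha> \<rho> x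
  define q2 where "q2 \<eta> \<rho> x = (cnj ^^ weight (Suc d) \<eta>) (mderivs T s (hr h \<rho>) f (Tz (int (\<Sum>j<Suc d. \<eta> j * mr m \<rho> j) - low_sum \<rho>) x))" for \<eta> \<rho> x
  define q3 where "q3 \<epsilon> \<rho> x = (cnj ^^ weight s \<epsilon>) (dual_rep (select \<epsilon> (hr h \<rho>) h') (Tz (- low_sum \<rho>) x))" for \<epsilon> \<rho> x
  define q4 where "q4 \<theta> \<rho> x = (cnj ^^ weight d \<theta>) (fs (hr h \<rho>) h' (Tz (int (\<Sum>i<d. \<theta> i * (n i + \<rho> i)) - low_sum \<rho>) x))" for \<theta> \<rho> x
  define F where "F x = (cnj ^^ (1 + s)) (f (Tz (int (m d + (\<Sum>j<s. h j))) x))" for x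
  have ed: "?ed \<in> cube (Suc d)" by (auto simp: cube_def)
  have ed0: "?ed \<noteq> czero (Suc d)"
  proof
    assume "?ed = czero (Suc d)"
    then have "?ed d = czero (Suc d) d" by simp
    then show False by (simp add: czero_def)
  qed
  have hr_low: "hr h (\<rho>(i := v)) = hr h \<rho>" if "i < d" for i v \<rho>
    using that by (auto simp: hr_def)
  have coef: "(\<Sum>i<d. (int (\<theta> i) - 1) * int ((\<rho>(k := v)) i)) = (\<Sum>i<d. (int (\<theta> i) - 1) * int (\<rho> i))" if "\<theta> k = 1" for \<theta> k v and \<rho> :: "nat \<Rightarrow> nat"
    using that by (intro sum.cong) auto
  have s1: "splits (d + s) C4 (q1 \<alpha>)" if \<alpha>: "\<alpha> \<in> ?Q1" for \<alpha>
  proof -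
    obtain j where j: "j < s" "\<alpha> j = 0" using cube_not_one \<alpha> by blast
    show ?thesis
    proof (rule splits_single[of "d + j"])
      show "q1 \<alpha> \<rho> \<in> BM" for \<rho> unfolding q1_def[abs_def] by (intro BM_cjn BM_Tz f)
      show "norm (q1 \<alpha> \<rho> x) \<le> C4" for \<rho> x unfolding q1_def cjn_norm using fC C_bounds(4) order_trans by blast
      have "(\<Sum>i<s. \<alpha> i * hr h (\<rho>(d + j := v)) i) = (\<Sum>i<s. \<alpha> i * hr h \<rho> i)" for \<rho> v
        using j by (intro sum.cong) (auto simp: hr_def)
      then show "q1 \<alpha> (\<rho>(d + j := v)) = q1 \<alpha> \<rho>" for \<rho> v
        by (simp add: q1_def fun_eq_iff low_sum_upd)
    qed (use j C_bounds in auto)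
  qed
  have s2: "splits (d + s) C4 (q2 \<eta>)" if \<eta>: "\<eta> \<in> ?Q2" for \<eta>
  proof -
    \<comment> \<open>The only vertices without a 1 below \<open>d\<close> are zero and
      \<open>?ed\<close>, and both have been taken out.\<close>
    have "\<exists>i<d. \<eta> i = 1"
    proof (rule ccontr)
      assume no: "\<not> ?thesis"
      have \<eta>c: "\<eta> \<in> cube (Suc d)" using \<eta> by simp
      then have z: "\<eta> i = 0" if "i < d" for i using cube_val[OF \<eta>c, of i] no that by auto
      have "\<eta> d = 0 \<or> \<eta> d = 1" by (rule cube_val[OF \<eta>c]) simp
      then have "\<eta> = czero (Suc d) \<or> \<eta> = ?ed"
      proof
        assume "\<eta> d = 0"
        then have "\<eta> = czero (Suc d)" using z by (intro cube_ext[OF \<eta>c czero_cube]) (auto simp: czero_def less_Suc_eq)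
        then show ?thesis ..
      next
        assume "\<eta> d = 1"
        then have "\<eta> = ?ed" using z by (intro cube_ext[OF \<eta>c ed]) (auto simp: less_Suc_eq)
        then show ?thesis ..
      qed
      with \<eta> show False by simp
    qed
    then obtain i where i: "i < d" "\<eta> i = 1" by blast
    \<comment> \<open>The translation leaves \<open>\<rho> j\<close> with the coefficient
      \<open>\<eta> j - 1\<close>, which vanishes where \<open>\<eta> j = 1\<close>.\<close>
    have e: "int (\<Sum>j<Suc d. \<eta> j * mr m \<rho> j) - low_sum \<rho> = (\<Sum>j<Suc d. int (\<eta> j * m j)) + (\<Sum>j<d. (int (\<eta> j) - 1) * int (\<rho> j))" for \<rho>
      by (simp add: low_sum_def mr_def sum_subtractf left_diff_distrib sum.distrib distrib_left)
    show ?thesis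
    proof (rule splits_single[of i])
      show "q2 \<eta> \<rho> \<in> BM" for \<rho> unfolding q2_def[abs_def] by (intro BM_cjn BM_Tz mderivs_f)
      show "norm (q2 \<eta> \<rho> x) \<le> C4" for \<rho> x unfolding q2_def cjn_norm using mderivs_f(2) C_bounds(5) order_trans by blast
      show "q2 \<eta> (\<rho>(i := v)) = q2 \<eta> \<rho>" for \<rho> v
        unfolding q2_def[abs_def] e hr_low[OF i(1)] coef[of \<eta> i, OF i(2)] ..
    qed (use i C_bounds in auto)
  qed
  have s3: "splits (d + s) C4 (q3 \<epsilon>)" if \<epsilon>: "\<epsilon> \<in> ?Q3" for \<epsilon>
  proof -
    obtain j where j: "j < s" "\<epsilon> j = 1" using cube_not_zero \<epsilon> by blast
    show ?thesis
    proof (rule splits_single[of "d + j"])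
      show "q3 \<epsilon> \<rho> \<in> BM" for \<rho> unfolding q3_def[abs_def] by (intro BM_cjn BM_Tz dual_rep)
      show "norm (q3 \<epsilon> \<rho> x) \<le> C4" for \<rho> x unfolding q3_def cjn_norm using dual_rep(2) C_bounds(6) order_trans by blast
      have "dual_rep (select \<epsilon> (hr h (\<rho>(d + j := v))) h') = dual_rep (select \<epsilon> (hr h \<rho>) h')" for \<rho> v
        using j by (intro dual_rep_cong) (auto simp: select_def hr_def)
      then show "q3 \<epsilon> (\<rho>(d + j := v)) = q3 \<epsilon> \<rho>" for \<rho> v
        by (simp add: q3_def fun_eq_iff low_sum_upd)
    qed (use j C_bounds in auto)
  qed
  have s4: "splits (d + s) C4 (q4 \<theta>)" if \<theta>: "\<theta> \<in> ?Q4" for \<theta>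
  proof -
    obtain i where i: "i < d" "\<theta> i = 1" using cube_not_zero \<theta> by blast
    have e: "int (\<Sum>i<d. \<theta> i * (n i + \<rho> i)) - low_sum \<rho> = (\<Sum>j<d. int (\<theta> j * n j)) + (\<Sum>j<d. (int (\<theta> j) - 1) * int (\<rho> j))" for \<rho>
      by (simp add: low_sum_def sum_subtractf left_diff_distrib sum.distrib distrib_left)
    show ?thesis
    proof (rule splits_single[of i])
      show "q4 \<theta> \<rho> \<in> BM" for \<rho> unfolding q4_def[abs_def] by (intro BM_cjn BM_Tz fs_BM)
      show "norm (q4 \<theta> \<rho> x) \<le> C4" for \<rho> x unfolding q4_def cjn_norm by (rule fs_bound)
      show "q4 \<theta> (\<rho>(i := v)) = q4 \<theta> \<rho>" for \<rho> v
        unfolding q4_def[abs_def] e hr_low[OF i(1)] coef[of \<theta> i, OF i(2)] ..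
    qed (use i C_bounds in auto)
  qed
  define q where "q \<rho> x = (\<Prod>\<alpha>\<in>?Q1. q1 \<alpha> \<rho> x) * (\<Prod>\<eta>\<in>?Q2. q2 \<eta> \<rho> x) * (\<Prod>\<epsilon>\<in>?Q3. q3 \<epsilon> \<rho> x) * (\<Prod>\<theta>\<in>?Q4. q4 \<theta> \<rho> x)" for \<rho> x
  have q: "splits (d + s) Bt q"
    unfolding q_def[abs_def] Bt_def by (intro splits_mult splits_prod s1 s2 s3 s4) auto
  have eq: "dprod (hr h \<rho>) (mr m \<rho>) (Tz (- low_sum \<rho>) x) * Rf h h' n \<rho> (Tz (- low_sum \<rho>) x) = F (Tz (lin dirs (d + s) \<rho>) x) * q \<rho> x" for \<rho> x
  proof -
    have r: "Rf h h' n \<rho> (Tz (- low_sum \<rho>) x) = (\<Prod>\<epsilon>\<in>?Q3. q3 \<epsilon> \<rho> x) * (\<Prod>\<theta>\<in>?Q4. q4 \<theta> \<rho> x)"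
      by (simp add: Rf_def q3_def q4_def TnTz)
    have "dprod (hr h \<rho>) (mr m \<rho>) (Tz (- low_sum \<rho>) x) = (\<Prod>\<eta>\<in>cube (Suc d) - {czero (Suc d)}. q2 \<eta> \<rho> x)"
      unfolding dprod_def q2_def TnTz by simp
    also have "\<dots> = q2 ?ed \<rho> x * (\<Prod>\<eta>\<in>?Q2. q2 \<eta> \<rho> x)"
      using ed ed0 by (intro prod.remove) auto
    \<comment> \<open>At \<open>?ed\<close> only \<open>m d\<close> enters, and \<rho> does not
      shift it; expanding the derivative then isolates the top vertex \<open>cone s\<close>.\<close>
    also have "q2 ?ed \<rho> x = (\<Prod>\<alpha>\<in>cube s. q1 \<alpha> \<rho> x)"
    proof -
      have w: "weight (Suc d) ?ed = 1" by (simp add: weight_def)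
      have e: "(\<Sum>j<Suc d. ?ed j * mr m \<rho> j) = m d" by (simp add: mr_def)
      show ?thesis
        unfolding q2_def w e mderivs_cube cjn_prod q1_def cjn_add[of 1] TnTz by (simp add: algebra_simps)
    qed
    also have "\<dots> = q1 (cone s) \<rho> x * (\<Prod>\<alpha>\<in>?Q1. q1 \<alpha> \<rho> x)"
      by (intro prod.remove) auto
    also have "q1 (cone s) \<rho> x = F (Tz (lin dirs (d + s) \<rho>) x)"
    proof -
      have "(\<Sum>j<s. cone s j * hr h \<rho> j) = (\<Sum>j<s. h j) + (\<Sum>j<s. \<rho> (d + j))"
        by (simp add: cone_def hr_def sum.distrib)
      then show ?thesis
        unfolding q1_def F_def lin_dirs by (simp add: Tz_add[symmetric] algebra_simps)
    qed
    finally show ?thesis unfolding r q_def by (simp only: mult.assoc)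
  qed
  have "(LINT x|M. dprod (hr h \<rho>) (mr m \<rho>) x * Rf h h' n \<rho> x) = (LINT x|M. F (Tz (lin dirs (d + s) \<rho>) x) * q \<rho> x)" for \<rho>
    unfolding eq[symmetric] by (rule shift_out[OF BM_mult[OF dprod_BM Rf_BM]])
  moreover have F: "F \<in> BM" unfolding F_def[abs_def] by (intro BM_cjn BM_Tz f)
  moreover have "norm (box_pow dirs K (d + s) F) = norm (box_pow dirs K (d + s) f)"
    unfolding F_def[abs_def] using box_pow_cjn[of dirs K "d + s" "1 + s" "\<lambda>x. f (Tz (int (m d + (\<Sum>j<s. h j))) x)"] box_pow_Tz[OF f] by simp
  ultimately show ?thesis using splits_box_bound[where F = F and r = "d + s" and B = Bt and q = q and K = K and c = dirs, OF F q K] by simp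
qed

text \<open>The zero vertex of the derivative and the zero vertex of the product over
  \<open>cube s\<close> single out the dual function to be expanded.\<close>

lemma mderivs_fs: "mderivs T d (\<lambda>i. n i + \<rho> i) (fs (hr h \<rho>) h') x = dual_rep (hr h \<rho>) x * Rf h h' n \<rho> x"
proof -
  have z: "(\<Sum>i<d. czero d i * v i) = 0" for v by (simp add: czero_def)
  have "mderivs T d (\<lambda>i. n i + \<rho> i) (fs (hr h \<rho>) h') x
      = fs (hr h \<rho>) h' x * (\<Prod>\<theta>\<in>cube d - {czero d}. (cnj ^^ weight d \<theta>) (fs (hr h \<rho>) h' ((T ^^ (\<Sum>i<d. \<theta> i * (n i + \<rho> i))) x)))"
    unfolding mderivs_cube by (subst prod.remove[of "cube d" "czero d"]) (simp_all add: z)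
  moreover have "fs (hr h \<rho>) h' x = dual_rep (hr h \<rho>) x * (\<Prod>\<epsilon>\<in>cube s - {czero s}. (cnj ^^ weight s \<epsilon>) (dual_rep (select \<epsilon> (hr h \<rho>) h') x))"
  proof -
    have "dual_rep (select (czero s) (hr h \<rho>) h') = dual_rep (hr h \<rho>)" by (rule dual_rep_cong) (simp add: select_def czero_def)
    then show ?thesis unfolding fs_def by (subst prod.remove[of "cube s" "czero s"]) auto
  qed
  ultimately show ?thesis by (simp add: Rf_def)
qed

text \<open>For each \<rho> the dual function is expanded by \<open>L2_weak\<close>; shifting
  \<open>m\<close> by \<rho> is free in the limit because the window is fixed. Exchanging the sums
  over \<rho> and \<open>m\<close> leaves, for each \<open>m\<close>, the sum treated in
  \<open>core_bound\<close>.\<close>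

lemma mderivs_sum_bound:
  assumes K: "\<And>i. K i > 0" and X: "0 \<le> X" "(Bt ^ (d + s)) ^ (2 ^ (d + s)) * norm (box_pow dirs K (d + s) f) \<le> X ^ (2 ^ (d + s))"
  shows "norm (\<Sum>\<rho>\<in>gridK (d + s) K. LINT x|M. mderivs T d (\<lambda>i. n i + \<rho> i) (fs (hr h \<rho>) h') x) \<le> (\<Prod>i<d + s. real (K i)) * X"
proof -
  let ?P = "\<Prod>i<d + s. real (K i)"
  have P0: "?P > 0" using K by (intro prod_pos) auto
  define a where "a \<rho> m = (LINT x|M. dprod (hr h \<rho>) m x * Rf h h' n \<rho> x)" for \<rho> m
  let ?s = "\<lambda>N \<rho>. \<Sum>m\<in>grid (Suc d) N. a \<rho> (mr m \<rho>)"
    and ?l = "\<lambda>\<rho>. LINT x|M. mderivs T d (\<lambda>i. n i + \<rho> i) (fs (hr h \<rho>) h') x"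
  have bound: "norm (\<Sum>\<rho>\<in>gridK (d + s) K. a \<rho> (mr m \<rho>)) \<le> ?P * X" for m
  proof -
    let ?Y = "\<Sum>\<rho>\<in>gridK (d + s) K. a \<rho> (mr m \<rho>)"
    have "norm (?Y / of_nat (\<Prod>i<d + s. K i)) ^ (2 ^ (d + s)) \<le> X ^ (2 ^ (d + s))"
      using core_bound[where K = K and h = h and m = m and h' = h' and n = n, OF K] X(2) unfolding a_def by linarith
    then have "norm (?Y / of_nat (\<Prod>i<d + s. K i)) \<le> X"
      using X(1) by (subst (asm) power_mono_iff) auto
    moreover have "norm (?Y / of_nat (\<Prod>i<d + s. K i)) = norm ?Y / ?P"
      unfolding norm_divide norm_of_nat by simp
    ultimately show ?thesis using P0 by (simp only: divide_le_eq mult.commute if_True)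
  qed
  have lim: "(\<lambda>N. ?s N \<rho> / of_nat N ^ Suc d)
     \<longlonglongrightarrow> ?l \<rho>" for \<rho>
  proof -
    have "(\<lambda>N. LINT x|M. dual_avg T (Suc d) (mderivs T s (hr h \<rho>) f) N x * Rf h h' n \<rho> x)
       \<longlonglongrightarrow> (LINT x|M. dual_rep (hr h \<rho>) x * Rf h h' n \<rho> x)"
      by (rule L2_weak[OF dual_avg_BM[OF mderivs_f(1)] dual_rep(1) Rf_BM dual_rep(4)])
    moreover have "(LINT x|M. dual_avg T (Suc d) (mderivs T s (hr h \<rho>) f) N x * Rf h h' n \<rho> x)
        = (\<Sum>m\<in>grid (Suc d) N. a \<rho> m) / of_nat N ^ Suc d" for N
    proof -
      have "(LINT x|M. dual_avg T (Suc d) (mderivs T s (hr h \<rho>) f) N x * Rf h h' n \<rho> x)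
          = (LINT x|M. (\<Sum>m\<in>grid (Suc d) N. dprod (hr h \<rho>) m x * Rf h h' n \<rho> x) / of_nat N ^ Suc d)"
        unfolding dual_avg_dprod by (simp add: sum_distrib_right)
      also have "\<dots> = (LINT x|M. (\<Sum>m\<in>grid (Suc d) N. dprod (hr h \<rho>) m x * Rf h h' n \<rho> x)) / of_nat N ^ Suc d"
        by (rule integral_divide_zero)
      also have "(LINT x|M. (\<Sum>m\<in>grid (Suc d) N. dprod (hr h \<rho>) m x * Rf h h' n \<rho> x)) = (\<Sum>m\<in>grid (Suc d) N. a \<rho> m)"
        unfolding a_def by (rule Bochner_Integration.integral_sum) (intro BM_integrable BM_mult dprod_BM Rf_BM)
      finally show ?thesis .
    qed
    ultimately have l1: "(\<lambda>N. (\<Sum>m\<in>grid (Suc d) N. a \<rho> m) / of_nat N ^ Suc d)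
        \<longlonglongrightarrow> ?l \<rho>"
      by (simp only: mderivs_fs)
    obtain B where B: "\<And>x. norm (Rf h h' n \<rho> x) \<le> B" using BM_bdd[OF Rf_BM] by blast
    let ?c = "C2 ^ card (cube (Suc d) - {czero (Suc d)})"
    have "norm (dprod (hr h \<rho>) m x) \<le> ?c" for m x
      unfolding dprod_def by (rule osys.prod_bound[OF base_osys]) (simp add: mderivs_f(2))
    then have ab: "norm (a \<rho> m) \<le> ?c * B" for m
    proof -
      have "norm (dprod (hr h \<rho>) m x * Rf h h' n \<rho> x) \<le> ?c * B" for x
        unfolding norm_mult using \<open>\<And>m x. norm (dprod (hr h \<rho>) m x) \<le> ?c\<close> B C_bounds(1) by (intro mult_mono) auto
      then have "norm (a \<rho> m) \<le> (LINT x|M. ?c * B)"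
        unfolding a_def using BM_integrable[OF BM_mult[OF dprod_BM Rf_BM]]
        by (intro order_trans[OF integral_norm_bound] integral_mono) auto
      then show ?thesis by (simp add: prob_space)
    qed
    have dep: "a \<rho> m = a \<rho> m'" if "\<forall>i<Suc d. m i = m' i" for m m'
    proof -
      have "(\<Sum>j<Suc d. \<eta> j * m j) = (\<Sum>j<Suc d. \<eta> j * m' j)" for \<eta>
        using that by (intro sum.cong) auto
      then show ?thesis unfolding a_def dprod_def by simp
    qed
    obtain dd where dd: "dd \<longlonglongrightarrow> 0" "\<And>N C (a :: (nat \<Rightarrow> nat) \<Rightarrow> complex).
       (\<forall>m. norm (a m) \<le> C) \<Longrightarrow> (\<forall>m m'. (\<forall>i<Suc d. m i = m' i) \<longrightarrow> a m = a m') \<Longrightarrow>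
       norm (((\<Sum>m\<in>grid (Suc d) N. a (\<lambda>i. m i + (if i < d then \<rho> i else 0))) - (\<Sum>m\<in>grid (Suc d) N. a m)) / of_nat N ^ Suc d) \<le> C * dd N"
      using grid_shift[of "Suc d" "\<lambda>i. if i < d then \<rho> i else 0"] by blast
    have le: "norm ((?s N \<rho> - (\<Sum>m\<in>grid (Suc d) N. a \<rho> m)) / of_nat N ^ Suc d) \<le> (?c * B) * dd N" for N
      unfolding mr_def using ab dep by (intro dd(2)) blast+
    have "(\<lambda>N. (?c * B) * dd N) \<longlonglongrightarrow> 0" by (rule tendsto_mult_right_zero[OF dd(1)])
    then have "(\<lambda>N. (?s N \<rho> - (\<Sum>m\<in>grid (Suc d) N. a \<rho> m)) / of_nat N ^ Suc d) \<longlonglongrightarrow> 0"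
      by (rule Lim_null_comparison[rotated]) (intro always_eventually allI le)
    from tendsto_add[OF this l1] show ?thesis by (simp add: diff_divide_distrib del: power_Suc)
  qed
  have "(\<lambda>N. \<Sum>\<rho>\<in>gridK (d + s) K. ?s N \<rho> / of_nat N ^ Suc d)
     \<longlonglongrightarrow> (\<Sum>\<rho>\<in>gridK (d + s) K. LINT x|M. mderivs T d (\<lambda>i. n i + \<rho> i) (fs (hr h \<rho>) h') x)"
    by (intro tendsto_sum lim)
  moreover have "norm (\<Sum>\<rho>\<in>gridK (d + s) K. ?s N \<rho> / of_nat N ^ Suc d) \<le> ?P * X" for N
  proof -
    have "(\<Sum>\<rho>\<in>gridK (d + s) K. ?s N \<rho> / of_nat N ^ Suc d)
      = (\<Sum>m\<in>grid (Suc d) N. \<Sum>\<rho>\<in>gridK (d + s) K. a \<rho> (mr m \<rho>)) / of_nat N ^ Suc d"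
      unfolding sum_divide_distrib[symmetric] by (subst sum.swap) (rule refl)
    moreover have "norm (\<Sum>m\<in>grid (Suc d) N. \<Sum>\<rho>\<in>gridK (d + s) K. a \<rho> (mr m \<rho>)) \<le> real (card (grid (Suc d) N)) * (?P * X)"
      by (rule sum_norm_bound) (rule bound)
    ultimately have "norm (\<Sum>\<rho>\<in>gridK (d + s) K. ?s N \<rho> / of_nat N ^ Suc d)
       \<le> real N ^ Suc d * (?P * X) / real N ^ Suc d"
      unfolding card_grid by (simp only: norm_divide norm_power norm_of_nat of_nat_power) (intro divide_right_mono, auto)
    also have "\<dots> \<le> ?P * X" using P0 X(1) by (cases "N = 0") auto
    finally show ?thesis .
  qed
  ultimately show ?thesis by (intro Lim_norm_ubound[OF sequentially_bot]) auto
qed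

text \<open>\<open>ghk_window\<close> uses up the first \<open>d\<close> window coordinates; the
  last \<open>s\<close> remain as shifts of \<open>h\<close>. The bound is uniform in
  \<open>h\<close> and \<open>h'\<close>.\<close>

lemma window_bound:
  assumes K: "\<And>i. K i > 0" and X: "0 \<le> X" "(Bt ^ (d + s)) ^ (2 ^ (d + s)) * norm (box_pow dirs K (d + s) f) \<le> X ^ (2 ^ (d + s))"
  shows "norm (\<Sum>\<sigma>\<in>gridK s (\<lambda>j. K (d + j)). gp d (fs (\<lambda>j. h j + \<sigma> j) h')) \<le> (\<Prod>j<s. real (K (d + j))) * X"
proof -
  let ?G = "gridK s (\<lambda>j. K (d + j))"
  \<comment> \<open>\<open>ghk_window\<close> takes families indexed by natural numbers, so the
    window is enumerated.\<close>
  obtain \<psi> where \<psi>: "bij_betw \<psi> {0..<card ?G} ?G" using ex_bij_betw_nat_finite[of ?G] by auto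
  define F where "F p = fs (\<lambda>j. h j + \<psi> p j) h'" for p
  have re: "(\<Sum>p\<in>{0..<card ?G}. g (\<psi> p)) = (\<Sum>\<sigma>\<in>?G. g \<sigma>)" for g :: "(nat \<Rightarrow> nat) \<Rightarrow> complex"
    by (rule sum.reindex_bij_betw[OF \<psi>])
  have "norm (\<Sum>p\<in>{0..<card ?G}. gp d (F p)) * (\<Prod>i<d. real (K i)) \<le> (\<Prod>i<d + s. real (K i)) * X"
  proof (rule ghk_window)
    show "F p \<in> BM" for p unfolding F_def by (rule fs_BM)
    fix n :: "nat \<Rightarrow> nat"
    have "(\<Sum>p\<in>{0..<card ?G}. \<Sum>\<tau>\<in>gridK d K. LINT x|M. mderivs T d (\<lambda>i. n i + \<tau> i) (F p) x)
       = (\<Sum>\<sigma>\<in>?G. \<Sum>\<tau>\<in>gridK d K. LINT x|M. mderivs T d (\<lambda>i. n i + \<tau> i) (fs (\<lambda>j. h j + \<sigma> j) h') x)"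
      unfolding F_def by (rule re[of "\<lambda>\<sigma>. \<Sum>\<tau>\<in>gridK d K. LINT x|M. mderivs T d (\<lambda>i. n i + \<tau> i) (fs (\<lambda>j. h j + \<sigma> j) h') x"])
    also have "\<dots> = (\<Sum>\<rho>\<in>gridK (d + s) K. LINT x|M. mderivs T d (\<lambda>i. n i + \<rho> i) (fs (hr h \<rho>) h') x)"
      unfolding sum_gridK_add
    proof (intro sum.cong refl)
      fix \<sigma> \<tau> :: "nat \<Rightarrow> nat"
      let ?\<rho> = "\<lambda>i. if i < d then \<tau> i else if i < d + s then \<sigma> (i - d) else undefined"
      have "fs (\<lambda>j. h j + \<sigma> j) h' = fs (hr h ?\<rho>) h'" by (rule fs_cong) (auto simp: hr_def)
      moreover have "mderivs T d (\<lambda>i. n i + \<tau> i) g = mderivs T d (\<lambda>i. n i + ?\<rho> i) g" for g :: "'a \<Rightarrow> complex"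
        by (rule mderivs_cong) simp
      ultimately show "(LINT x|M. mderivs T d (\<lambda>i. n i + \<tau> i) (fs (\<lambda>j. h j + \<sigma> j) h') x)
          = (LINT x|M. mderivs T d (\<lambda>i. n i + ?\<rho> i) (fs (hr h ?\<rho>) h') x)" by simp
    qed
    finally show "norm (\<Sum>p\<in>{0..<card ?G}. \<Sum>\<tau>\<in>gridK d K. LINT x|M. mderivs T d (\<lambda>i. n i + \<tau> i) (F p) x) \<le> (\<Prod>i<d + s. real (K i)) * X"
      using mderivs_sum_bound[OF K X] by simp
  qed simp
  moreover have "(\<Prod>i<d + s. real (K i)) = (\<Prod>i<d. real (K i)) * (\<Prod>j<s. real (K (d + j)))"
    by (induction s) (auto simp: mult.assoc)
  moreover have "(\<Prod>i<d. real (K i)) > 0" using K by (intro prod_pos) auto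
  moreover have "x \<le> q * X" if "x * p \<le> r * X" "r = p * q" "p > 0" for x p q r :: real
    using that by (simp add: mult.assoc mult.commute[of x])
  ultimately have "norm (\<Sum>p\<in>{0..<card ?G}. gp d (F p)) \<le> (\<Prod>j<s. real (K (d + j))) * X"
    by blast
  then show ?thesis
    unfolding F_def re[of "\<lambda>\<sigma>. gp d (fs (\<lambda>j. h j + \<sigma> j) h')"] .
qed

text \<open>The window is fixed in terms of \<open>e\<close> before \<open>H\<close> grows. Only
  \<open>h\<close> is shifted over the window, for each \<open>h'\<close> separately; this costs a
  vanishing error uniform in \<open>h'\<close>, and \<open>window_bound\<close> controls the shifted
  sums.\<close>

lemma power_average_tendsto:
  assumes zero: "ghk M T (d + s) f = 0"
  shows "(\<lambda>H. (\<Sum>h\<in>grid s H. \<Sum>h'\<in>grid s H. gp d (fs h h')) / of_nat H ^ (2 * s)) \<longlonglongrightarrow> 0"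
proof (rule LIMSEQ_I)
  fix e :: real assume e: "e > 0"
  define X where "X = e / 2"
  have X: "X > 0" using e by (simp add: X_def)
  let ?r = "d + s"
  have "1 \<le> Bt" unfolding Bt_def
    using C_bounds(3) by (intro mult_ge1_I one_le_power)
  then have B0: "(Bt ^ ?r) ^ (2 ^ ?r) > 0" by simp
  \<comment> \<open>Chosen so that a box average below \<open>e0\<close>, multiplied by the constant
    of \<open>core_bound\<close>, stays below \<open>X ^ (2 ^ ?r)\<close>.\<close>
  define e0 where "e0 = X ^ (2 ^ ?r) / (Bt ^ ?r) ^ (2 ^ ?r)"
  have e0: "e0 > 0" unfolding e0_def using X B0 by (intro divide_pos_pos) auto
  obtain K where K: "\<And>i. K i > 0" "norm (box_pow dirs K ?r f - gp ?r f) < e0"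
  proof -
    have "dirs i \<in> {1, -1}" for i by (simp add: dirs_def)
    from box_pow_approx[of dirs "{f}" e0 ?r, OF this] f e0 that show ?thesis by auto
  qed
  have "norm (box_pow dirs K ?r f) \<le> e0" using K(2) by (simp add: zero power_0_left)
  then have XJ: "(Bt ^ ?r) ^ (2 ^ ?r) * norm (box_pow dirs K ?r f) \<le> X ^ (2 ^ ?r)"
    using B0 unfolding e0_def by (simp only: pos_le_divide_eq mult.commute)
  let ?G = "gridK s (\<lambda>j. K (d + j))"
  define g where "g = (\<Prod>j<s. real (K (d + j)))"
  have g0: "g > 0" unfolding g_def using K(1) by (intro prod_pos) auto
  have cG: "real (card ?G) = g" by (simp add: g_def)
  define a where "a h' h = gp d (fs h h')" for h' h
  let ?A = "\<lambda>h' N. \<Sum>h\<in>grid s N. a h' h" and ?B = "\<lambda>h' N. \<Sum>h\<in>grid s N. \<Sum>\<sigma>\<in>?G. a h' (\<lambda>i. h i + \<sigma> i)"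
    and ?D = "\<lambda>\<sigma> h' N. (\<Sum>h\<in>grid s N. a h' (\<lambda>i. h i + \<sigma> i)) - (\<Sum>h\<in>grid s N. a h' h)"
  define c where "c = C4 ^ (2 ^ d)"
  have ab: "norm (a h' h) \<le> c" for h' h unfolding a_def c_def by (rule ghk_norm_bound[OF fs_BM fs_bound])
  have dep: "a h' h = a h' h1" if "\<forall>i<s. h i = h1 i" for h' h h1
    unfolding a_def using fs_cong[of h h1 h' h'] that by simp
  have "\<forall>\<sigma>. \<exists>dd. dd \<longlonglongrightarrow> 0 \<and> (\<forall>N h'. norm (?D \<sigma> h' N / of_nat N ^ s) \<le> c * dd N)"
  proof
    fix \<sigma> :: "nat \<Rightarrow> nat"
    obtain dd where dd: "dd \<longlonglongrightarrow> 0" "\<And>N C (a :: (nat \<Rightarrow> nat) \<Rightarrow> complex).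
       (\<forall>m. norm (a m) \<le> C) \<Longrightarrow> (\<forall>m m'. (\<forall>i<s. m i = m' i) \<longrightarrow> a m = a m') \<Longrightarrow>
       norm (((\<Sum>m\<in>grid s N. a (\<lambda>i. m i + \<sigma> i)) - (\<Sum>m\<in>grid s N. a m)) / of_nat N ^ s) \<le> C * dd N"
      using grid_shift[of s \<sigma>] by blast
    have "norm (?D \<sigma> h' N / of_nat N ^ s) \<le> c * dd N" for N h'
      using ab dep by (intro dd(2)) blast+
    with dd(1) show "\<exists>dd. dd \<longlonglongrightarrow> 0 \<and> (\<forall>N h'. norm (?D \<sigma> h' N / of_nat N ^ s) \<le> c * dd N)"
      by blast
  qed
  from choice[OF this] obtain dd where dd: "\<And>\<sigma>. dd \<sigma> \<longlonglongrightarrow> 0"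
    "\<And>\<sigma> N h'. norm (?D \<sigma> h' N / of_nat N ^ s) \<le> c * dd \<sigma> N"
    by blast
  define \<delta> where "\<delta> N = (\<Sum>\<sigma>\<in>?G. c * dd \<sigma> N) / g" for N
  have "\<delta> \<longlonglongrightarrow> (\<Sum>\<sigma>\<in>?G. c * 0) / g"
    unfolding \<delta>_def using g0 by (intro tendsto_divide tendsto_sum tendsto_mult tendsto_const dd(1)) auto
  then have "\<delta> \<longlonglongrightarrow> 0" by simp
  then obtain N0 where N0: "\<And>N. N \<ge> N0 \<Longrightarrow> \<delta> N < e / 2"
    using LIMSEQ_D[of \<delta> 0 "e / 2"] e by fastforce
  have inner: "norm (?A h' H) \<le> real H ^ s * (X + \<delta> H)" if H: "H > 0" for H h'
  proof -
    have Hs: "real H ^ s > 0" using H by simp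
    have "of_nat (card ?G) * ?A h' H = ?B h' H
       - (\<Sum>\<sigma>\<in>?G. ?D \<sigma> h' H)"
      by (subst sum.swap) (simp add: sum_subtractf)
    then have "g * norm (?A h' H) = norm (?B h' H
       - (\<Sum>\<sigma>\<in>?G. ?D \<sigma> h' H))"
      unfolding cG[symmetric] by (metis norm_mult norm_of_nat)
    also have "\<dots> \<le> norm (?B h' H)
       + norm (\<Sum>\<sigma>\<in>?G. ?D \<sigma> h' H)"
      by (rule norm_triangle_ineq4)
    also have "\<dots> \<le> real H ^ s * (g * X) + (\<Sum>\<sigma>\<in>?G. real H ^ s * (c * dd \<sigma> H))"
    proof (intro add_mono)
      have "norm (?B h' H) \<le> of_nat (card (grid s H)) * (g * X)"
        unfolding a_def g_def using window_bound[OF K(1) less_imp_le[OF X] XJ] by (intro sum_norm_bound)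
      then show "norm (?B h' H) \<le> real H ^ s * (g * X)" by simp
      show "norm (\<Sum>\<sigma>\<in>?G. ?D \<sigma> h' H) \<le> (\<Sum>\<sigma>\<in>?G. real H ^ s * (c * dd \<sigma> H))"
      proof (intro order_trans[OF norm_sum] sum_mono)
        fix \<sigma>
        show "norm (?D \<sigma> h' H) \<le> real H ^ s * (c * dd \<sigma> H)"
        proof -
          have "norm (?D \<sigma> h' H / of_nat H ^ s) \<le> c * dd \<sigma> H"
            by (rule dd(2))
          then show ?thesis
            using Hs unfolding norm_divide norm_power norm_of_nat by (simp only: pos_divide_le_eq mult.commute)
        qed
      qed
    qed
    also have "\<dots> = g * (real H ^ s * (X + \<delta> H))"
      using g0 by (simp add: \<delta>_def distrib_left sum_distrib_left[symmetric])
    finally show ?thesis using g0 by (simp only: mult_le_cancel_left_pos)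
  qed
  have "norm ((\<Sum>h\<in>grid s H. \<Sum>h'\<in>grid s H. gp d (fs h h')) / of_nat H ^ (2 * s) - 0) < e"
    if H: "H \<ge> max N0 1" for H
  proof -
    have H0: "H > 0" "real H ^ s > 0" using H by auto
    have "norm (\<Sum>h\<in>grid s H. \<Sum>h'\<in>grid s H. a h' h) = norm (\<Sum>h'\<in>grid s H. \<Sum>h\<in>grid s H. a h' h)"
      by (subst sum.swap) (rule refl)
    also have "\<dots> \<le> of_nat (card (grid s H)) * (real H ^ s * (X + \<delta> H))"
      by (intro sum_norm_bound inner H0)
    also have "\<dots> = real H ^ (2 * s) * (X + \<delta> H)"
      by (simp add: mult_2 power_add)
    finally have "norm ((\<Sum>h\<in>grid s H. \<Sum>h'\<in>grid s H. a h' h) / of_nat H ^ (2 * s)) \<le> X + \<delta> H"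
      using H0 unfolding norm_divide norm_power norm_of_nat by (simp add: pos_divide_le_eq mult.commute)
    also have "\<dots> < e" using N0[of H] H by (simp add: X_def)
    finally show ?thesis by (simp add: a_def)
  qed
  then show "\<exists>no. \<forall>H\<ge>no. norm ((\<Sum>h\<in>grid s H. \<Sum>h'\<in>grid s H. gp d (fs h h')) / of_nat H ^ (2 * s) - 0) < e"
    by blast
qed

text \<open>For \<open>d = 0\<close> the exponent is 1 and there is no power to remove. Otherwise
  the seminorms are non-negative reals, and \<open>mean_pow2\<close> bounds the power of their
  average by the average of their powers.\<close>

lemma average_tendsto:
  assumes zero: "ghk M T (d + s) f = 0"
  shows "(\<lambda>H. (\<Sum>h\<in>grid s H. \<Sum>h'\<in>grid s H. ghk M T d (dual_cube_prod M T d s f h h')) / of_nat H ^ (2 * s)) \<longlonglongrightarrow> 0"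
proof (cases d)
  case 0
  then show ?thesis using power_average_tendsto[OF zero] unfolding ghk_dual_cube_prod by simp
next
  case (Suc d')
  have "\<exists>l\<ge>0. ghk M T (Suc d') (fs h h') = complex_of_real l" for h h'
    by (rule ghk_cesaro(3)[OF fs_BM])
  then have "\<exists>l\<ge>0. ghk M T d (fs h h') = complex_of_real l" for h h'
    by (simp only: Suc[symmetric])
  then have "\<exists>l. \<forall>h h'. l h h' \<ge> 0 \<and> ghk M T d (fs h h') = complex_of_real (l h h')"
    by metis
  then obtain l where l: "\<And>h h'. l h h' \<ge> (0::real)" "\<And>h h'. ghk M T d (fs h h') = of_real (l h h')" by blast
  let ?I = "\<lambda>H. grid s H \<times> grid s H"
  let ?W = "\<lambda>H. (\<Sum>p\<in>?I H. l (fst p) (snd p)) / card (?I H)"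
  let ?V = "\<lambda>H. (\<Sum>p\<in>?I H. l (fst p) (snd p) ^ (2 ^ d)) / card (?I H)"
  have cI: "card (?I H) = H ^ (2 * s)" for H by (simp add: mult_2 power_add)
  have V: "complex_of_real (?V H) = (\<Sum>h\<in>grid s H. \<Sum>h'\<in>grid s H. gp d (fs h h')) / of_nat H ^ (2 * s)" for H
    unfolding cI l(2) sum.cartesian_product by (simp add: case_prod_unfold)
  have W: "complex_of_real (?W H) = (\<Sum>h\<in>grid s H. \<Sum>h'\<in>grid s H. ghk M T d (fs h h')) / of_nat H ^ (2 * s)" for H
    unfolding cI l(2) sum.cartesian_product by (simp add: case_prod_unfold)
  have "(\<lambda>H. complex_of_real (?V H)) \<longlonglongrightarrow> of_real 0"
    unfolding V using power_average_tendsto[OF zero] by simp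
  then have Vlim: "?V \<longlonglongrightarrow> 0" by (subst (asm) tendsto_of_real_iff)
  have W0: "0 \<le> ?W H" for H using l(1) by (intro divide_nonneg_nonneg sum_nonneg) auto
  have le: "?W H ^ (2 ^ d) \<le> ?V H" for H by (rule mean_pow2) (auto simp: l(1))
  have "?W \<longlonglongrightarrow> 0"
  proof (rule LIMSEQ_I)
    fix e :: real assume e: "e > 0"
    obtain no where no': "\<forall>H\<ge>no. norm (?V H - 0) < e ^ (2 ^ d)"
      using LIMSEQ_D[OF Vlim zero_less_power[OF e]] by blast
    have no: "?V H < e ^ (2 ^ d)" if "H \<ge> no" for H
      using no'[rule_format, OF that] abs_ge_self[of "?V H"] unfolding real_norm_def diff_zero by (rule le_less_trans[rotated])
    have "norm (?W H - 0) < e" if "H \<ge> no" for H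
    proof -
      have "?W H ^ (2 ^ d) < e ^ (2 ^ d)" using le[of H] no[OF that] by linarith
      then have "?W H < e" using e by (intro power_less_imp_less_base[of "?W H" "2 ^ d" e]) auto
      then show ?thesis using W0[of H] by simp
    qed
    then show "\<exists>no. \<forall>H\<ge>no. norm (?W H - 0) < e" by blast
  qed
  then have "(\<lambda>H. complex_of_real (?W H)) \<longlonglongrightarrow> of_real 0" by (rule tendsto_of_real)
  then show ?thesis unfolding W ghk_dual_cube_prod by simp
qed

end

section \<open>Arbitrary systems\<close>

lemma L2_tendsto_cong:
  assumes "\<And>n. AE x in M. u n x = u' n x" shows "L2_tendsto M u g = L2_tendsto M u' g"
proof -
  have "(\<integral>\<^sup>+ x. ennreal ((norm (u n x - g x))\<^sup>2) \<partial>M) = (\<integral>\<^sup>+ x. ennreal ((norm (u' n x - g x))\<^sup>2) \<partial>M)" for n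
    by (rule nn_integral_cong_AE) (use assms[of n] in eventually_elim, simp)
  then show ?thesis by (simp add: L2_tendsto_def)
qed

text \<open>\<open>dual_fun\<close> chooses among all L2 limits, a set that does not change under
  almost everywhere equality of the averages; hence the conclusion is outright equality.\<close>

lemma dual_fun_cong:
  assumes "\<And>n. AE x in M. dual_avg T r F n x = dual_avg T' r F' n x"
  shows "dual_fun M T r F = dual_fun M T' r F'"
proof -
  have "L2_tendsto M (dual_avg T r F) = L2_tendsto M (dual_avg T' r F')"
    by (intro ext L2_tendsto_cong assms)
  then show ?thesis by (simp add: dual_fun_def)
qed

context
  fixes M :: "'a measure" and T T' :: "'a \<Rightarrow> 'a"
  assumes T: "\<And>x. x \<in> space M \<Longrightarrow> T x \<in> space M" and T': "\<And>x. x \<in> space M \<Longrightarrow> T' x = T x"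
begin

lemma funpow_space: "x \<in> space M \<Longrightarrow> (T ^^ n) x \<in> space M \<and> (T' ^^ n) x = (T ^^ n) x"
  by (induction n) (auto simp: T T')

lemma ghk_cong_space:
  "(\<And>x. x \<in> space M \<Longrightarrow> g x = g' x) \<Longrightarrow> ghk M T s g = ghk M T' s g'"
proof (induction s arbitrary: g g')
  case 0
  then show ?case by (simp cong: Bochner_Integration.integral_cong)
next
  case (Suc s)
  have "ghk M T s (mderiv T h g) = ghk M T' s (mderiv T' h g')" for h
    by (rule Suc.IH) (simp add: mderiv_def shift_def Suc.prems funpow_space)
  then show ?case by simp
qed

lemma mderivs_cong_space:
  "x \<in> space M \<Longrightarrow> (\<And>x. x \<in> space M \<Longrightarrow> g x = g' x) \<Longrightarrow> mderivs T s h g x = mderivs T' s h g' x"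
  unfolding mderivs_cube by (simp add: funpow_space)

lemma dual_cube_prod_cong_space:
  assumes "\<And>x. x \<in> space M \<Longrightarrow> g x = g' x"
  shows "dual_cube_prod M T d s g h h' = dual_cube_prod M T' d s g' h h'"
proof -
  have "dual_fun M T (Suc d) (mderivs T s k g) = dual_fun M T' (Suc d) (mderivs T' s k g')" for k
    by (intro dual_fun_cong AE_I2) (simp add: dual_avg_def shift_def funpow_space mderivs_cong_space[OF _ assms])
  then show ?thesis by (simp add: dual_cube_prod_def)
qed

end

context mps begin

text \<open>The averages evaluate the function only along the countably many iterates of
  \<open>T\<close>, so one null set serves them all.\<close>

lemma dual_cube_prod_cong_AE:
  assumes "AE x in M. g x = g' x"
  shows "dual_cube_prod M T d s g h h' = dual_cube_prod M T d s g' h h'"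
proof -
  have "AE x in M. \<forall>n. g ((T ^^ n) x) = g' ((T ^^ n) x)"
    unfolding AE_all_countable using AE_Tn[OF assms] by blast
  then have "AE x in M. dual_avg T (Suc d) (mderivs T s k g) N x = dual_avg T (Suc d) (mderivs T s k g') N x" for k N
  proof eventually_elim
    case (elim x)
    have "mderivs T s k g ((T ^^ n) x) = mderivs T s k g' ((T ^^ n) x)" for n
      unfolding mderivs_cube using elim by (simp flip: funpow_add o_apply[of "T ^^ _"])
    then show ?case by (simp add: dual_avg_def shift_def)
  qed
  then have "dual_fun M T (Suc d) (mderivs T s k g) = dual_fun M T (Suc d) (mderivs T s k g')" for k
    by (rule dual_fun_cong)
  then show ?thesis by (simp add: dual_cube_prod_def)
qed

end

text \<open>A system constrains \<open>T\<close> only on the space; off the space it is made the identity, hence a bijection of the type.\<close>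

lemma mp_system_extend:
  assumes "mp_system M T"
  defines "T' \<equiv> \<lambda>x. if x \<in> space M then T x else x"
  shows "mps M T'"
proof -
  interpret mp_system M T by fact
  have T_sp: "T x \<in> space M" if "x \<in> space M" for x using bij that by (auto simp: bij_betw_def)
  have inj: "inj_on T (space M)" and surj: "T ` space M = space M" using bij by (auto simp: bij_betw_def)
  have bij': "bij T'"
  proof (rule bijI)
    show "inj T'" using inj T_sp by (auto simp: inj_on_def T'_def split: if_splits)
    show "surj T'"
      unfolding surj_def
    proof
      fix y
      show "\<exists>x. y = T' x"
      proof (cases "y \<in> space M")
        case True
        then obtain x where "x \<in> space M" "T x = y" using surj by (metis imageE)
        then show ?thesis by (intro exI[of _ x]) (simp add: T'_def)
      qed (auto simp: T'_def intro!: exI[of _ y])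
    qed
  qed
  have meas': "T' \<in> measurable M M"
    using meas by (subst measurable_cong[of M T' T]) (auto simp: T'_def)
  have "inv T' x = the_inv_into (space M) T x" if "x \<in> space M" for x
  proof -
    have "x \<in> T ` space M" using surj that by simp
    then obtain z where z: "z \<in> space M" "x = T z" by (rule imageE) simp
    have "inv T' x = z" by (rule inv_f_eq[OF bij_is_inj[OF bij']]) (simp add: T'_def z)
    moreover have "the_inv_into (space M) T x = z" unfolding z(2) by (rule the_inv_into_f_f[OF inj z(1)])
    ultimately show ?thesis by simp
  qed
  then have inv': "inv T' \<in> measurable M M"
    using meas_inv by (subst measurable_cong[of M "inv T'" "the_inv_into (space M) T"]) auto
  have "distr M M T' = distr M M T" by (rule distr_cong) (auto simp: T'_def)
  then have "distr M M T' = M" using preserving by simp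
  moreover have "prob_space M" using lebesgue by (simp add: lebesgue_prob_space_def)
  ultimately show ?thesis
    using bij' meas' inv' by (intro mps.intro mps_axioms.intro) auto
qed

theorem proposition7p1:
  fixes M :: "'a measure" and T :: "'a \<Rightarrow> 'a" and f :: "'a \<Rightarrow> complex" and d s :: nat
  assumes "mp_system M T"
    and "f \<in> Linf M"
    and "ghk M T (d + s) f = 0"
  shows "(\<lambda>H. (\<Sum>h\<in>grid s H. \<Sum>h'\<in>grid s H. ghk M T d (dual_cube_prod M T d s f h h'))
            / of_nat H ^ (2 * s)) \<longlonglongrightarrow> 0"
proof -
  define T' where "T' = (\<lambda>x. if x \<in> space M then T x else x)"
  interpret mps M T' unfolding T'_def by (rule mp_system_extend[OF assms(1)])
  have T_sp: "T x \<in> space M" if "x \<in> space M" for x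
    using assms(1) that by (auto simp: mp_system_def bij_betw_def)
  have T'_eq: "T' x = T x" if "x \<in> space M" for x using that by (simp add: T'_def)
  obtain C0 where fm: "f \<in> borel_measurable M" and C0: "AE x in M. norm (f x) \<le> C0"
    using assms(2) by (auto simp: Linf_def)
  \<comment> \<open>\<open>prop_setup\<close> asks for \<open>1 \<le> C\<close> and a bound at every
    point, which the truncation \<open>f'\<close> supplies.\<close>
  define C where "C = max 1 C0"
  define f' where "f' x = (if norm (f x) \<le> C then f x else 0)" for x
  have f'm: "f' \<in> borel_measurable M" unfolding f'_def using fm by measurable
  have f'C: "norm (f' x) \<le> C" for x by (simp add: f'_def C_def le_max_iff_disj)
  have ff': "AE x in M. f x = f' x" using C0 by eventually_elim (auto simp: f'_def C_def)
  interpret prop_setup M T' f' C d s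
    by unfold_locales (use f'm f'C in \<open>auto simp: C_def intro: BM_I\<close>)
  have "ghk M T' (d + s) f' = ghk M T' (d + s) f" by (rule ghk_cong_AE[OF fm f'm ff', symmetric])
  also have "\<dots> = ghk M T (d + s) f" by (rule ghk_cong_space[OF T_sp T'_eq, symmetric]) simp_all
  also have "\<dots> = 0" by fact
  finally have zero: "ghk M T' (d + s) f' = 0" .
  have "ghk M T d (dual_cube_prod M T d s f h h') = ghk M T' d (dual_cube_prod M T' d s f' h h')" for h h'
  proof -
    have "dual_cube_prod M T d s f h h' = dual_cube_prod M T' d s f h h'"
      by (rule dual_cube_prod_cong_space[OF T_sp T'_eq]) simp_all
    also have "\<dots> = dual_cube_prod M T' d s f' h h'" by (rule dual_cube_prod_cong_AE[OF ff'])
    finally have e: "dual_cube_prod M T d s f h h' = dual_cube_prod M T' d s f' h h'" .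
    show ?thesis unfolding e by (rule ghk_cong_space[OF T_sp T'_eq]) simp_all
  qed
  then show ?thesis using average_tendsto[OF zero] by simp
qed

end
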